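(* Let $M=\mathbb H\mathrm H^m$, $m\ge1$, so that $n=4m\ge4$, $p=n-4$, $q=3$. Put $x=\sinh^2r$ and $\delta=1-\beta-\gamma=\alpha^2$. Then, at every point of $M\setminus\{o\}$ and for every unit normal $\nu=\alpha N+v+w$ there, with $\beta=|v|^2$, $\gamma=|w|^2$, $$\mathscr T_{n-4,3}=-\frac{\mathcal P^{\mathbb H}_{n,x}(\beta,\gamma)}{(n+2)^2(1+x)^4},$$ where $$\mathcal P^{\mathbb H}_{n,x}=A_{20}\beta^2+A_{11}\beta\gamma+A_{02}\gamma^2+A_{10}\beta\delta+A_{01}\gamma\delta,$$ and $$\begin{aligned} A_{20}={}&(1+x)(nx+n+2)\bigl[(n^2+n)(1+x)^2-6x-2\bigr],\\ A_{11}={}&(nx+n+2)\bigl[3n^2x^3+(8n^2+6n-24)x^2+(7n^2+8n-16)x+2n^2+2n-4\bigr],\\ A_{02}={}&(nx+n+2)\bigl[2n^2x^3+(5n^2+4n-16)x^2+(4n^2+5n-8)x+n^2+n-2\bigr],\\ A_{10}={}&n^3x^4+(4n^3+5n^2-16n)x^3+(6n^3+14n^2-16n-48)x^2\\&+(4n^3+13n^2+4n-12)x+n^3+4n^2+4n,\\ A_{01}={}&(2n^3-4n^2)x^4+(7n^3-48n)x^3+(9n^3+16n^2-48n-96)x^2\\&+(5n^3+16n^2+4n-16)x+n^3+4n^2+4n. \end{aligned}$$ Consequently $$\mathscr T_{n-4,3}\le0,\qquad\mathscr T_{n-4,3}=0\iff\beta=\gamma=0.$$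
   Context: $M=\mathbb H\mathrm H^m$ is quaternionic hyperbolic space of real dimension $n=4m$, with metric $g$ normalized so that for every unit $\theta\in T_oM$ the radial curvature operator $X\mapsto R(X,\theta)\theta$ on $\theta^\perp$ has sectional-curvature eigenvalues $-1$ (multiplicity $p=n-4$) and $-4$ (multiplicity $q=3$); for $m=1$ only $-4$ occurs. Fix $o\in M$; $\mathbb S_o^{n-1}\subset T_oM$ is the unit sphere with round metric and $T_\theta\mathbb S_o^{n-1}=\mathcal H_\theta\oplus\mathcal V_\theta$ is the orthogonal splitting into the $-1$ and $-4$ eigenspaces. In polar coordinates $(r,\theta)$ about $o$, $g=dr^2+\sinh^2r\,g_{\mathcal H}+\sinh^2r\cosh^2r\,g_{\mathcal V}$, with $g_{\mathcal H},g_{\mathcal V}$ the restrictions of the round metric. The volume radius $R(r)$ is defined by $R^n=n\int_0^r\sinh^{n-1}s\cosh^3s\,ds$. For $\varphi\in C^1(\mathbb S_o^{n-1})$ let $F_{t,\varphi}(R,\theta)=(e^{t\varphi(\theta)}R,\theta)$ in coordinates $(R,\theta)$ on $M\setminus\{o\}$. For a unit vector $\nu$ at a point of $M\setminus\{o\}$ write $\nu=\alpha N+v+w$ with $N=\partial_r$ and $v,w$ in the subspaces tangent to the geodesic sphere corresponding to $\mathcal H_\theta,\mathcal V_\theta$. With $\Pi=\nu^\perp$, put $J_\Pi(t,\varphi)=|\operatorname{cof}DF_{t,\varphi}\,\nu|$, $\operatorname{cof}L=(\det L)L^{-T}$ (with respect to $g$ at source and target), i.e. the $(n-1)$-dimensional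 Jacobian of $DF_{t,\varphi}|_\Pi$. With $\varphi_j(\theta)=\langle\theta,e_j\rangle$ for an orthonormal basis $e_1,\dots,e_n$ of $T_oM$ and primes denoting $t$-derivatives, $$\mathscr T_{n-4,3}=\sum_{j=1}^nJ_\Pi''(0,\varphi_j)-nJ_\Pi'(0,1),$$ where $1$ denotes the constant function. *)

theory Defs
  imports "HOL-Analysis.Analysis"
begin

section \<open>Riemannian geometry in a single chart\<close>

text \<open>
  A manifold covered by one chart is an open set \<open>M\<close> of a Euclidean space. All tangent spaces are
  identified with that space, and a metric \<open>g\<close> assigns an inner product \<open>g y\<close> to every point.
\<close>

type_synonym 'a metric = "'a \<Rightarrow> 'a \<Rightarrow> 'a \<Rightarrow> real"

text \<open>
  \<open>christoffel g y u v\<close> is the covariant derivative at \<open>y\<close> of the constant field \<open>v\<close> in direction \<open>u\<close>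
  for the Levi-Civita connection (Koszul formula for constant fields).
\<close>
definition christoffel :: "('a::euclidean_space) metric \<Rightarrow> 'a \<Rightarrow> 'a \<Rightarrow> 'a \<Rightarrow> 'a" where
  "christoffel g y u v =
     (THE w. \<forall>z. 2 * g y w z =
        frechet_derivative (\<lambda>x. g x v z) (at y) u
      + frechet_derivative (\<lambda>x. g x u z) (at y) v
      - frechet_derivative (\<lambda>x. g x u v) (at y) z)"

text \<open>
  Sign convention: \<open>R(X,Y)Z = \<nabla>\<^sub>X \<nabla>\<^sub>Y Z - \<nabla>\<^sub>Y \<nabla>\<^sub>X Z - \<nabla>\<^sub>[\<^sub>X\<^sub>,\<^sub>Y\<^sub>] Z\<close>, evaluated on constant fields, so that
  \<open>g(R(X,Y)Y, X)\<close> is the sectional curvature of an orthonormal pair.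
\<close>
definition riemann_tensor ::
    "('a::euclidean_space) metric \<Rightarrow> 'a \<Rightarrow> 'a \<Rightarrow> 'a \<Rightarrow> 'a \<Rightarrow> 'a" where
  "riemann_tensor g y X Y Z =
     frechet_derivative (\<lambda>x. christoffel g x Y Z) (at y) X
   - frechet_derivative (\<lambda>x. christoffel g x X Z) (at y) Y
   + christoffel g y X (christoffel g y Y Z)
   - christoffel g y Y (christoffel g y X Z)"

definition radial_eigenspace ::
    "('a::euclidean_space) metric \<Rightarrow> 'a \<Rightarrow> 'a \<Rightarrow> real \<Rightarrow> 'a set" where
  "radial_eigenspace g p \<theta> \<kappa> =
     {X. g p X \<theta> = 0 \<and> riemann_tensor g p X \<theta> \<theta> = \<kappa> *\<^sub>R X}"

definition geodesic_segment ::
    "'a set \<Rightarrow> ('a::euclidean_space) metric \<Rightarrow> (real \<Rightarrow> 'a) \<Rightarrow> (real \<Rightarrow> 'a) \<Rightarrow> bool" where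
  "geodesic_segment M g c c' \<longleftrightarrow>
     (\<forall>t\<in>{0..1}. c t \<in> M
        \<and> (c has_vector_derivative c' t) (at t within {0..1})
        \<and> (c' has_vector_derivative - christoffel g (c t) (c' t) (c' t)) (at t within {0..1}))"

definition riemann_exp ::
    "'a set \<Rightarrow> ('a::euclidean_space) metric \<Rightarrow> 'a \<Rightarrow> 'a \<Rightarrow> 'a" where
  "riemann_exp M g p u =
     (THE y. \<exists>c c'. geodesic_segment M g c c' \<and> c 0 = p \<and> c' 0 = u \<and> c 1 = y)"

definition polar_coords ::
    "'a set \<Rightarrow> ('a::euclidean_space) metric \<Rightarrow> 'a \<Rightarrow> 'a \<Rightarrow> real \<times> 'a" where
  "polar_coords M g p y =
     (THE (r, \<theta>). 0 < r \<and> g p \<theta> \<theta> = 1 \<and> riemann_exp M g p (r *\<^sub>R \<theta>) = y)"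

text \<open>
  The radial field \<open>\<partial>\<^sub>r\<close>, and the subspace tangent to the geodesic sphere through \<open>y\<close> that corresponds,
  under polar coordinates, to the \<open>\<kappa>\<close>-eigenspace at the direction \<open>\<theta>\<close> of \<open>y\<close>. The coordinate map
  \<open>(r, \<theta>) \<mapsto> exp\<^sub>p (r \<theta>)\<close> differs from \<open>exp\<^sub>p\<close> on tangent vectors to the sphere only by the factor \<open>r\<close>.
\<close>
definition radial_field ::
    "'a set \<Rightarrow> ('a::euclidean_space) metric \<Rightarrow> 'a \<Rightarrow> 'a \<Rightarrow> 'a" where
  "radial_field M g p y =
     (let (r, \<theta>) = polar_coords M g p y
      in vector_derivative (\<lambda>s. riemann_exp M g p (s *\<^sub>R \<theta>)) (at r))"

definition sphere_subspace ::
    "'a set \<Rightarrow> ('a::euclidean_space) metric \<Rightarrow> 'a \<Rightarrow> real \<Rightarrow> 'a \<Rightarrow> 'a set" where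
  "sphere_subspace M g p \<kappa> y =
     (let (r, \<theta>) = polar_coords M g p y
      in frechet_derivative (riemann_exp M g p) (at (r *\<^sub>R \<theta>)) ` radial_eigenspace g p \<theta> \<kappa>)"

section \<open>Cofactor of a linear map between inner product spaces\<close>

text \<open>
  Below, \<open>B\<close> is the inner product at the source of \<open>L\<close> and \<open>C\<close> the one at its target.
  \<open>gram_matrix B\<close> is the Gram matrix of the coordinate basis, so that \<open>det_wrt B C L\<close> is the
  determinant of \<open>L\<close> in positively oriented orthonormal bases for \<open>B\<close> and \<open>C\<close>.
\<close>

definition gram_matrix :: "(real^'n \<Rightarrow> real^'n \<Rightarrow> real) \<Rightarrow> real^'n^'n" where
  "gram_matrix B = (\<chi> i j. B (axis i 1) (axis j 1))"

definition det_wrt ::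
    "(real^'n \<Rightarrow> real^'n \<Rightarrow> real) \<Rightarrow> (real^'n \<Rightarrow> real^'n \<Rightarrow> real) \<Rightarrow> (real^'n \<Rightarrow> real^'n) \<Rightarrow> real" where
  "det_wrt B C L =
     det (matrix L) * sqrt (det (gram_matrix C)) / sqrt (det (gram_matrix B))"

definition adjoint_wrt ::
    "('a \<Rightarrow> 'a \<Rightarrow> real) \<Rightarrow> ('b \<Rightarrow> 'b \<Rightarrow> real) \<Rightarrow> ('a \<Rightarrow> 'b) \<Rightarrow> 'b \<Rightarrow> 'a" where
  "adjoint_wrt B C L b = (THE a. \<forall>x. C (L x) b = B x a)"

definition cof_wrt ::
    "(real^'n \<Rightarrow> real^'n \<Rightarrow> real) \<Rightarrow> (real^'n \<Rightarrow> real^'n \<Rightarrow> real) \<Rightarrow> (real^'n \<Rightarrow> real^'n)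
      \<Rightarrow> real^'n \<Rightarrow> real^'n" where
  "cof_wrt B C L \<nu> = det_wrt B C L *\<^sub>R adjoint_wrt C B (inv L) \<nu>"

section \<open>The ball model of quaternionic hyperbolic space\<close>

text \<open>
  A quaternion \<open>a + b i + c j + d k\<close> is the vector with components \<open>a, b, c, d\<close>. A vector \<open>u\<close> of
  quaternionic \<open>m\<close>-space, \<open>m = CARD('m)\<close>, has the entries \<open>u $ (l, 1), ..., u $ (l, 4)\<close> as the
  components of its \<open>l\<close>-th quaternionic coordinate.
\<close>

type_synonym quat = "real^4"

definition quat_mult :: "quat \<Rightarrow> quat \<Rightarrow> quat" where
  "quat_mult a b = vector
     [a$1 * b$1 - a$2 * b$2 - a$3 * b$3 - a$4 * b$4,
      a$1 * b$2 + a$2 * b$1 + a$3 * b$4 - a$4 * b$3,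
      a$1 * b$3 - a$2 * b$4 + a$3 * b$1 + a$4 * b$2,
      a$1 * b$4 + a$2 * b$3 - a$3 * b$2 + a$4 * b$1]"

definition quat_cnj :: "quat \<Rightarrow> quat" where
  "quat_cnj a = vector [a$1, - a$2, - a$3, - a$4]"

definition quat_coord :: "real^('m::finite \<times> 4) \<Rightarrow> 'm \<Rightarrow> quat" where
  "quat_coord u l = (\<chi> k. u $ (l, k))"

definition quat_herm :: "real^('m::finite \<times> 4) \<Rightarrow> real^('m \<times> 4) \<Rightarrow> quat" where
  "quat_herm u v = (\<Sum>l\<in>UNIV. quat_mult (quat_cnj (quat_coord u l)) (quat_coord v l))"

text \<open>
  Lines in quaternionic \<open>(m+1)\<close>-space that are negative for the form of signature \<open>(m, 1)\<close>, in the
  affine chart \<open>y \<mapsto> [y : 1]\<close>, form the open unit ball with this metric. The sectional curvature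
  lies between \<open>-4\<close> and \<open>-1\<close>; the value \<open>-4\<close> is attained on quaternionic lines.
\<close>

definition qh_space :: "(real^('m::finite \<times> 4)) set" where
  "qh_space = ball 0 1"

definition qh_metric :: "(real^('m::finite \<times> 4)) metric" where
  "qh_metric y u v =
     (u \<bullet> v) / (1 - (norm y)\<^sup>2) + (quat_herm y u \<bullet> quat_herm y v) / (1 - (norm y)\<^sup>2)\<^sup>2"

abbreviation qh_exp :: "real^('m::finite \<times> 4) \<Rightarrow> real^('m \<times> 4) \<Rightarrow> real^('m \<times> 4)" where
  "qh_exp \<equiv> riemann_exp qh_space qh_metric"

abbreviation qh_polar :: "real^('m::finite \<times> 4) \<Rightarrow> real^('m \<times> 4) \<Rightarrow> real \<times> (real^('m \<times> 4))" where
  "qh_polar \<equiv> polar_coords qh_space qh_metric"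

abbreviation qh_radial :: "real^('m::finite \<times> 4) \<Rightarrow> real^('m \<times> 4) \<Rightarrow> real^('m \<times> 4)" where
  "qh_radial \<equiv> radial_field qh_space qh_metric"

abbreviation qh_sub :: "real^('m::finite \<times> 4) \<Rightarrow> real \<Rightarrow> real^('m \<times> 4) \<Rightarrow> (real^('m \<times> 4)) set" where
  "qh_sub \<equiv> sphere_subspace qh_space qh_metric"

section \<open>Radial dilations in the volume radius\<close>

definition volume_radius :: "nat \<Rightarrow> real \<Rightarrow> real" where
  "volume_radius n r =
     root n (real n * integral {0..r} (\<lambda>s. sinh s ^ (n - 1) * cosh s ^ 3))"

definition radius_of_volume_radius :: "nat \<Rightarrow> real \<Rightarrow> real" where
  "radius_of_volume_radius n R = (THE r. 0 \<le> r \<and> volume_radius n r = R)"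

text \<open>
  \<open>F\<^sub>t\<^sub>,\<^sub>\<phi>\<close> for the base point \<open>p\<close>. Only the values of \<open>\<phi>\<close> on the unit sphere of the tangent space at \<open>p\<close>
  enter.
\<close>
definition qh_dilation ::
    "real^('m::finite \<times> 4) \<Rightarrow> real \<Rightarrow> (real^('m \<times> 4) \<Rightarrow> real) \<Rightarrow> real^('m \<times> 4) \<Rightarrow> real^('m \<times> 4)" where
  "qh_dilation p t \<phi> y =
     (let n = CARD('m \<times> 4); (r, \<theta>) = qh_polar p y
      in qh_exp p (radius_of_volume_radius n (exp (t * \<phi> \<theta>) * volume_radius n r) *\<^sub>R \<theta>))"

definition hyperplane_jacobian ::
    "real^('m::finite \<times> 4) \<Rightarrow> real^('m \<times> 4) \<Rightarrow> real^('m \<times> 4) \<Rightarrow> real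
      \<Rightarrow> (real^('m \<times> 4) \<Rightarrow> real) \<Rightarrow> real" where
  "hyperplane_jacobian p y \<nu> t \<phi> =
     (let z = qh_dilation p t \<phi> y;
          L = frechet_derivative (qh_dilation p t \<phi>) (at y);
          c = cof_wrt (qh_metric y) (qh_metric z) L \<nu>
      in sqrt (qh_metric z c c))"

definition qh_orthonormal_basis ::
    "real^('m::finite \<times> 4) \<Rightarrow> (nat \<Rightarrow> real^('m \<times> 4)) \<Rightarrow> bool" where
  "qh_orthonormal_basis p e \<longleftrightarrow>
     (\<forall>i\<in>{1..CARD('m \<times> 4)}. \<forall>j\<in>{1..CARD('m \<times> 4)}.
        qh_metric p (e i) (e j) = (if i = j then 1 else 0))"

definition trace_defect ::
    "real^('m::finite \<times> 4) \<Rightarrow> (nat \<Rightarrow> real^('m \<times> 4)) \<Rightarrow> real^('m \<times> 4) \<Rightarrow> real^('m \<times> 4) \<Rightarrow> real" where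
  "trace_defect p e y \<nu> =
     (\<Sum>j = 1..CARD('m \<times> 4).
        deriv (deriv (\<lambda>t. hyperplane_jacobian p y \<nu> t (\<lambda>\<theta>. qh_metric p \<theta> (e j)))) 0)
   - real CARD('m \<times> 4) * deriv (\<lambda>t. hyperplane_jacobian p y \<nu> t (\<lambda>\<theta>. 1)) 0"

section \<open>The polynomial\<close>

definition A20 :: "real \<Rightarrow> real \<Rightarrow> real" where
  "A20 n x = (1 + x) * (n*x + n + 2) * ((n^2 + n) * (1 + x)^2 - 6*x - 2)"

definition A11 :: "real \<Rightarrow> real \<Rightarrow> real" where
  "A11 n x = (n*x + n + 2) *
     (3*n^2 * x^3 + (8*n^2 + 6*n - 24) * x^2 + (7*n^2 + 8*n - 16) * x + 2*n^2 + 2*n - 4)"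

definition A02 :: "real \<Rightarrow> real \<Rightarrow> real" where
  "A02 n x = (n*x + n + 2) *
     (2*n^2 * x^3 + (5*n^2 + 4*n - 16) * x^2 + (4*n^2 + 5*n - 8) * x + n^2 + n - 2)"

definition A10 :: "real \<Rightarrow> real \<Rightarrow> real" where
  "A10 n x = n^3 * x^4 + (4*n^3 + 5*n^2 - 16*n) * x^3 + (6*n^3 + 14*n^2 - 16*n - 48) * x^2
     + (4*n^3 + 13*n^2 + 4*n - 12) * x + n^3 + 4*n^2 + 4*n"

definition A01 :: "real \<Rightarrow> real \<Rightarrow> real" where
  "A01 n x = (2*n^3 - 4*n^2) * x^4 + (7*n^3 - 48*n) * x^3
     + (9*n^3 + 16*n^2 - 48*n - 96) * x^2 + (5*n^3 + 16*n^2 + 4*n - 16) * x + n^3 + 4*n^2 + 4*n"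

definition P_H :: "real \<Rightarrow> real \<Rightarrow> real \<Rightarrow> real \<Rightarrow> real" where
  "P_H n x \<beta> \<gamma> =
     (let \<delta> = 1 - \<beta> - \<gamma>
      in A20 n x * \<beta>^2 + A11 n x * \<beta> * \<gamma> + A02 n x * \<gamma>^2 + A10 n x * \<beta> * \<delta> + A01 n x * \<gamma> * \<delta>)"

end

theory Submission
  imports Defs
begin

text \<open>
  Write \<open>h\<close> for the quaternionic Hermitian form, \<open>s = 1 - |p|\<^sup>2\<close>, and
  \<open>H(u,v) = h(u,v)/s + h(u,p) h(p,v)/s\<^sup>2\<close>, a Hermitian form whose real part is the metric at \<open>p\<close>.
  The projective map \<open>B(z) = p + z (1 + h(p,z)/s)\<^sup>-\<^sup>1\<close> (\<open>recentre\<close>) carries the ball \<open>H(z,z) < 1\<close>, equipped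
  with the ball metric built from \<open>H\<close>, isometrically onto the given ball and sends \<open>0\<close> to \<open>p\<close>
  (\<open>recentre_isometry\<close>). Through \<open>B\<close> everything becomes radial: \<open>exp\<^sub>p(r \<theta>) = B(tanh r \<theta>)\<close>, so polar
  coordinates, the radial field and the dilations are explicit.

  The first ingredient is the connection: \<open>\<nabla>\<^sub>u v\<close> of constant fields is \<open>(u h(y,v) + v h(y,u))/(1 - |y|\<^sup>2)\<close>
  (\<open>christoffel_qh\<close>). Differentiating once gives \<open>R(X,\<theta>)\<theta> = - X - 3 \<theta> H(\<theta>,X)\<close> for \<open>X\<close> orthogonal to \<open>\<theta>\<close>,
  hence the eigenspaces \<open>H(\<theta>,X) = 0\<close> and \<open>X = \<theta> q\<close> with \<open>q\<close> imaginary. The curves \<open>t \<mapsto> B(tanh(kt)/k u)\<close> solve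
  the geodesic equation, and a Gronwall estimate shows that there are no others; this identifies \<open>exp\<^sub>p\<close>.

  In the recentred ball the dilation multiplies \<open>z\<close> by a scalar function, so that its derivative is a
  multiple of the identity plus an operator of rank one. Its volume distortion is exactly \<open>exp(n t \<phi>)\<close>,
  because the volume radius is defined by the volume. The conormal \<open>L\<^sup>-\<^sup>T \<nu>\<close> can be written down, and
  the squared hyperplane Jacobian along \<open>\<theta>\<close> is, with \<open>\<tau> = t \<phi>(\<theta>)\<close>,
  \<open>\<alpha>\<^sup>2 f\<^sub>1(\<tau>) + f\<^sub>2(\<tau>) |v - t \<alpha> c\<^sub>H \<nabla>\<phi>|\<^sup>2 + f\<^sub>3(\<tau>) |w - t \<alpha> c\<^sub>V \<nabla>\<phi>|\<^sup>2\<close>, where \<open>\<nabla>\<phi>\<close> stands for its parts in the two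
  eigenspaces (\<open>hyperplane_jacobian_eq\<close>, \<open>conormal_norm\<close>).
  All three \<open>f\<^sub>i\<close> are functions of \<open>X = sinh\<^sup>2 \<rho>(\<tau>)\<close>, which satisfies the autonomous equation
  \<open>X' = 2 X (1 + n X/(n+2))/(1 + X)\<close>; this makes the first two \<open>t\<close>-derivatives rational in \<open>x = sinh\<^sup>2 r\<close>.

  Summing over the orthonormal basis, Parseval's identity at \<open>p\<close> removes the basis (\<open>parseval\<close>,
  \<open>sum_norm_H\<close>), and what remains is a quadratic form in \<open>\<beta>, \<gamma>, \<delta>\<close> after homogenizing with
  \<open>\<beta> + \<gamma> + \<delta> = 1\<close>. Its coefficient of \<open>\<delta>\<^sup>2\<close> vanishes and, up to a common denominator, the
  other five are the negatives of the given polynomials (\<open>coefficient_identities\<close>). The polynomials are positive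
  for \<open>n \<ge> 4\<close> and \<open>x > 0\<close>, which gives the sign and the equality case.
\<close>

section \<open>The division algebra of quaternions\<close>

text \<open>
  A copy of \<open>quat\<close>: on vectors the symbol \<open>*\<close> is already the componentwise product, so a separate type is
  needed for the quaternions to form a normed division algebra with its calculus of inverses.
\<close>
codatatype quaternion = Quaternion (qre: real) (qi: real) (qj: real) (qk: real)

lemma quaternion_eq_iff:
  "a = b \<longleftrightarrow> qre a = qre b \<and> qi a = qi b \<and> qj a = qj b \<and> qk a = qk b"
  using quaternion.expand by blast

instantiation quaternion :: real_vector
begin

primcorec zero_quaternion where
  "qre 0 = 0" | "qi 0 = 0" | "qj 0 = 0" | "qk 0 = 0"

primcorec plus_quaternion where
  "qre (a + b) = qre a + qre b" | "qi (a + b) = qi a + qi b"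
| "qj (a + b) = qj a + qj b" | "qk (a + b) = qk a + qk b"

primcorec minus_quaternion where
  "qre (a - b) = qre a - qre b" | "qi (a - b) = qi a - qi b"
| "qj (a - b) = qj a - qj b" | "qk (a - b) = qk a - qk b"

primcorec uminus_quaternion where
  "qre (- a) = - qre a" | "qi (- a) = - qi a" | "qj (- a) = - qj a" | "qk (- a) = - qk a"

primcorec scaleR_quaternion where
  "qre (c *\<^sub>R a) = c * qre a" | "qi (c *\<^sub>R a) = c * qi a"
| "qj (c *\<^sub>R a) = c * qj a" | "qk (c *\<^sub>R a) = c * qk a"

instance by standard (simp_all add: quaternion_eq_iff algebra_simps)

end

definition quat_of :: "quaternion \<Rightarrow> quat" where
  "quat_of a = vector [qre a, qi a, qj a, qk a]"

definition of_quat :: "quat \<Rightarrow> quaternion" where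
  "of_quat a = Quaternion (a $ 1) (a $ 2) (a $ 3) (a $ 4)"

lemma vector_4_nth [simp]:
  "(vector [a, b, c, d] :: quat) $ 1 = a" "(vector [a, b, c, d] :: quat) $ 2 = b"
  "(vector [a, b, c, d] :: quat) $ 3 = c" "(vector [a, b, c, d] :: quat) $ 4 = d"
  unfolding vector_def by simp_all

lemma quat_of_nth [simp]:
  "quat_of a $ 1 = qre a" "quat_of a $ 2 = qi a" "quat_of a $ 3 = qj a" "quat_of a $ 4 = qk a"
  by (simp_all add: quat_of_def)

lemma of_quat_sel [simp]:
  "qre (of_quat a) = a $ 1" "qi (of_quat a) = a $ 2" "qj (of_quat a) = a $ 3" "qk (of_quat a) = a $ 4"
  by (simp_all add: of_quat_def)

lemma norm_quat_of: "norm (quat_of a) = sqrt ((qre a)^2 + (qi a)^2 + (qj a)^2 + (qk a)^2)"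
  by (simp add: norm_vec_def L2_set_def sum_4)

lemma quat_of_linear:
  "quat_of (a + b) = quat_of a + quat_of b" "quat_of (c *\<^sub>R a) = c *\<^sub>R quat_of a"
  by (simp_all add: vec_eq_iff forall_4)

lemma quat_of_eq_0_iff: "quat_of a = 0 \<longleftrightarrow> a = 0"
  by (simp add: vec_eq_iff forall_4 quaternion_eq_iff)

instantiation quaternion :: real_normed_vector
begin

definition "norm a = norm (quat_of a)"
definition sgn_quaternion_def: "sgn a = a /\<^sub>R norm (a :: quaternion)"
definition dist_quaternion_def: "dist a b = norm (a - b :: quaternion)"
definition uniformity_quaternion_def [code del]:
  "(uniformity :: (quaternion \<times> quaternion) filter) = (INF e\<in>{0 <..}. principal {(a, b). dist a b < e})"
definition open_quaternion_def [code del]: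
  "open (U :: quaternion set) \<longleftrightarrow> (\<forall>a\<in>U. eventually (\<lambda>(a', b). a' = a \<longrightarrow> b \<in> U) uniformity)"

instance
proof
  fix a b :: quaternion and c :: real and U :: "quaternion set"
  show "norm (a + b) \<le> norm a + norm b"
    by (simp add: norm_quaternion_def quat_of_linear norm_triangle_ineq)
  show "norm (c *\<^sub>R a) = \<bar>c\<bar> * norm a" "norm a = 0 \<longleftrightarrow> a = 0"
    by (simp_all add: norm_quaternion_def quat_of_linear quat_of_eq_0_iff)
  show "sgn a = a /\<^sub>R norm a" by (rule sgn_quaternion_def)
  show "dist a b = norm (a - b)" by (rule dist_quaternion_def)
  show "(uniformity :: (quaternion \<times> quaternion) filter) = (INF e\<in>{0 <..}. principal {(a, b). dist a b < e})"
    by (rule uniformity_quaternion_def)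
  show "open U \<longleftrightarrow> (\<forall>a\<in>U. eventually (\<lambda>(a', b). a' = a \<longrightarrow> b \<in> U) uniformity)"
    by (rule open_quaternion_def)
qed

end

primcorec qcnj :: "quaternion \<Rightarrow> quaternion" where
  "qre (qcnj a) = qre a" | "qi (qcnj a) = - qi a" | "qj (qcnj a) = - qj a" | "qk (qcnj a) = - qk a"

lemma norm_quaternion_sq: "(norm a)^2 = (qre a)^2 + (qi a)^2 + (qj a)^2 + (qk a)^2"
  by (simp add: norm_quaternion_def norm_quat_of)

instantiation quaternion :: real_normed_div_algebra
begin

primcorec one_quaternion where
  "qre 1 = 1" | "qi 1 = 0" | "qj 1 = 0" | "qk 1 = 0"

primcorec times_quaternion where
  "qre (a * b) = qre a * qre b - qi a * qi b - qj a * qj b - qk a * qk b"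
| "qi (a * b) = qre a * qi b + qi a * qre b + qj a * qk b - qk a * qj b"
| "qj (a * b) = qre a * qj b - qi a * qk b + qj a * qre b + qk a * qi b"
| "qk (a * b) = qre a * qk b + qi a * qj b - qj a * qi b + qk a * qre b"

definition inverse_quaternion_def: "inverse a = qcnj a /\<^sub>R (norm a)^2"
definition divide_quaternion_def: "a div b = a * inverse (b :: quaternion)"

instance
proof
  fix a b c :: quaternion and r :: real
  show "a * b * c = a * (b * c)" "(a + b) * c = a * c + b * c" "a * (b + c) = a * b + a * c"
    by (simp_all add: quaternion_eq_iff algebra_simps)
  show "r *\<^sub>R a * b = r *\<^sub>R (a * b)" "a * r *\<^sub>R b = r *\<^sub>R (a * b)"
    by (simp_all add: quaternion_eq_iff algebra_simps)
  show "1 * a = a" "a * 1 = a" "(0 :: quaternion) \<noteq> 1"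
    by (simp_all add: quaternion_eq_iff)
  have *: "a * qcnj a = (norm a)^2 *\<^sub>R 1" "qcnj a * a = (norm a)^2 *\<^sub>R 1"
    unfolding norm_quaternion_sq by (simp_all add: quaternion_eq_iff power2_eq_square)
  show "inverse a * a = 1" "a * inverse a = 1" if "a \<noteq> 0"
  proof -
    have "(norm a)^2 \<noteq> 0" using that by simp
    moreover have "(c *\<^sub>R qcnj a) * a = c *\<^sub>R (qcnj a * a)" "a * (c *\<^sub>R qcnj a) = c *\<^sub>R (a * qcnj a)" for c
      by (simp_all add: quaternion_eq_iff algebra_simps)
    ultimately show "inverse a * a = 1" "a * inverse a = 1"
      by (simp_all add: inverse_quaternion_def *)
  qed
  show "inverse (0 :: quaternion) = 0"
    by (simp add: inverse_quaternion_def quaternion_eq_iff)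
  show "a div b = a * inverse b" by (rule divide_quaternion_def)
  have "(norm (a * b))^2 = (norm a * norm b)^2"
    unfolding power_mult_distrib norm_quaternion_sq by simp algebra
  then show "norm (a * b) = norm a * norm b"
    by (simp add: power2_eq_imp_eq)
qed

end

lemma qcnj_linear [simp]:
  "qcnj (a + b) = qcnj a + qcnj b" "qcnj (a - b) = qcnj a - qcnj b" "qcnj (- a) = - qcnj a"
  "qcnj (c *\<^sub>R a) = c *\<^sub>R qcnj a" "qcnj 0 = 0" "qcnj 1 = 1" "qcnj (qcnj a) = a"
  "qcnj (of_real c) = of_real c"
  by (simp_all add: quaternion_eq_iff of_real_def)

lemma qcnj_mult [simp]: "qcnj (a * b) = qcnj b * qcnj a"
  by (simp add: quaternion_eq_iff algebra_simps)

lemma norm_qcnj [simp]: "norm (qcnj a) = norm a"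
  by (simp add: norm_quaternion_def norm_quat_of)

lemma qcnj_mult_self: "qcnj a * a = of_real ((norm a)^2)" "a * qcnj a = of_real ((norm a)^2)"
  unfolding norm_quaternion_sq by (simp_all add: quaternion_eq_iff of_real_def power2_eq_square)

lemma qcnj_eq: "qcnj a = of_real (2 * qre a) - a"
  by (simp add: quaternion_eq_iff of_real_def)

lemma inverse_quaternion: "inverse a = qcnj a /\<^sub>R (norm a)^2"
  by (simp add: inverse_quaternion_def)

lemma qre_of_real [simp]: "qre (of_real c) = c"
  by (simp add: of_real_def)

lemma qre_commute: "qre (a * b) = qre (b * a)"
  by (simp add: algebra_simps)

lemma abs_qre_le: "\<bar>qre a\<bar> \<le> norm a"
proof -
  have "(qre a)^2 \<le> (norm a)^2" unfolding norm_quaternion_sq by simp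
  then show ?thesis by (metis abs_le_square_iff abs_norm_cancel)
qed

lemma bounded_linear_qre: "bounded_linear qre"
  by (rule bounded_linear_intro[where K = 1]) (simp_all add: abs_qre_le)

lemma bounded_linear_qcnj: "bounded_linear qcnj"
  by (rule bounded_linear_intro[where K = 1]) simp_all

lemmas has_derivative_qre [derivative_intros] = bounded_linear.has_derivative [OF bounded_linear_qre]
lemmas has_derivative_qcnj [derivative_intros] = bounded_linear.has_derivative [OF bounded_linear_qcnj]

lemma of_real_mult_commute: "of_real c * a = a * (of_real c :: quaternion)"
  by (simp add: quaternion_eq_iff of_real_def)

section \<open>Quaternionic space as a right module\<close>

definition qcoord :: "real^('m::finite \<times> 4) \<Rightarrow> 'm \<Rightarrow> quaternion" where
  "qcoord u l = of_quat (quat_coord u l)"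

definition rscale :: "real^('m::finite \<times> 4) \<Rightarrow> quaternion \<Rightarrow> real^('m \<times> 4)" (infixl "\<star>" 75) where
  "u \<star> a = (\<chi> i. quat_of (qcoord u (fst i) * a) $ snd i)"

definition herm :: "real^('m::finite \<times> 4) \<Rightarrow> real^('m \<times> 4) \<Rightarrow> quaternion" where
  "herm u v = (\<Sum>l\<in>UNIV. qcnj (qcoord u l) * qcoord v l)"

lemma qcoord_eqI: "(\<And>l. qcoord u l = qcoord v l) \<Longrightarrow> u = v"
  by (simp add: vec_eq_iff qcoord_def quaternion_eq_iff quat_coord_def forall_4)

lemma qcoord_linear [simp]:
  "qcoord (u + v) l = qcoord u l + qcoord v l" "qcoord (u - v) l = qcoord u l - qcoord v l"
  "qcoord (- u) l = - qcoord u l" "qcoord (c *\<^sub>R u) l = c *\<^sub>R qcoord u l" "qcoord 0 l = 0"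
  by (simp_all add: qcoord_def quaternion_eq_iff quat_coord_def)

lemma qcoord_rscale [simp]: "qcoord (u \<star> a) l = qcoord u l * a"
proof -
  have "quat_coord (u \<star> a) l = quat_of (qcoord u l * a)"
    by (simp add: vec_eq_iff quat_coord_def rscale_def)
  then show ?thesis
    by (simp add: qcoord_def[of "u \<star> a"] quaternion_eq_iff)
qed

lemma rscale_assoc: "u \<star> a \<star> b = u \<star> (a * b)"
  by (rule qcoord_eqI) (simp add: mult.assoc)

lemma rscale_simps [simp]: "u \<star> 1 = u" "u \<star> 0 = 0" "0 \<star> a = 0" "u \<star> of_real c = c *\<^sub>R u"
  "u \<star> (- a) = - (u \<star> a)" "(- u) \<star> a = - (u \<star> a)" "u \<star> (c *\<^sub>R a) = c *\<^sub>R (u \<star> a)" "(c *\<^sub>R u) \<star> a = c *\<^sub>R (u \<star> a)"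
  by (rule qcoord_eqI; simp add: of_real_def)+

lemma rscale_distrib: "u \<star> (a + b) = u \<star> a + u \<star> b" "(u + v) \<star> a = u \<star> a + v \<star> a"
   "u \<star> (a - b) = u \<star> a - u \<star> b" "(u - v) \<star> a = u \<star> a - v \<star> a"
  by (rule qcoord_eqI; simp add: algebra_simps)+

lemma herm_linear [simp]:
  "herm (u + v) w = herm u w + herm v w" "herm u (v + w) = herm u v + herm u w"
  "herm (u - v) w = herm u w - herm v w" "herm u (v - w) = herm u v - herm u w"
  "herm (c *\<^sub>R u) v = c *\<^sub>R herm u v" "herm u (c *\<^sub>R v) = c *\<^sub>R herm u v"
  by (simp_all add: herm_def sum.distrib sum_subtractf algebra_simps scaleR_sum_right)

lemma herm_rscale [simp]: "herm u (v \<star> a) = herm u v * a" "herm (u \<star> a) v = qcnj a * herm u v"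
  by (simp_all add: herm_def sum_distrib_left sum_distrib_right mult.assoc)

lemma qcnj_sum: "qcnj (sum f A) = (\<Sum>x\<in>A. qcnj (f x))"
  by (induction A rule: infinite_finite_induct) simp_all

lemma qre_sum: "qre (sum f A) = (\<Sum>x\<in>A. qre (f x))"
  by (induction A rule: infinite_finite_induct) simp_all

lemma herm_sym: "herm v u = qcnj (herm u v)"
  by (simp add: herm_def qcnj_sum)

lemma qre_herm: "qre (herm u v) = u \<bullet> v"
proof -
  have "u \<bullet> v = (\<Sum>(l, k)\<in>UNIV \<times> UNIV. u $ (l, k) * v $ (l, k))"
    unfolding inner_vec_def UNIV_Times_UNIV by (rule sum.cong) auto
  also have "\<dots> = (\<Sum>l\<in>UNIV. \<Sum>k\<in>UNIV. u $ (l, k) * v $ (l, k))"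
    by (rule sum.cartesian_product[symmetric])
  also have "\<dots> = qre (herm u v)"
    by (simp add: herm_def qre_sum qcoord_def quat_coord_def sum_4 ac_simps)
  finally show ?thesis by simp
qed

lemma herm_self: "herm u u = of_real ((norm u)^2)"
proof -
  have "herm u u = of_real (qre (herm u u))"
    using herm_sym[of u u] by (simp add: quaternion_eq_iff of_real_def)
  then show ?thesis by (simp add: qre_herm power2_norm_eq_inner)
qed

lemma norm_rscale [simp]: "norm (u \<star> a) = norm u * norm a"
proof -
  have "of_real ((norm (u \<star> a))^2) = qcnj a * of_real ((norm u)^2) * a"
    unfolding herm_self[symmetric] by (simp only: herm_rscale mult.assoc)
  also have "\<dots> = of_real ((norm u)^2) * (qcnj a * a)"
    by (simp only: of_real_mult_commute mult.assoc)
  also have "\<dots> = of_real ((norm u * norm a)^2)"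
    unfolding qcnj_mult_self by (simp add: power_mult_distrib)
  finally have "(norm (u \<star> a))^2 = (norm u * norm a)^2"
    using of_real_eq_iff by blast
  then show ?thesis by (simp add: power2_eq_imp_eq)
qed

lemma bounded_bilinear_rscale: "bounded_bilinear (\<star>)"
proof
  show "\<exists>K. \<forall>(u :: real^('a \<times> 4)) a. norm (u \<star> a) \<le> norm u * norm a * K"
    by (rule exI[of _ 1]) simp
qed (simp_all add: rscale_distrib)

lemma bounded_bilinear_herm: "bounded_bilinear herm"
  unfolding bilinear_conv_bounded_bilinear[symmetric] bilinear_def
  by (auto intro!: linearI)

lemmas has_derivative_rscale [derivative_intros] = bounded_bilinear.FDERIV[OF bounded_bilinear_rscale]
lemmas has_derivative_herm [derivative_intros] = bounded_bilinear.FDERIV[OF bounded_bilinear_herm]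

lemma of_quat_quat_herm: "of_quat (quat_herm u v) = herm u v"
proof -
  have [simp]: "of_quat (a + b) = of_quat a + of_quat b" "of_quat 0 = 0" for a b
    by (simp_all add: quaternion_eq_iff)
  have "of_quat (sum f A) = (\<Sum>l\<in>A. of_quat (f l))" for f and A :: "'a set"
    by (induction A rule: infinite_finite_induct) simp_all
  moreover have "of_quat (quat_mult a b) = of_quat a * of_quat b" "of_quat (quat_cnj a) = qcnj (of_quat a)" for a b
    by (simp_all add: quaternion_eq_iff quat_mult_def quat_cnj_def)
  ultimately show ?thesis by (simp add: quat_herm_def herm_def qcoord_def)
qed

lemma quat_herm_inner: "quat_herm y u \<bullet> quat_herm y v = qre (qcnj (herm y u) * herm y v)"
  unfolding of_quat_quat_herm[symmetric] by (simp add: inner_vec_def sum_4)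

section \<open>Determinants\<close>

lemma det_matrix_compose:
  fixes f g :: "real^'n \<Rightarrow> real^'n"
  assumes "linear f" "linear g"
  shows "det (matrix (\<lambda>x. f (g x))) = det (matrix f) * det (matrix g)"
  using matrix_compose[OF assms(2,1)] by (simp add: det_mul o_def)

text \<open>
  A rotation taking \<open>c\<close> to a coordinate axis turns the update into a change of one column, where Cramer's
  rule reads off the determinant.
\<close>
lemma det_rank_one_update:
  fixes a c :: "real^'n"
  shows "det (matrix (\<lambda>u. u + (c \<bullet> u) *\<^sub>R a)) = 1 + c \<bullet> a"
proof -
  \<comment> \<open>an arbitrary coordinate\<close>
  define k :: 'n where "k = undefined"
  have "norm c = norm (norm c *\<^sub>R (axis k 1 :: real^'n))" by simp
  then obtain P :: "real^'n \<Rightarrow> real^'n"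
    where P: "orthogonal_transformation P" "P c = norm c *\<^sub>R axis k 1"
    by (rule orthogonal_transformation_exists)
  have linP: "linear P" using P(1) by (rule orthogonal_transformation_linear)
  have inner: "P u \<bullet> P v = u \<bullet> v" for u v
    using P(1) by (simp add: orthogonal_transformation_def)
  let ?L = "\<lambda>u. u + (c \<bullet> u) *\<^sub>R a" and ?M = "\<lambda>w. w + (norm c * w $ k) *\<^sub>R P a"
  have linL: "linear ?L" and linM: "linear ?M"
    by (auto intro!: linearI simp: inner_add_right scaleR_add_left algebra_simps)
  have "P (?L u) = ?M (P u)" for u
  proof -
    have "c \<bullet> u = norm c * P u $ k"
      using inner[of c u] by (simp add: P(2) inner_axis' )
    then show ?thesis by (simp add: linear_add[OF linP] linear_scale[OF linP])
  qed
  then have "det (matrix P) * det (matrix ?L) = det (matrix ?M) * det (matrix P)"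
    unfolding det_matrix_compose[OF linP linL, symmetric] det_matrix_compose[OF linM linP, symmetric]
    by simp
  moreover have "det (matrix P) \<noteq> 0"
    using orthogonal_transformation_det[OF P(1)] by auto
  moreover have "det (matrix ?M) = 1 + norm c * P a $ k"
  proof -
    have "matrix ?M = (\<chi> i j. if j = k then (mat 1 *v (axis k 1 + norm c *\<^sub>R P a)) $ i else mat 1 $ i $ j)"
      unfolding matrix_vector_mul_lid by (auto simp: matrix_def vec_eq_iff mat_def axis_def)
    then show ?thesis
      using cramer_lemma[of k "mat 1" "axis k 1 + norm c *\<^sub>R P a"] by simp
  qed
  moreover have "norm c * P a $ k = c \<bullet> a"
    using inner[of c a] by (simp add: P(2) inner_axis')
  ultimately show ?thesis by simp
qed

lemma det_scaled_rank_one_update: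
  fixes a :: "real^'n" and f :: "real^'n \<Rightarrow> real"
  assumes "linear f"
  shows "det (matrix (\<lambda>u. k *\<^sub>R (u + f u *\<^sub>R a))) = k ^ CARD('n) * (1 + f a)"
proof -
  define c where "c = adjoint f 1"
  have f: "f u = c \<bullet> u" for u
    using adjoint_works[OF assms, of u 1] by (simp add: c_def inner_commute)
  have lin: "linear (\<lambda>u. u + (c \<bullet> u) *\<^sub>R a)"
    by (auto intro!: linearI simp: inner_add_right scaleR_add_left algebra_simps)
  show ?thesis
    unfolding f using det_matrix_compose[OF _ lin, of "(*\<^sub>R) k"] linear_scaleR
    by (simp add: det_rank_one_update)
qed

text \<open>
  The Gram determinant is the square of the Riemannian volume density. Composing the form in one argument
  with an endomorphism multiplies it by the determinant of that endomorphism.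
\<close>
lemma gram_matrix_right:
  fixes S :: "real^'n \<Rightarrow> real^'n"
  assumes B: "\<And>u. linear (\<lambda>v. B u v)" 
  shows "det (gram_matrix (\<lambda>u v. B u (S v))) = det (gram_matrix B) * det (matrix S)"
proof -
  have exp: "B u v = (\<Sum>j\<in>UNIV. v $ j * B u (axis j 1))" for u v
  proof -
    have "B u v = B u (\<Sum>j\<in>UNIV. v $ j *\<^sub>R axis j 1)"
      using basis_expansion[of v] by (simp add: scalar_mult_eq_scaleR)
    then show ?thesis by (simp add: linear_sum[OF B(1)] linear_scale[OF B(1)])
  qed
  have "gram_matrix (\<lambda>u v. B u (S v)) = gram_matrix B ** matrix S"
    unfolding gram_matrix_def matrix_matrix_mult_def matrix_def
    by (subst exp) (simp add: vec_eq_iff mult_ac)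
  then show ?thesis by (simp add: det_mul)
qed

lemma gram_matrix_compose:
  fixes L :: "real^'n \<Rightarrow> real^'n"
  assumes B: "\<And>u. linear (\<lambda>v. B u v)" "\<And>v. linear (\<lambda>u. B u v)" and L: "linear L"
  shows "det (gram_matrix (\<lambda>u v. B (L u) (L v))) = (det (matrix L))^2 * det (gram_matrix B)"
proof -
  have 1: "linear (\<lambda>v. B (L u) v)" for u by (rule B)
  have tr: "det (gram_matrix (\<lambda>u v. C v u)) = det (gram_matrix C)" for C :: "real^'n \<Rightarrow> real^'n \<Rightarrow> real"
    using det_transpose[of "gram_matrix C"] by (simp add: gram_matrix_def transpose_def)
  have "det (gram_matrix (\<lambda>u v. B (L u) (L v))) = det (gram_matrix (\<lambda>u v. B (L u) v)) * det (matrix L)"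
    by (rule gram_matrix_right[OF 1])
  also have "det (gram_matrix (\<lambda>u v. B (L u) v)) = det (gram_matrix (\<lambda>u v. B (L v) u))"
    by (rule tr[symmetric])
  also have "\<dots> = det (gram_matrix (\<lambda>u v. B v u)) * det (matrix L)"
    by (rule gram_matrix_right[OF B(2)])
  finally show ?thesis unfolding tr[of B] by (simp add: power2_eq_square)
qed

section \<open>Quaternionic Hermitian forms\<close>

text \<open>
  Positive definite forms that are linear over the quaternions, which act from the right. They occur as
  the standard form, as the forms at the points of the ball, and as the forms at the points of the
  recentred ball.
\<close>
locale hermitian_form =
  fixes H :: "real^('m::finite \<times> 4) \<Rightarrow> real^('m \<times> 4) \<Rightarrow> quaternion"
  assumes bounded_bilinear_form: "bounded_bilinear H"
    and rscale_right: "H u (v \<star> a) = H u v * a"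
    and form_sym: "H v u = qcnj (H u v)"
    and form_pos: "u \<noteq> 0 \<Longrightarrow> 0 < qre (H u u)"
begin

sublocale bounded_bilinear H by (rule bounded_bilinear_form)

abbreviation G :: "real^('m \<times> 4) \<Rightarrow> real^('m \<times> 4) \<Rightarrow> real" where "G u v \<equiv> qre (H u v)"

lemmas form_simps = add_left add_right diff_left diff_right scaleR_left scaleR_right
  minus_left minus_right zero_left zero_right rscale_right

lemma rscale_left: "H (u \<star> a) v = qcnj a * H u v"
  using form_sym[of "u \<star> a" v] form_sym[of u v] by (simp add: rscale_right)

lemma G_sym: "G v u = G u v"
  using form_sym[of v u] by simp

lemma form_self: "H u u = of_real (G u u)"
  using form_sym[of u u] by (simp add: quaternion_eq_iff of_real_def)

lemma G_nonneg: "0 \<le> G u u"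
  using form_pos[of u] by (cases "u = 0") (auto simp: zero_left)

lemma G_eq_0_iff: "G u u = 0 \<longleftrightarrow> u = 0"
  using form_pos[of u] zero_left by (metis less_irrefl zero_quaternion.sel(1))

text \<open>
  The projection to the quaternionic line of \<open>z\<close> is self-adjoint.
\<close>
lemma G_rscale_adjoint: "qre (qcnj (H z u) * H z v) = G u (z \<star> H z v)"
  by (simp add: rscale_right form_sym[of u z])

lemma linear_G_left: "linear (\<lambda>u. G u v)" and linear_G_right: "linear (\<lambda>v. G u v)"
  by (auto intro!: linearI simp: form_simps)

lemma G_nondegenerate: "(\<And>u. G u a = G u b) \<Longrightarrow> a = b"
  using G_eq_0_iff[of "a - b"] by (simp only: diff_right minus_quaternion.sel) simp

text \<open>
  The update acts on the quaternionic line of \<open>z\<close>, of real dimension four, as the scalar \<open>1 + c G z z\<close>. It is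
  a product of four commuting updates of rank one, in the directions of \<open>z\<close> times \<open>1, i, j, k\<close>.
\<close>
lemma det_line_update:
  "det (matrix (\<lambda>u. u + c *\<^sub>R (z \<star> H z u))) = (1 + c * G z z) ^ 4"
proof -
  define P where "P a u = u + G (z \<star> a) u *\<^sub>R (c *\<^sub>R (z \<star> a))" for a u
  have lin: "linear (G (z \<star> a))" for a
    by (rule linear_G_right)
  have linP: "linear (P a)" for a
    unfolding P_def by (auto intro!: linearI simp: form_simps algebra_simps scaleR_add_left)
  have linPP: "linear (\<lambda>u. P a (P b u))" for a b
    by (rule linear_compose[OF linP linP, unfolded o_def])
  have linPPP: "linear (\<lambda>u. P a (P b (P d u)))" for a b d
    by (rule linear_compose[OF linPP linP, unfolded o_def])
  have orth: "G (z \<star> a) (z \<star> b) = qre (qcnj a * b) * G z z" for a b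
  proof -
    obtain N where N: "H z z = of_real N" "G z z = N" using form_self[of z] by blast
    show ?thesis unfolding N rscale_left rscale_right by (simp add: of_real_def algebra_simps)
  qed
  have detP: "det (matrix (P a)) = 1 + c * ((norm a)^2 * G z z)" for a
    using det_scaled_rank_one_update[OF lin[of a], of 1 "c *\<^sub>R (z \<star> a)"]
    unfolding scaleR_right scaleR_quaternion.sel orth qcnj_mult_self qre_of_real
    by (simp add: P_def[abs_def])
  let ?i = "Quaternion 0 1 0 0" and ?j = "Quaternion 0 0 1 0" and ?k = "Quaternion 0 0 0 1"
  have comps: "G (z \<star> 1) u = qre (H z u)" "G (z \<star> ?i) u = qi (H z u)"
     "G (z \<star> ?j) u = qj (H z u)" "G (z \<star> ?k) u = qk (H z u)" for u
    by (simp_all add: rscale_left)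
  have split: "z \<star> H z u = qre (H z u) *\<^sub>R (z \<star> 1) + qi (H z u) *\<^sub>R (z \<star> ?i)
      + qj (H z u) *\<^sub>R (z \<star> ?j) + qk (H z u) *\<^sub>R (z \<star> ?k)" for u
  proof -
    have "H z u = qre (H z u) *\<^sub>R 1 + qi (H z u) *\<^sub>R ?i + qj (H z u) *\<^sub>R ?j + qk (H z u) *\<^sub>R ?k"
      by (simp add: quaternion_eq_iff)
    then have "z \<star> H z u = z \<star> (qre (H z u) *\<^sub>R 1 + qi (H z u) *\<^sub>R ?i + qj (H z u) *\<^sub>R ?j + qk (H z u) *\<^sub>R ?k)"
      by simp
    then show ?thesis by (simp only: rscale_distrib rscale_simps(7))
  qed
  have "P 1 (P ?i (P ?j (P ?k u))) = u + c *\<^sub>R (z \<star> H z u)" for u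
    unfolding split unfolding P_def
    by (simp only: add_right scaleR_right plus_quaternion.sel scaleR_quaternion.sel orth comps)
       (simp add: algebra_simps)
  then have "det (matrix (\<lambda>u. u + c *\<^sub>R (z \<star> H z u))) =
      det (matrix (\<lambda>u. P 1 (P ?i (P ?j (P ?k u)))))"
    by presburger
  also have "\<dots> = det (matrix (P 1)) * det (matrix (P ?i)) * det (matrix (P ?j)) * det (matrix (P ?k))"
    using det_matrix_compose[OF linP[of 1] linPPP[of ?i ?j ?k]] det_matrix_compose[OF linP[of ?i] linPP[of ?j ?k]]
      det_matrix_compose[OF linP[of ?j] linP[of ?k]] by simp
  finally show ?thesis by (simp add: detP norm_quaternion_sq power4_eq_xxxx)
qed

end

text \<open>
  The Hermitian form, at the point \<open>z\<close>, of the ball model built from \<open>H\<close> in place of the standard form.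
\<close>
definition ball_form :: "(real^('m::finite \<times> 4) \<Rightarrow> real^('m \<times> 4) \<Rightarrow> quaternion)
    \<Rightarrow> real^('m \<times> 4) \<Rightarrow> real^('m \<times> 4) \<Rightarrow> real^('m \<times> 4) \<Rightarrow> quaternion" where
  "ball_form H z u v = H u v /\<^sub>R (1 - qre (H z z)) + (qcnj (H z u) * H z v) /\<^sub>R (1 - qre (H z z))^2"

context hermitian_form
begin

lemma qre_ball_form:
  "qre (ball_form H z u v) = G u v / (1 - G z z) + qre (qcnj (H z u) * H z v) / (1 - G z z)^2"
  by (simp only: ball_form_def plus_quaternion.sel scaleR_quaternion.sel divide_inverse_commute)

lemma hermitian_form_ball_form:
  assumes "G z z < 1"
  shows "hermitian_form (ball_form H z)"
proof (rule hermitian_form.intro)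
  show "bounded_bilinear (ball_form H z)"
    unfolding bilinear_conv_bounded_bilinear[symmetric] bilinear_def
  proof (intro conjI allI linearI)
    fix u v w :: "real^('m \<times> 4)" and c :: real
    show "ball_form H z w (u + v) = ball_form H z w u + ball_form H z w v"
      "ball_form H z (u + v) w = ball_form H z u w + ball_form H z v w"
      unfolding ball_form_def form_simps qcnj_linear by (simp_all add: algebra_simps)
    show "ball_form H z w (c *\<^sub>R u) = c *\<^sub>R ball_form H z w u"
      "ball_form H z (c *\<^sub>R u) w = c *\<^sub>R ball_form H z u w"
      unfolding ball_form_def form_simps qcnj_linear by (simp_all add: scaleR_add_right mult.commute)
  qed
  fix u v :: "real^('m \<times> 4)" and a
  show "ball_form H z u (v \<star> a) = ball_form H z u v * a"
    unfolding ball_form_def form_simps by (simp add: distrib_right mult.assoc)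
  show "ball_form H z v u = qcnj (ball_form H z u v)"
    by (simp add: ball_form_def form_sym[of u v])
  assume "u \<noteq> 0"
  then show "0 < qre (ball_form H z u u)"
    using form_pos[of u] assms unfolding qre_ball_form qcnj_mult_self qre_of_real
    by (intro add_pos_nonneg) auto
qed

text \<open>
  The volume density of the ball model: the form at \<open>z\<close> is \<open>H\<close> composed with a line update.
\<close>
lemma det_gram_ball_form:
  assumes "G z z < 1"
  shows "det (gram_matrix (\<lambda>u v. qre (ball_form H z u v)))
    = det (gram_matrix G) / (1 - G z z) ^ (CARD('m \<times> 4) + 4)"
proof -
  define \<sigma> where "\<sigma> = 1 - G z z"
  have \<sigma>: "\<sigma> > 0" using assms by (simp add: \<sigma>_def)
  let ?S = "\<lambda>u. inverse \<sigma> *\<^sub>R (u + inverse \<sigma> *\<^sub>R (z \<star> H z u))"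
  have "qre (ball_form H z u v) = G u (?S v)" for u v
    unfolding qre_ball_form G_rscale_adjoint \<sigma>_def[symmetric]
    by (simp add: form_simps power2_eq_square divide_inverse algebra_simps)
  then have "det (gram_matrix (\<lambda>u v. qre (ball_form H z u v))) = det (gram_matrix G) * det (matrix ?S)"
    using gram_matrix_right[of "\<lambda>u v. G u v" ?S, OF linear_G_right] by presburger
  moreover have "linear (\<lambda>u. u + inverse \<sigma> *\<^sub>R (z \<star> H z u))"
    by (auto intro!: linearI simp: form_simps rscale_distrib algebra_simps)
  then have "det (matrix ?S) = inverse \<sigma> ^ CARD('m \<times> 4) * (1 + inverse \<sigma> * G z z) ^ 4"
    using det_matrix_compose[of "(*\<^sub>R) (inverse \<sigma>)" "\<lambda>u. u + inverse \<sigma> *\<^sub>R (z \<star> H z u)"]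
    by (simp only: det_matrix_scaleR det_line_update linear_scaleR) 
  moreover have "1 + inverse \<sigma> * G z z = inverse \<sigma>"
    using \<sigma> by (simp add: \<sigma>_def field_simps)
  ultimately show ?thesis
    by (simp only: \<sigma>_def[symmetric] power_add divide_inverse power_inverse inverse_mult_distrib)
qed

end

interpretation std: hermitian_form herm
proof (rule hermitian_form.intro)
  fix u :: "real^('a \<times> 4)"
  assume "u \<noteq> 0"
  then show "0 < qre (herm u u)" by (simp add: qre_herm)
qed (simp_all only: bounded_bilinear_herm herm_rscale, rule herm_sym)

lemma qh_metric_eq: "qh_metric y u v = qre (ball_form herm y u v)"
  unfolding qh_metric_def std.qre_ball_form quat_herm_inner qre_herm
  unfolding power2_norm_eq_inner ..

lemma in_qh_space: "y \<in> qh_space \<longleftrightarrow> qre (herm y y) < 1"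
  using abs_square_less_1[of "norm y"] by (simp add: qh_space_def qre_herm dot_square_norm)

lemma hermitian_form_qh: "p \<in> qh_space \<Longrightarrow> hermitian_form (ball_form herm p)"
  by (rule std.hermitian_form_ball_form) (simp add: in_qh_space)

lemma gram_matrix_inner: "gram_matrix (\<lambda>u v. qre (herm u v)) = mat 1"
  by (auto simp: gram_matrix_def vec_eq_iff qre_herm mat_def inner_axis_axis)

lemma det_gram_qh_nonzero:
  "p \<in> qh_space \<Longrightarrow> det (gram_matrix (\<lambda>u v. qre (ball_form herm (p :: real^('m::finite \<times> 4)) u v))) \<noteq> 0"
  by (subst std.det_gram_ball_form) (simp_all add: in_qh_space gram_matrix_inner)

section \<open>Connection and curvature\<close>

definition gap :: "real^('m::finite \<times> 4) \<Rightarrow> real" where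
  "gap y = 1 - y \<bullet> y"

lemma gap_pos: "y \<in> qh_space \<longleftrightarrow> 0 < gap y"
  by (simp add: in_qh_space gap_def qre_herm)

lemma has_derivative_gap [derivative_intros]:
  assumes "(f has_derivative f') (at x within S)"
  shows "((\<lambda>x. gap (f x)) has_derivative (\<lambda>h. - 2 * (f x \<bullet> f' h))) (at x within S)"
  unfolding gap_def[abs_def] by (auto intro!: derivative_eq_intros assms simp: inner_commute)

lemma open_qh_space: "open qh_space"
  by (simp add: qh_space_def)

lemma ball_form_herm:
  "ball_form herm y u v = herm u v /\<^sub>R gap y + (qcnj (herm y u) * herm y v) /\<^sub>R (gap y)^2"
  by (simp add: ball_form_def gap_def qre_herm)

text \<open>
  The values of the Levi-Civita connection on constant fields. The formula is the noncommutative version of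
  the one for the complex hyperbolic ball; symmetry in \<open>u\<close> and \<open>v\<close> is evident, and the lemma below is
  compatibility with the metric.
\<close>
definition levi_civita where
  "levi_civita y u v = (u \<star> herm y v + v \<star> herm y u) /\<^sub>R gap y"

lemma levi_civita_sym: "levi_civita y u v = levi_civita y v u"
  by (simp add: levi_civita_def add.commute)

lemma qh_metric_sym: "qh_metric y u v = qh_metric y v u"
  by (simp only: qh_metric_def inner_commute)

lemma has_derivative_qh_metric:
  assumes "y \<in> qh_space"
  shows "((\<lambda>x. qh_metric x a b) has_derivative
    (\<lambda>w. qh_metric y (levi_civita y w a) b + qh_metric y a (levi_civita y w b))) (at y)"
proof -
  define s where "s = gap y"
  have s: "s > 0" using assms by (simp add: gap_pos s_def)
  have ne: "gap y \<noteq> 0" "(gap y)^2 \<noteq> 0" using s by (auto simp: s_def)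
  have "((\<lambda>x. qre (herm a b) / gap x + qre (qcnj (herm x a) * herm x b) / (gap x)^2) has_derivative
    (\<lambda>w. qre (herm a b) * (2 * (y \<bullet> w)) / s^2 + 
       qre (qcnj (herm w a) * herm y b + qcnj (herm y a) * herm w b) / s^2
      + 4 * (y \<bullet> w) * qre (qcnj (herm y a) * herm y b) / s ^ 3)) (at y)"
    apply (rule derivative_eq_intros refl ne)+
    apply (rule ext)
    apply (simp only: s_def[symmetric] std.zero_right std.zero_left plus_quaternion.sel)
    using s apply (simp add: field_simps power2_eq_square power3_eq_cube del: times_quaternion.sel)
    done
  moreover have "qre (herm a b) * (2 * (y \<bullet> w)) / s^2 + 
       qre (qcnj (herm w a) * herm y b + qcnj (herm y a) * herm w b) / s^2
      + 4 * (y \<bullet> w) * qre (qcnj (herm y a) * herm y b) / s ^ 3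
    = qh_metric y (levi_civita y w a) b + qh_metric y a (levi_civita y w b)" for w
  proof -
    define A B C P Q R where d: "A = herm y a" "B = herm y b" "C = herm y w"
      "P = herm w a" "Q = herm w b" "R = herm a b"
    note d = d[symmetric]
    have C: "y \<bullet> w = qre C" by (simp only: d[symmetric] qre_herm)
    have P: "herm a w = qcnj P" unfolding d[symmetric] by (rule herm_sym)
    have 1: "qre (qcnj C * R) + qre (R * C) = 2 * qre R * qre C"
      by (simp add: algebra_simps)
    have 2: "qre (qcnj (C * A + A * C) * B) + qre (qcnj A * (C * B + B * C)) = 4 * qre C * qre (qcnj A * B)"
      by (simp add: algebra_simps)
    have "qh_metric y (levi_civita y w a) b + qh_metric y a (levi_civita y w b)
       = (qre (qcnj A * Q) + qre (qcnj C * R)) / s^2 + qre (qcnj (C * A + A * C) * B) / s ^ 3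
       + (qre (qcnj P * B) + qre (R * C)) / s^2 + qre (qcnj A * (C * B + B * C)) / s ^ 3"
      unfolding qh_metric_eq ball_form_herm levi_civita_def herm_linear herm_rscale P d s_def[symmetric]
      using s by (simp only: plus_quaternion.sel scaleR_quaternion.sel qcnj_linear qcnj_mult
            mult_scaleR_left mult_scaleR_right distrib_left distrib_right scaleR_add_right scaleR_scaleR)
        (simp add: field_simps power2_eq_square power3_eq_cube del: times_quaternion.sel)
    also have "\<dots> = (2 * qre R * qre C + qre (qcnj A * Q) + qre (qcnj P * B)) / s^2
         + 4 * qre C * qre (qcnj A * B) / s ^ 3"
      unfolding 1[symmetric] 2[symmetric] by (simp only: add_divide_distrib ac_simps)
    finally show ?thesis
      unfolding C d by (simp only: plus_quaternion.sel add_divide_distrib) (simp only: ac_simps)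
  qed
  ultimately show ?thesis
    unfolding qh_metric_eq[abs_def] std.qre_ball_form by (simp add: gap_def qre_herm qh_metric_eq)
qed

lemma qh_metric_nondegenerate:
  assumes "y \<in> qh_space" "\<And>z. qh_metric y a z = qh_metric y b z"
  shows "a = b"
proof -
  interpret hermitian_form "ball_form herm y" by (rule hermitian_form_qh[OF assms(1)])
  show ?thesis
    using assms(2) by (intro G_nondegenerate) (simp only: qh_metric_eq G_sym)
qed

text \<open>
  A symmetric connection compatible with the metric satisfies the Koszul formula, and the metric is
  nondegenerate.
\<close>
lemma christoffel_qh:
  assumes "y \<in> qh_space"
  shows "christoffel qh_metric y u v = levi_civita y u v"
proof -
  have D: "frechet_derivative (\<lambda>x. qh_metric x a b) (at y) w =
      qh_metric y (levi_civita y w a) b + qh_metric y a (levi_civita y w b)" for a b w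
    by (simp only: frechet_derivative_at[OF has_derivative_qh_metric[OF assms], symmetric])
  have eq: "2 * qh_metric y (levi_civita y u v) z =
      frechet_derivative (\<lambda>x. qh_metric x v z) (at y) u
    + frechet_derivative (\<lambda>x. qh_metric x u z) (at y) v
    - frechet_derivative (\<lambda>x. qh_metric x u v) (at y) z" for z
    unfolding D using qh_metric_sym[of y v "levi_civita y u z"] qh_metric_sym[of y u "levi_civita y v z"]
    unfolding levi_civita_sym[of y v u] levi_civita_sym[of y z u] levi_civita_sym[of y z v] by linarith
  show ?thesis
    unfolding christoffel_def
  proof (rule the_equality)
    show "\<forall>z. 2 * qh_metric y (levi_civita y u v) z =
      frechet_derivative (\<lambda>x. qh_metric x v z) (at y) u
    + frechet_derivative (\<lambda>x. qh_metric x u z) (at y) v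
    - frechet_derivative (\<lambda>x. qh_metric x u v) (at y) z" using eq by blast
    fix w assume "\<forall>z. 2 * qh_metric y w z =
      frechet_derivative (\<lambda>x. qh_metric x v z) (at y) u
    + frechet_derivative (\<lambda>x. qh_metric x u z) (at y) v
    - frechet_derivative (\<lambda>x. qh_metric x u v) (at y) z"
    then show "w = levi_civita y u v"
      by (intro qh_metric_nondegenerate[OF assms]) (simp add: eq[symmetric])
  qed
qed

lemma frechet_derivative_christoffel_qh:
  assumes "y \<in> qh_space"
  shows "frechet_derivative (\<lambda>x. christoffel qh_metric x u v) (at y) w =
    (u \<star> herm w v + v \<star> herm w u) /\<^sub>R gap y + (2 * (y \<bullet> w) / (gap y)^2) *\<^sub>R (u \<star> herm y v + v \<star> herm y u)"
proof -
  have s: "gap y > 0" using assms by (simp add: gap_pos)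
  then have ne: "gap y \<noteq> 0" by simp
  have "((\<lambda>x. levi_civita x u v) has_derivative (\<lambda>w.
    (u \<star> herm w v + v \<star> herm w u) /\<^sub>R gap y + (2 * (y \<bullet> w) / (gap y)^2) *\<^sub>R (u \<star> herm y v + v \<star> herm y u))) (at y)"
    unfolding levi_civita_def
    apply (rule derivative_eq_intros refl ne)+
    apply (rule ext)
    using s apply (simp add: std.zero_right power2_eq_square divide_inverse)
    done
  then have "((\<lambda>x. christoffel qh_metric x u v) has_derivative (\<lambda>w.
    (u \<star> herm w v + v \<star> herm w u) /\<^sub>R gap y + (2 * (y \<bullet> w) / (gap y)^2) *\<^sub>R (u \<star> herm y v + v \<star> herm y u))) (at y)"
    by (rule has_derivative_transform_within_open[OF _ open_qh_space assms])
       (simp add: christoffel_qh)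
  from frechet_derivative_at[OF this, symmetric] show ?thesis by simp
qed

text \<open>
  Collecting the coefficients of \<open>X\<close>, \<open>Y\<close> and \<open>Z\<close> on the right leaves three identities between quaternions,
  in which \<open>2 Re a - a\<close> combines to the conjugate of \<open>a\<close>.
\<close>
lemma riemann_tensor_qh:
  assumes "y \<in> qh_space"
  defines "K \<equiv> ball_form herm y"
  shows "riemann_tensor qh_metric y X Y Z = Y \<star> K X Z + Z \<star> K X Y - X \<star> K Y Z - Z \<star> K Y X"
proof -
  define s where "s = gap y"
  have s: "s > 0" using assms by (simp add: gap_pos s_def)
  define a b c where d: "a = herm y X" "b = herm y Y" "c = herm y Z"
  note d = d[symmetric]
  have re: "y \<bullet> X = qre a" "y \<bullet> Y = qre b" by (simp_all only: d[symmetric] qre_herm)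
  define t where "t = inverse s"
  have t: "1 / s = t" "r / s^2 = r * t^2" "inverse (s^2) = t^2" for r
    by (simp_all add: t_def divide_inverse power_inverse)
  \<comment> \<open>the coefficients of \<open>Y\<close>, \<open>X\<close> and \<open>Z\<close>, with \<open>t = 1 / gap y\<close>\<close>
  have Y: "t *\<^sub>R herm X Z + (2 * qre a * t^2) *\<^sub>R c + t^2 *\<^sub>R (c * a) - t^2 *\<^sub>R (a * c + c * a)
     = t *\<^sub>R herm X Z + t^2 *\<^sub>R (qcnj a * c)"
    unfolding qcnj_eq by (simp add: algebra_simps of_real_def)
  have X: "t^2 *\<^sub>R (b * c + c * b) - (t *\<^sub>R herm Y Z + (2 * qre b * t^2) *\<^sub>R c) - t^2 *\<^sub>R (c * b)
     = - (t *\<^sub>R herm Y Z + t^2 *\<^sub>R (qcnj b * c))"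
    unfolding qcnj_eq by (simp add: algebra_simps of_real_def)
  have Z: "(t *\<^sub>R herm X Y + (2 * qre a * t^2) *\<^sub>R b) - (t *\<^sub>R herm Y X + (2 * qre b * t^2) *\<^sub>R a)
      + t^2 *\<^sub>R (b * a) - t^2 *\<^sub>R (a * b)
     = (t *\<^sub>R herm X Y + t^2 *\<^sub>R (qcnj a * b)) - (t *\<^sub>R herm Y X + t^2 *\<^sub>R (qcnj b * a))"
    unfolding qcnj_eq by (simp add: algebra_simps of_real_def)
  have "riemann_tensor qh_metric y X Y Z =
     Y \<star> (t *\<^sub>R herm X Z + (2 * qre a * t^2) *\<^sub>R c + t^2 *\<^sub>R (c * a) - t^2 *\<^sub>R (a * c + c * a))
   + X \<star> (t^2 *\<^sub>R (b * c + c * b) - (t *\<^sub>R herm Y Z + (2 * qre b * t^2) *\<^sub>R c) - t^2 *\<^sub>R (c * b))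
   + Z \<star> ((t *\<^sub>R herm X Y + (2 * qre a * t^2) *\<^sub>R b) - (t *\<^sub>R herm Y X + (2 * qre b * t^2) *\<^sub>R a)
      + t^2 *\<^sub>R (b * a) - t^2 *\<^sub>R (a * b))"
    unfolding riemann_tensor_def frechet_derivative_christoffel_qh[OF assms(1)] christoffel_qh[OF assms(1)]
      levi_civita_def herm_linear herm_rscale d re s_def[symmetric] t t_def[symmetric]
    by (simp add: rscale_distrib rscale_assoc algebra_simps power2_eq_square)
  also have "\<dots> = Y \<star> K X Z + Z \<star> K X Y - X \<star> K Y Z - Z \<star> K Y X"
    unfolding Y X Z K_def ball_form_herm d s_def[symmetric] t t_def[symmetric]
    by (simp add: rscale_distrib)
  finally show ?thesis .
qed


section \<open>Recentring the ball\<close>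

lemma norm_quaternion_add_sq: "(norm (a + b))^2 = (norm a)^2 + (norm b)^2 + 2 * qre (qcnj a * b)"
  unfolding norm_quaternion_sq by (simp add: power2_eq_square algebra_simps)

lemma norm_sub_rscale_sq:
  "(norm (u - w \<star> m))^2 = (norm u)^2 - 2 * qre (herm u w * m) + (norm w)^2 * (norm m)^2"
proof -
  have "u \<bullet> (w \<star> m) = qre (herm u w * m)" unfolding qre_herm[symmetric] by (simp only: herm_rscale)
  moreover have "(norm (w \<star> m))^2 = (norm w)^2 * (norm m)^2" by (simp add: power_mult_distrib)
  ultimately show ?thesis
    by (simp only: power2_norm_eq_inner inner_diff_left inner_diff_right inner_commute[of "w \<star> m" u])
qed

text \<open>
  The base point. The form \<open>H\<close> at the base point has the metric there as its real part.
\<close>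
locale qh_point =
  fixes p :: "real^('m::finite \<times> 4)"
  assumes p_in_space: "p \<in> qh_space"
begin

abbreviation "H \<equiv> ball_form herm p"

sublocale hermitian_form H by (rule hermitian_form_qh[OF p_in_space])

lemma gap_p: "gap p > 0" using p_in_space by (simp add: gap_pos)

definition slope :: "real^('m \<times> 4) \<Rightarrow> quaternion" where "slope z = herm p z /\<^sub>R gap p"

lemma slope_simps: "slope (u + v) = slope u + slope v" "slope (u - v) = slope u - slope v"
  "slope (c *\<^sub>R u) = c *\<^sub>R slope u" "slope (u \<star> a) = slope u * a"
  by (simp_all add: slope_def algebra_simps)

lemma has_derivative_slope [derivative_intros]:
  assumes "(f has_derivative f') (at x within S)"
  shows "((\<lambda>x. slope (f x)) has_derivative (\<lambda>h. slope (f' h))) (at x within S)"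
  unfolding slope_def by (auto intro!: derivative_eq_intros assms simp: std.zero_left)

lemma herm_p: "herm p z = gap p *\<^sub>R slope z"
  using gap_p by (simp add: slope_def)

lemma H_slope: "H u v = herm u v /\<^sub>R gap p + qcnj (slope u) * slope v"
  by (simp add: ball_form_herm slope_def power2_eq_square)

lemma G_norm: "G z z = (norm z)^2 / gap p + (norm (slope z))^2"
  unfolding H_slope qcnj_mult_self plus_quaternion.sel scaleR_quaternion.sel qre_of_real qre_herm
  by (simp add: power2_norm_eq_inner divide_inverse_commute)

definition denom :: "real^('m \<times> 4) \<Rightarrow> quaternion" where "denom z = 1 + slope z"

text \<open>
  In homogeneous coordinates, \<open>recentre\<close> is the linear map sending \<open>(z, 1)\<close> to \<open>z\<close>, made orthogonal to
  \<open>(p, 1)\<close>, plus \<open>(p, 1)\<close>; division by the last coordinate \<open>denom z\<close> returns to the ball. It is inverted by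
  \<open>decentre\<close>.
\<close>
definition recentre :: "real^('m \<times> 4) \<Rightarrow> real^('m \<times> 4)" where
  "recentre z = p + z \<star> inverse (denom z)"

definition recentre_deriv :: "real^('m \<times> 4) \<Rightarrow> real^('m \<times> 4) \<Rightarrow> real^('m \<times> 4)" where
  "recentre_deriv z u = (u - z \<star> inverse (denom z) \<star> slope u) \<star> inverse (denom z)"

definition decentre :: "real^('m \<times> 4) \<Rightarrow> real^('m \<times> 4)" where
  "decentre y = (y - p) \<star> inverse (1 - slope (y - p))"

lemma norm_slope_less_1: "G z z < 1 \<Longrightarrow> norm (slope z) < 1"
proof -
  assume "G z z < 1"
  moreover have "(norm z)^2 / gap p \<ge> 0" using gap_p by simp
  ultimately have "(norm (slope z))^2 < 1" unfolding G_norm by linarith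
  then show ?thesis using abs_square_less_1[of "norm (slope z)"] by simp
qed

lemma denom_nonzero: "G z z < 1 \<Longrightarrow> denom z \<noteq> 0"
proof
  assume "G z z < 1" "denom z = 0"
  then have "slope z = - 1" by (simp add: denom_def eq_neg_iff_add_eq_0 add.commute)
  then show False using norm_slope_less_1[OF \<open>G z z < 1\<close>] by simp
qed

lemma norm_denom_sq: "(norm (denom z))^2 = 1 + 2 * qre (slope z) + (norm (slope z))^2"
  unfolding denom_def norm_quaternion_add_sq by simp

lemma slope_inverse_denom:
  assumes "denom z \<noteq> 0" shows "slope z * inverse (denom z) = 1 - inverse (denom z)"
proof -
  have "slope z = denom z - 1" by (simp add: denom_def)
  then show ?thesis using assms by (simp add: left_diff_distrib)
qed

text \<open>
  \<open>gap\<close> is minus the Lorentzian norm of the homogeneous coordinates with last entry \<open>1\<close>; normalizing that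
  entry divides by the square of the norm of \<open>denom z\<close>.
\<close>
lemma gap_recentre:
  assumes "denom z \<noteq> 0"
  shows "gap (recentre z) = gap p * (1 - G z z) / (norm (denom z))^2"
proof -
  define N where "N = (norm (denom z))^2"
  have N: "N \<noteq> 0" "N = 1 + 2 * qre (slope z) + (norm (slope z))^2"
    unfolding N_def using assms by simp (rule norm_denom_sq)
  have "p \<bullet> (z \<star> inverse (denom z)) = gap p * qre (1 - inverse (denom z))"
    unfolding qre_herm[symmetric] slope_inverse_denom[OF assms, symmetric] herm_rscale herm_p
    by (simp only: mult_scaleR_left scaleR_quaternion.sel)
  also have "qre (1 - inverse (denom z)) = 1 - (1 + qre (slope z)) / N"
    unfolding inverse_quaternion by (simp add: N_def denom_def divide_inverse_commute)
  finally have 1: "p \<bullet> (z \<star> inverse (denom z)) = gap p * (1 - (1 + qre (slope z)) / N)" .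
  have 2: "(norm (z \<star> inverse (denom z)))^2 = (norm z)^2 / N"
    by (simp add: power_mult_distrib norm_inverse N_def divide_inverse power_inverse)
  have "gap (recentre z) = gap p - 2 * (p \<bullet> (z \<star> inverse (denom z))) - (norm (z \<star> inverse (denom z)))^2"
    unfolding gap_def recentre_def power2_norm_eq_inner by (simp add: inner_add_left inner_add_right inner_commute)
  also have "\<dots> = (gap p * (- N + 2 + 2 * qre (slope z)) - (norm z)^2) / N"
    unfolding 1 2 using N(1) by (simp add: field_simps)
  also have "gap p * (- N + 2 + 2 * qre (slope z)) - (norm z)^2 = gap p * (1 - G z z)"
    unfolding G_norm N(2) using gap_p by (simp add: field_simps)
  finally show ?thesis by (simp add: N_def)
qed

lemma recentre_in_space:
  assumes "G z z < 1" shows "recentre z \<in> qh_space"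
  using gap_p assms denom_nonzero[OF assms] by (simp add: gap_pos gap_recentre)

lemma has_derivative_recentre:
  assumes "denom z \<noteq> 0"
  shows "(recentre has_derivative recentre_deriv z) (at z)"
proof -
  have "((\<lambda>z. p + z \<star> inverse (1 + slope z)) has_derivative recentre_deriv z) (at z)"
    apply (rule derivative_eq_intros refl assms[unfolded denom_def])+
    apply (rule ext)
    apply (simp add: recentre_deriv_def denom_def rscale_distrib rscale_assoc mult.assoc)
    done
  then show ?thesis by (simp add: recentre_def[abs_def] denom_def)
qed

lemma linear_recentre_deriv: "linear (recentre_deriv z)"
  by (rule linearI) (simp_all add: recentre_deriv_def slope_simps rscale_distrib scaleR_diff_right)

lemma recentre_decentre:
  assumes "1 - slope (y - p) \<noteq> 0"
  shows "recentre (decentre y) = y" "denom (decentre y) = inverse (1 - slope (y - p))"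
proof -
  define m where "m = slope (y - p)"
  have m: "1 - m \<noteq> 0" using assms by (simp add: m_def)
  have "denom (decentre y) = (1 - m) * inverse (1 - m) + m * inverse (1 - m)"
    using m by (simp add: denom_def decentre_def slope_simps m_def)
  also have "\<dots> = inverse (1 - m)" by (simp only: distrib_right[symmetric]) simp
  finally show *: "denom (decentre y) = inverse (1 - slope (y - p))" by (simp add: m_def)
  show "recentre (decentre y) = y"
    unfolding recentre_def * using m by (simp add: decentre_def rscale_assoc m_def)
qed

lemma decentre_recentre:
  assumes "denom z \<noteq> 0"
  shows "decentre (recentre z) = z" "1 - slope (recentre z - p) = inverse (denom z)"
proof -
  have *: "1 - slope (recentre z - p) = inverse (denom z)"
    using slope_inverse_denom[OF assms] by (simp add: recentre_def slope_simps)
  then show "1 - slope (recentre z - p) = inverse (denom z)" .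
  show "decentre (recentre z) = z"
    unfolding decentre_def * using assms by (simp add: recentre_def rscale_assoc)
qed

lemma slope_diff_p:
  assumes "y \<in> qh_space" shows "1 - slope (y - p) \<noteq> 0"
proof
  assume "1 - slope (y - p) = 0"
  then have "slope (y - p) = 1" by simp
  then have "qre (herm p (y - p)) = gap p" unfolding herm_p[of "y - p"] by simp
  then have "p \<bullet> y = 1" unfolding qre_herm by (simp add: gap_def inner_diff_right)
  moreover have "norm p < 1" "norm y < 1" using p_in_space assms by (simp_all add: qh_space_def)
  moreover have "p \<bullet> y \<le> norm p * norm y" by (rule norm_cauchy_schwarz)
  ultimately show False
    using mult_strict_mono[of "norm p" 1 "norm y" 1] by simp
qed

lemma decentre_in_ball:
  assumes "y \<in> qh_space" shows "G (decentre y) (decentre y) < 1"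
proof -
  note ne = slope_diff_p[OF assms]
  have d: "denom (decentre y) \<noteq> 0" using recentre_decentre(2)[OF ne] ne by simp
  have "gap y = gap p * (1 - G (decentre y) (decentre y)) / (norm (denom (decentre y)))^2"
    using gap_recentre[OF d] recentre_decentre(1)[OF ne] by simp
  moreover have "gap y > 0" using assms by (simp add: gap_pos)
  moreover have "(norm (denom (decentre y)))^2 > 0" using d by simp
  ultimately show ?thesis using gap_p by (simp add: zero_less_divide_iff zero_less_mult_iff)
qed

text \<open>
  The second term of the metric at the image point needs this component of the derivative. It agrees with
  \<open>H z u\<close>, up to scaling, conjugation by \<open>denom z\<close> and a term in \<open>slope u\<close> that later cancels against the first term
  of the metric.
\<close>
lemma herm_recentre_deriv:
  assumes "G z z < 1"
  shows "herm (recentre z) (recentre_deriv z u) =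
    gap (recentre z) *\<^sub>R ((denom z * H z u /\<^sub>R (1 - G z z) + slope u) * inverse (denom z))"
proof -
  define q w N \<sigma> where d: "q = denom z" "w = z \<star> inverse q" "N = (norm q)^2" "\<sigma> = 1 - G z z"
  have q: "q \<noteq> 0" "N \<noteq> 0" using denom_nonzero[OF assms] by (simp_all add: d)
  have \<sigma>: "\<sigma> \<noteq> 0" using assms by (simp add: d)
  define k where "k = inverse N"
  have inv: "inverse q = k *\<^sub>R qcnj q" by (simp add: k_def d inverse_quaternion)
  have kq: "k *\<^sub>R (qcnj q * q) = 1" using q by (simp add: k_def qcnj_mult_self d of_real_def)
  have kq2: "k *\<^sub>R (q * qcnj q) = 1" using q by (simp add: k_def qcnj_mult_self d of_real_def)
  have gapb: "gap (recentre z) = k * (gap p * \<sigma>)"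
    using gap_recentre[of z] q by (simp add: d k_def divide_inverse)
  have b: "recentre z = p + w" by (simp add: recentre_def d)
  have 1: "herm (recentre z) u = gap p *\<^sub>R slope u + k *\<^sub>R (q * herm z u)"
    unfolding b by (simp add: herm_p d(2) inv)
  have nw: "herm w w = (k * (norm z)^2) *\<^sub>R 1"
    unfolding herm_self d(2) using q by (simp add: power_mult_distrib norm_inverse k_def d(3) of_real_def power_inverse)
  have 2: "herm (recentre z) w = gap p *\<^sub>R (1 - inverse q) + (k * (norm z)^2) *\<^sub>R 1"
    unfolding b herm_linear nw using slope_inverse_denom[of z] q by (simp add: herm_p d slope_simps)
  have G: "(norm z)^2 = gap p * (1 - \<sigma> - (norm (slope z))^2)"
    using gap_p by (simp add: d(4) G_norm)
  have sl: "q * qcnj (slope z) = qcnj (slope z) + ((norm (slope z))^2) *\<^sub>R 1"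
    by (simp add: d(1) denom_def distrib_right qcnj_mult_self of_real_def)
  have qc: "qcnj q = 1 + qcnj (slope z)" by (simp add: d(1) denom_def)
  have hz: "herm z u = gap p *\<^sub>R (H z u - qcnj (slope z) * slope u)"
    using gap_p by (simp add: H_slope)
  have "herm (recentre z) u - herm (recentre z) w * slope u =
     (gap p * k) *\<^sub>R (q * H z u) + ((k * gap p) *\<^sub>R (qcnj q - q * qcnj (slope z))
         - (k * (norm z)^2) *\<^sub>R 1) * slope u"
    unfolding 1 2 hz inv by (simp add: algebra_simps scaleR_diff_right)
  also have "(k * gap p) *\<^sub>R (qcnj q - q * qcnj (slope z)) - (k * (norm z)^2) *\<^sub>R 1 = (k * gap p * \<sigma>) *\<^sub>R 1"
    unfolding sl qc G by (simp add: algebra_simps)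
  finally have "herm (recentre z) u - herm (recentre z) w * slope u =
     gap (recentre z) *\<^sub>R (q * H z u /\<^sub>R \<sigma> + slope u)"
    unfolding gapb using \<sigma> by (simp add: scaleR_add_right mult_ac)
  then have "(herm (recentre z) u - herm (recentre z) w * slope u) * inverse q =
     gap (recentre z) *\<^sub>R ((q * H z u /\<^sub>R \<sigma> + slope u) * inverse q)" by simp
  then show ?thesis
    unfolding recentre_deriv_def d[symmetric] herm_linear herm_rscale .
qed

text \<open>
  On the diagonal only norms of products occur, which are multiplicative; this avoids most of the
  noncommutative algebra. Polarization then gives the isometry property.
\<close>
lemma recentre_isometry_diag:
  assumes "G z z < 1"
  shows "qh_metric (recentre z) (recentre_deriv z u) (recentre_deriv z u) = qre (ball_form H z u u)"
proof -
  define q N \<sigma> where d: "q = denom z" "N = (norm q)^2" "\<sigma> = 1 - G z z"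
  have q: "q \<noteq> 0" "N \<noteq> 0" using denom_nonzero[OF assms] by (simp_all add: d)
  have \<sigma>: "\<sigma> > 0" using assms by (simp add: d)
  define s where "s = gap p"
  have s: "s > 0" using gap_p by (simp add: s_def)
  let ?b = "recentre z" and ?\<eta> = "recentre_deriv z u"
  have gb: "gap ?b = s * \<sigma> / N" using gap_recentre[of z] q by (simp add: d s_def)
  then have gb0: "gap ?b \<noteq> 0" using s \<sigma> q by simp
  let ?M = "qre (qcnj (H z u) * qcnj q * slope u)"
  have n1: "(norm (herm ?b ?\<eta>))^2 = (gap ?b)^2 * (norm (H z u) ^ 2 / \<sigma>^2 + (norm (slope u))^2 / N + 2 * ?M / (\<sigma> * N))"
    unfolding herm_recentre_deriv[OF assms] d[symmetric] norm_scaleR norm_mult power_mult_distrib norm_quaternion_add_sq norm_inverse power_inverse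
    using q \<sigma> by (simp add: field_simps qcnj_mult del: times_quaternion.sel)
  have ni: "(norm (inverse q))^2 = inverse N" by (simp add: norm_inverse power_inverse d(2))
  have inv: "inverse q = inverse N *\<^sub>R qcnj q" by (simp add: inverse_quaternion d(2))
  have n2: "(norm ?\<eta>)^2 = ((norm u)^2 - 2 * qre (herm u z * qcnj q * slope u) / N + (norm z)^2 * (norm (slope u))^2 / N) / N"
    unfolding recentre_deriv_def norm_rscale power_mult_distrib norm_sub_rscale_sq herm_rscale d(1)[symmetric] ni
    by (simp add: inv divide_inverse mult_ac del: times_quaternion.sel)
  have huz: "herm u z = s *\<^sub>R (qcnj (H z u) - qcnj (slope u) * slope z)"
    using s herm_sym[of u z] by (simp add: H_slope s_def)
  have "qre (herm u z * qcnj q * slope u) = s * ?M - s * qre (qcnj (slope u) * slope z * qcnj q * slope u)"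
    unfolding huz by (simp add: left_diff_distrib right_diff_distrib del: times_quaternion.sel)
  also have "qre (qcnj (slope u) * slope z * qcnj q * slope u) = (norm (slope u))^2 * (qre (slope z) + (norm (slope z))^2)"
  proof -
    have "slope z * qcnj q = slope z + of_real ((norm (slope z))^2)"
      by (simp add: d(1) denom_def distrib_left qcnj_mult_self del: of_real_power)
    then have "qcnj (slope u) * slope z * qcnj q * slope u = 
        qcnj (slope u) * (slope z + of_real ((norm (slope z))^2)) * slope u"
      by (simp add: mult.assoc)
    then have "qre (qcnj (slope u) * slope z * qcnj q * slope u) = 
        qre (slope u * (qcnj (slope u) * (slope z + of_real ((norm (slope z))^2))))"
      using qre_commute by metis
    also have "\<dots> = (norm (slope u))^2 * (qre (slope z) + (norm (slope z))^2)"
      unfolding mult.assoc[symmetric] qcnj_mult_self by (simp add: of_real_def)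
    finally show ?thesis .
  qed
  finally have m: "qre (herm u z * qcnj q * slope u) = s * (?M - (norm (slope u))^2 * (qre (slope z) + (norm (slope z))^2))"
    by (simp add: algebra_simps del: times_quaternion.sel)
  have N: "N = 1 + 2 * qre (slope z) + (norm (slope z))^2" by (simp add: d norm_denom_sq)
  have nz: "(norm z)^2 = s * (1 - \<sigma> - (norm (slope z))^2)"
    using s by (simp add: d(3) G_norm s_def)
  have nu: "G u u = (norm u)^2 / s + (norm (slope u))^2" by (simp add: G_norm s_def)
  have "qh_metric ?b ?\<eta> ?\<eta> = (norm ?\<eta>)^2 / gap ?b + (norm (herm ?b ?\<eta>))^2 / (gap ?b)^2"
    unfolding qh_metric_eq ball_form_herm qcnj_mult_self herm_self by (simp add: divide_inverse_commute of_real_def)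
  also have "\<dots> = (norm ?\<eta>)^2 * N / (s * \<sigma>) + (norm (H z u) ^ 2 / \<sigma>^2 + (norm (slope u))^2 / N + 2 * ?M / (\<sigma> * N))"
    unfolding n1 using gb0 gb by simp
  also have "\<dots> = ((norm u)^2 / s + (norm (slope u))^2) / \<sigma> + norm (H z u) ^ 2 / \<sigma>^2"
  proof -
    define A B C E where ab: "A = (norm u)^2" "B = (norm (slope u))^2" "C = (norm (slope z))^2" "E = qre (slope z)"
    have "(A - 2 * (s * (?M - B * (E + C))) / N + s * (1 - \<sigma> - C) * B / N) / N * N / (s * \<sigma>)
        + (B / N + 2 * ?M / (\<sigma> * N)) = A / (s * \<sigma>) + (B * (2 * (E + C) + (1 - \<sigma> - C) + \<sigma>) / N) / \<sigma>"
      using s \<sigma> q(2) by (simp add: field_simps del: times_quaternion.sel)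
    also have "2 * (E + C) + (1 - \<sigma> - C) + \<sigma> = N" by (simp add: N ab)
    finally show ?thesis
      unfolding n2 m nz using q(2) s \<sigma> by (simp add: ab add_divide_distrib del: times_quaternion.sel)
  qed
  also have "\<dots> = qre (ball_form H z u u)"
    unfolding qre_ball_form qcnj_mult_self qre_of_real nu d(3) ..
  finally show ?thesis .
qed

lemma symmetric_forms_eq:
  fixes B C :: "'a::real_vector \<Rightarrow> 'a \<Rightarrow> real"
  assumes "\<And>u v. B u v = B v u" "\<And>u v. C u v = C v u"
    "\<And>u v w. B (u + v) w = B u w + B v w" "\<And>u v w. C (u + v) w = C u w + C v w"
    and diag: "\<And>u. B u u = C u u"
  shows "B u v = C u v"
proof -
  have "B (u + v) (u + v) = B u u + 2 * B u v + B v v"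
    using assms(1,3) by (metis (no_types, opaque_lifting) add.assoc mult_2)
  moreover have "C (u + v) (u + v) = C u u + 2 * C u v + C v v"
    using assms(2,4) by (metis (no_types, opaque_lifting) add.assoc mult_2)
  ultimately show ?thesis using diag by simp
qed

lemma recentre_isometry:
  assumes "G z z < 1"
  shows "qh_metric (recentre z) (recentre_deriv z u) (recentre_deriv z v) = qre (ball_form H z u v)"
proof -
  interpret z: hermitian_form "ball_form H z" by (rule hermitian_form_ball_form[OF assms])
  interpret b: hermitian_form "ball_form herm (recentre z)"
    by (rule hermitian_form_qh[OF recentre_in_space[OF assms]])
  show ?thesis
  proof (rule symmetric_forms_eq[where u = u and v = v and B = "\<lambda>u v. qh_metric (recentre z) (recentre_deriv z u) (recentre_deriv z v)"
      and C = "\<lambda>u v. qre (ball_form H z u v)"])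
    show "qre (ball_form H z u v) = qre (ball_form H z v u)" for u v by (rule z.G_sym)
    show "qh_metric (recentre z) (recentre_deriv z u) (recentre_deriv z v)
        = qh_metric (recentre z) (recentre_deriv z v) (recentre_deriv z u)" for u v
      by (rule qh_metric_sym)
    show "qh_metric (recentre z) (recentre_deriv z u) (recentre_deriv z u) = qre (ball_form H z u u)" for u
      by (rule recentre_isometry_diag[OF assms])
  qed (simp_all only: z.add_left plus_quaternion.sel
         qh_metric_eq linear_add[OF linear_recentre_deriv] b.add_left)
qed

end

section \<open>Uniqueness of geodesics\<close>

lemma has_field_derivative_imp_has_derivative:
  "(f has_real_derivative D) (at x) \<Longrightarrow> (f has_derivative (\<lambda>h. h * D)) (at x)"
  by (simp add: has_field_derivative_def mult_commute_abs)

text \<open>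
  The function \<open>|f|\<^sup>2 exp(-2Kt)\<close> is decreasing and starts at zero.
\<close>
lemma gronwall_zero:
  fixes f :: "real \<Rightarrow> 'a::real_inner"
  assumes der: "\<And>t. t \<in> {0..1} \<Longrightarrow> (f has_vector_derivative f' t) (at t within {0..1})"
    and bound: "\<And>t. t \<in> {0..1} \<Longrightarrow> norm (f' t) \<le> K * norm (f t)"
    and f0: "f 0 = 0" and t: "t \<in> {0..1}"
  shows "f t = 0"
proof -
  define g where "g t = (f t \<bullet> f t) * exp (- 2 * K * t)" for t
  have cont: "continuous_on {0..1} f"
    by (rule continuous_on_vector_derivative, erule der)
  have "g t \<le> g 0"
  proof (rule DERIV_nonpos_imp_decreasing_open[where f = g and a = 0 and b = t])
    show "0 \<le> t" using t by simp
    show "continuous_on {0..t} g"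
      unfolding g_def using t by (intro continuous_intros continuous_on_subset[OF cont]) auto
    fix x assume x: "0 < x" "x < t"
    then have x01: "x \<in> {0..1}" "x \<in> interior {0..1}" using t by auto
    have "(f has_vector_derivative f' x) (at x)"
      using der[OF x01(1)] at_within_interior[OF x01(2)] by simp
    then have "((\<lambda>t. f t \<bullet> f t) has_real_derivative (2 * (f x \<bullet> f' x))) (at x)"
      unfolding has_vector_derivative_def has_field_derivative_def
      by (auto intro!: derivative_eq_intros simp: inner_commute)
    then have "(g has_real_derivative (2 * (f x \<bullet> f' x) - 2 * K * (f x \<bullet> f x)) * exp (- 2 * K * x)) (at x)"
      unfolding g_def by (auto intro!: derivative_eq_intros simp: algebra_simps)
    moreover have "f x \<bullet> f' x \<le> norm (f x) * norm (f' x)" by (rule norm_cauchy_schwarz)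
    moreover have "norm (f x) * norm (f' x) \<le> norm (f x) * (K * norm (f x))"
      by (intro mult_left_mono bound x01) simp
    then have "2 * (f x \<bullet> f' x) - 2 * K * (f x \<bullet> f x) \<le> 0"
      using \<open>f x \<bullet> f' x \<le> norm (f x) * norm (f' x)\<close> by (simp add: dot_square_norm power2_eq_square mult_ac)
    then have "(2 * (f x \<bullet> f' x) - 2 * K * (f x \<bullet> f x)) * exp (- 2 * K * x) \<le> 0"
      by (intro mult_nonpos_nonneg) auto
    ultimately show "\<exists>y. (g has_real_derivative y) (at x) \<and> y \<le> 0" by blast
  qed
  then have "(f t \<bullet> f t) * exp (- 2 * K * t) \<le> 0" by (simp add: g_def f0)
  then show ?thesis by (simp add: mult_le_0_iff not_le[symmetric]) (metis inner_ge_zero inner_eq_zero_iff antisym_conv)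
qed

text \<open>
  \<open>f\<close> and \<open>g\<close> are bounded and differ by at most a multiple of \<open>E\<close>. The relation is stable under bounded
  bilinear operations, which gives the Lipschitz estimate for the geodesic equation term by term.
\<close>
definition close_along :: "(real \<Rightarrow> real) \<Rightarrow> (real \<Rightarrow> 'a::real_normed_vector) \<Rightarrow> (real \<Rightarrow> 'a) \<Rightarrow> bool" where
  "close_along E f g \<longleftrightarrow> (\<exists>K. \<forall>t\<in>{0..1}. norm (f t - g t) \<le> K * E t \<and> norm (f t) \<le> K \<and> norm (g t) \<le> K)"

lemma close_alongI:
  assumes "continuous_on {0..1} f" "continuous_on {0..1} g"
    and "\<And>t. t \<in> {0..1} \<Longrightarrow> norm (f t - g t) \<le> K * E t" "\<And>t. 0 \<le> E t"
  shows "close_along E f g"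
proof -
  have "bounded (f ` {0..1})" "bounded (g ` {0..1})"
    by (intro compact_imp_bounded compact_continuous_image assms compact_Icc)+
  then obtain a b where ab: "\<forall>t\<in>{0..1}. norm (f t) \<le> a" "\<forall>t\<in>{0..1}. norm (g t) \<le> b"
    unfolding bounded_iff by auto
  show ?thesis
    unfolding close_along_def
  proof (intro exI[of _ "max K (max a b)"] ballI conjI)
    fix t :: real assume t: "t \<in> {0..1}"
    have "K * E t \<le> max K (max a b) * E t" by (intro mult_right_mono assms(4)) simp
    then show "norm (f t - g t) \<le> max K (max a b) * E t" using assms(3)[OF t] by linarith
    show "norm (f t) \<le> max K (max a b)" "norm (g t) \<le> max K (max a b)"
      using ab t by (auto simp: le_max_iff_disj)
  qed
qed

lemma close_along_bilinear:
  assumes "bounded_bilinear pr" and E: "\<And>t. 0 \<le> E t"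
    and "close_along E f1 g1" "close_along E f2 g2"
  shows "close_along E (\<lambda>t. pr (f1 t) (f2 t)) (\<lambda>t. pr (g1 t) (g2 t))"
proof -
  interpret bounded_bilinear pr by fact
  obtain K where K: "K > 0" "\<And>a b. norm (pr a b) \<le> norm a * norm b * K" using pos_bounded by blast
  obtain K1 where K1: "\<And>t. t \<in> {0..1} \<Longrightarrow> norm (f1 t - g1 t) \<le> K1 * E t" 
    "\<And>t. t \<in> {0..1} \<Longrightarrow> norm (f1 t) \<le> K1" "\<And>t. t \<in> {0..1} \<Longrightarrow> norm (g1 t) \<le> K1"
    using assms(3) unfolding close_along_def by blast
  obtain K2 where K2: "\<And>t. t \<in> {0..1} \<Longrightarrow> norm (f2 t - g2 t) \<le> K2 * E t" 
    "\<And>t. t \<in> {0..1} \<Longrightarrow> norm (f2 t) \<le> K2" "\<And>t. t \<in> {0..1} \<Longrightarrow> norm (g2 t) \<le> K2"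
    using assms(4) unfolding close_along_def by blast
  have pos: "0 \<le> K1" "0 \<le> K2"
    using K1(2)[of 0] K2(2)[of 0] by (auto intro: order_trans[OF norm_ge_zero])
  have b: "norm (pr a b) \<le> A * B * K" if "norm a \<le> A" "norm b \<le> B" for a b A B
  proof -
    have "norm a * norm b * K \<le> A * B * K"
    proof -
      have "0 \<le> A" "0 \<le> B" using that by (auto intro: order_trans[OF norm_ge_zero])
      then show ?thesis using that K(1) by (intro mult_mono mult_nonneg_nonneg) auto
    qed
    then show ?thesis using K(2)[of a b] by linarith
  qed
  show ?thesis
    unfolding close_along_def
  proof (intro exI[of _ "max (2 * K1 * K2 * K) (K1 * K2 * K)"] ballI conjI)
    fix t :: real assume t: "t \<in> {0..1}"
    have "pr (f1 t) (f2 t) - pr (g1 t) (g2 t) = pr (f1 t - g1 t) (f2 t) + pr (g1 t) (f2 t - g2 t)"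
      by (simp add: diff_left diff_right)
    then have "norm (pr (f1 t) (f2 t) - pr (g1 t) (g2 t)) \<le> K1 * E t * K2 * K + K1 * (K2 * E t) * K"
      by (simp only:) (rule order_trans[OF norm_triangle_ineq
          add_mono[OF b[OF K1(1)[OF t] K2(2)[OF t]] b[OF K1(3)[OF t] K2(1)[OF t]]]])
    also have "\<dots> = 2 * K1 * K2 * K * E t" by simp
    also have "\<dots> \<le> max (2 * K1 * K2 * K) (K1 * K2 * K) * E t"
      by (intro mult_right_mono E) simp
    finally show "norm (pr (f1 t) (f2 t) - pr (g1 t) (g2 t)) \<le> max (2 * K1 * K2 * K) (K1 * K2 * K) * E t" .
    show "norm (pr (f1 t) (f2 t)) \<le> max (2 * K1 * K2 * K) (K1 * K2 * K)"
      "norm (pr (g1 t) (g2 t)) \<le> max (2 * K1 * K2 * K) (K1 * K2 * K)"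
      using b[OF K1(2)[OF t] K2(2)[OF t]] b[OF K1(3)[OF t] K2(3)[OF t]] by simp_all
  qed
qed

text \<open>
  With \<open>E\<close> the distance of positions and velocities, the difference of the two right-hand sides is bounded by
  a multiple of \<open>E\<close>, because \<open>levi_civita\<close> is composed of bilinear operations and the inverse of \<open>gap\<close>, which
  is bounded along a compact arc in the open ball.
\<close>
lemma geodesic_unique:
  fixes c d :: "real \<Rightarrow> real^('m::finite \<times> 4)"
  assumes c: "geodesic_segment qh_space qh_metric c c'" and d: "geodesic_segment qh_space qh_metric d d'"
    and init: "c 0 = d 0" "c' 0 = d' 0" and t: "t \<in> {0..1}"
  shows "c t = d t"
proof -
  define E where "E t = norm (c t - d t, c' t - d' t)" for t
  have E: "0 \<le> E t" for t by (simp add: E_def)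
  have cd: "c t \<in> qh_space" "(c has_vector_derivative c' t) (at t within {0..1})"
     "(c' has_vector_derivative - levi_civita (c t) (c' t) (c' t)) (at t within {0..1})"
     "d t \<in> qh_space" "(d has_vector_derivative d' t) (at t within {0..1})"
     "(d' has_vector_derivative - levi_civita (d t) (d' t) (d' t)) (at t within {0..1})"
     if "t \<in> {0..1}" for t
    using c d that by (auto simp: geodesic_segment_def christoffel_qh[symmetric])
  have cont: "continuous_on {0..1} c" "continuous_on {0..1} c'" "continuous_on {0..1} d" "continuous_on {0..1} d'"
    by (rule continuous_on_vector_derivative, erule cd)+
  have gap: "gap (c t) > 0" "gap (d t) > 0" if "t \<in> {0..1}" for t
    using cd(1,4)[OF that] by (simp_all add: gap_pos)
  have close: "close_along E c d" "close_along E c' d'"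
    by (rule close_alongI[where K = 1]; use cont E in \<open>auto simp: E_def norm_fst_le norm_snd_le\<close>)+
  have inner: "close_along E (\<lambda>t. c t \<bullet> c t) (\<lambda>t. d t \<bullet> d t)"
    by (rule close_along_bilinear[OF bounded_bilinear_inner E close(1) close(1)])
  then obtain K where K: "\<forall>t\<in>{0..1}. norm (c t \<bullet> c t - d t \<bullet> d t) \<le> K * E t"
    unfolding close_along_def by blast
  have gapclose: "close_along E (\<lambda>t. inverse (gap (c t))) (\<lambda>t. inverse (gap (d t)))"
  proof -
    have ci: "continuous_on {0..1} (\<lambda>t. inverse (gap (c t)))" "continuous_on {0..1} (\<lambda>t. inverse (gap (d t)))"
      using gap cont unfolding gap_def by (auto intro!: continuous_intros simp: less_imp_neq[symmetric])
    have "bounded ((\<lambda>t. inverse (gap (c t))) ` {0..1})" "bounded ((\<lambda>t. inverse (gap (d t))) ` {0..1})"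
      by (intro compact_imp_bounded compact_continuous_image ci compact_Icc)+
    then obtain a b where ab: "\<forall>t\<in>{0..1}. norm (inverse (gap (c t))) \<le> a" "\<forall>t\<in>{0..1}. norm (inverse (gap (d t))) \<le> b"
      unfolding bounded_iff by auto
    show ?thesis
    proof (rule close_alongI[where K = "a * b * K"])
      fix t :: real assume t: "t \<in> {0..1}"
      have a: "0 \<le> a" "0 \<le> b" using ab t by (meson norm_ge_zero order_trans)+
      have "norm (inverse (gap (c t)) - inverse (gap (d t))) =
          norm (inverse (gap (c t))) * norm (inverse (gap (d t))) * norm (c t \<bullet> c t - d t \<bullet> d t)"
        using gap[OF t] unfolding norm_mult[symmetric] by (simp add: inverse_diff_inverse gap_def abs_mult abs_minus_commute mult_ac)
      also have "\<dots> \<le> a * b * (K * E t)"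
        using ab K t a by (intro mult_mono) auto
      finally show "norm (inverse (gap (c t)) - inverse (gap (d t))) \<le> a * b * K * E t" by (simp add: mult.assoc)
    qed (use ci E in auto)
  qed
  have "close_along E (\<lambda>t. inverse (gap (c t)) *\<^sub>R (c' t \<star> herm (c t) (c' t)))
      (\<lambda>t. inverse (gap (d t)) *\<^sub>R (d' t \<star> herm (d t) (d' t)))"
    by (intro close_along_bilinear[OF bounded_bilinear_scaleR E] gapclose
       close_along_bilinear[OF bounded_bilinear_rscale E] close close_along_bilinear[OF bounded_bilinear_herm E])
  then obtain L where L: "\<And>t. t \<in> {0..1} \<Longrightarrow> norm (inverse (gap (c t)) *\<^sub>R (c' t \<star> herm (c t) (c' t)) -
      inverse (gap (d t)) *\<^sub>R (d' t \<star> herm (d t) (d' t))) \<le> L * E t"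
    unfolding close_along_def by blast
  have "(c t - d t, c' t - d' t) = 0"
  proof (rule gronwall_zero[OF _ _ _ t, where K = "1 + 2 * L"
      and f' = "\<lambda>t. (c' t - d' t, - levi_civita (c t) (c' t) (c' t) + levi_civita (d t) (d' t) (d' t))"])
    fix t :: real assume t: "t \<in> {0..1}"
    have "((\<lambda>t. c t - d t) has_vector_derivative c' t - d' t) (at t within {0..1})"
      by (intro derivative_intros cd t)
    moreover have "((\<lambda>t. c' t - d' t) has_vector_derivative
        - levi_civita (c t) (c' t) (c' t) + levi_civita (d t) (d' t) (d' t)) (at t within {0..1})"
      using has_vector_derivative_diff[OF cd(3)[OF t] cd(6)[OF t]] by simp
    ultimately show "((\<lambda>t. (c t - d t, c' t - d' t)) has_vector_derivative
       (c' t - d' t, - levi_civita (c t) (c' t) (c' t) + levi_civita (d t) (d' t) (d' t))) (at t within {0..1})"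
      by (rule has_vector_derivative_Pair)
    have 1: "norm (c' t - d' t) \<le> E t" by (simp add: E_def norm_snd_le)
    have lc: "levi_civita x v v = 2 *\<^sub>R (inverse (gap x) *\<^sub>R (v \<star> herm x v))" for x v :: "real^('m \<times> 4)"
      by (simp add: levi_civita_def scaleR_2[symmetric])
    have "- levi_civita (c t) (c' t) (c' t) + levi_civita (d t) (d' t) (d' t) =
       - 2 *\<^sub>R (inverse (gap (c t)) *\<^sub>R (c' t \<star> herm (c t) (c' t)) - inverse (gap (d t)) *\<^sub>R (d' t \<star> herm (d t) (d' t)))"
      unfolding lc by (simp add: scaleR_diff_right)
    then have 2: "norm (- levi_civita (c t) (c' t) (c' t) + levi_civita (d t) (d' t) (d' t)) \<le> 2 * (L * E t)"
      using L[OF t] by simp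
    show "norm (c' t - d' t, - levi_civita (c t) (c' t) (c' t) + levi_civita (d t) (d' t) (d' t))
        \<le> (1 + 2 * L) * norm (c t - d t, c' t - d' t)"
      using 1 2 norm_Pair_le[of "c' t - d' t" "- levi_civita (c t) (c' t) (c' t) + levi_civita (d t) (d' t) (d' t)"]
      unfolding E_def[symmetric] by (simp add: algebra_simps)
  qed (use init in \<open>auto simp: zero_prod_def\<close>)
  then show ?thesis by (simp add: zero_prod_def)
qed

section \<open>The exponential map and polar coordinates\<close>

context qh_point
begin

definition mnorm :: "real^('m \<times> 4) \<Rightarrow> real" where "mnorm u = sqrt (G u u)"

lemma mnorm_sq: "(mnorm u)^2 = G u u" by (simp add: mnorm_def G_nonneg)
lemma mnorm_nonneg: "0 \<le> mnorm u" by (simp add: mnorm_def G_nonneg)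
lemma mnorm_eq_0_iff: "mnorm u = 0 \<longleftrightarrow> u = 0" by (simp add: mnorm_def G_eq_0_iff)
lemma mnorm_scaleR: "mnorm (c *\<^sub>R u) = \<bar>c\<bar> * mnorm u"
  by (simp add: mnorm_def form_simps real_sqrt_mult)

text \<open>
  The radial reparametrization from distance to Euclidean radius. At the origin the quotient is \<open>0\<close>, and so is
  the value, as it should be.
\<close>
definition shrink :: "real^('m \<times> 4) \<Rightarrow> real^('m \<times> 4)" where
  "shrink u = (tanh (mnorm u) / mnorm u) *\<^sub>R u"

lemma tanh_sq_less_1: "(tanh (x :: real))^2 < 1"
  using tanh_real_bounds[of x] by (simp add: abs_square_less_1 abs_less_iff)

lemma tanh_artanh_real: "\<bar>x\<bar> < 1 \<Longrightarrow> tanh (artanh x) = (x :: real)"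
proof -
  assume x: "\<bar>x\<bar> < 1"
  then have "exp (- 2 * artanh x) = (1 - x) / (1 + x)"
    by (simp add: artanh_def exp_minus abs_less_iff)
  then have "tanh (artanh x) = (1 - (1 - x) / (1 + x)) / (1 + (1 - x) / (1 + x))"
    by (simp only: tanh_real_altdef)
  moreover have "1 - (1 - x) / (1 + x) = 2 * x / (1 + x)" "1 + (1 - x) / (1 + x) = 2 / (1 + x)"
    using x by (simp_all add: field_simps abs_less_iff)
  ultimately show ?thesis using x by (simp add: abs_less_iff)
qed

text \<open>
  Along the curve, \<open>denom\<close> takes values in the commutative field generated by \<open>slope u\<close>, so that the velocity
  is \<open>\<sigma>(t) u q(t)\<^sup>-\<^sup>2\<close> with \<open>q = denom\<close>; this and \<open>herm_recentre_deriv\<close> turn the geodesic equation into the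
  derivatives of \<open>tanh\<close>.
\<close>
lemma geodesic_recentre:
  assumes "u \<noteq> 0"
  defines "k \<equiv> mnorm u"
  defines "\<tau> \<equiv> \<lambda>t. tanh (k * t) / k"
  defines "c \<equiv> \<lambda>t. recentre (\<tau> t *\<^sub>R u)"
  defines "c' \<equiv> \<lambda>t. (1 - (tanh (k * t))^2) *\<^sub>R (u \<star> (inverse (denom (\<tau> t *\<^sub>R u)) * inverse (denom (\<tau> t *\<^sub>R u))))"
  shows "geodesic_segment qh_space qh_metric c c'" "c 0 = p" "c' 0 = u" "c 1 = recentre (shrink u)"
proof -
  have k: "k > 0" using assms(1) mnorm_nonneg[of u] mnorm_eq_0_iff[of u] by (simp add: k_def)
  define l where "l = slope u"
  define i where "i t = inverse (1 + \<tau> t *\<^sub>R l)" for t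
  define \<sigma> where "\<sigma> t = 1 - (tanh (k * t))^2" for t
  have den: "denom (\<tau> t *\<^sub>R u) = 1 + \<tau> t *\<^sub>R l" for t by (simp add: denom_def slope_simps l_def)
  have c': "c' t = \<sigma> t *\<^sub>R (u \<star> (i t * i t))" for t by (simp add: c'_def den i_def \<sigma>_def)
  have Guu: "G u u = k^2" by (simp add: k_def mnorm_sq)
  have Gz: "G (\<tau> t *\<^sub>R u) (\<tau> t *\<^sub>R u) = (tanh (k * t))^2" for t
    using k by (simp add: form_simps Guu \<tau>_def power2_eq_square)
  then have lt: "G (\<tau> t *\<^sub>R u) (\<tau> t *\<^sub>R u) < 1" for t by (simp only: tanh_sq_less_1)
  have q: "1 + \<tau> t *\<^sub>R l \<noteq> 0" for t using denom_nonzero[OF lt[of t]] by (simp add: den)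
  have comm: "l * i t = i t * l" for t
  proof -
    define q' where "q' = 1 + \<tau> t *\<^sub>R l"
    have iq: "i t * q' = 1" "q' * i t = 1" using q[of t] by (simp_all add: i_def q'_def)
    have "l * i t = (i t * q') * l * i t" by (simp add: iq)
    also have "\<dots> = i t * (l * q') * i t" by (simp add: q'_def algebra_simps)
    also have "\<dots> = i t * l" by (simp add: mult.assoc iq)
    finally show ?thesis .
  qed
  have d\<tau>: "(\<tau> has_real_derivative \<sigma> t) (at t)" for t
    unfolding \<tau>_def \<sigma>_def using k by (auto intro!: derivative_eq_intros)
  have d\<sigma>: "(\<sigma> has_real_derivative - 2 * k^2 * \<tau> t * \<sigma> t) (at t)" for t
    unfolding \<tau>_def \<sigma>_def[abs_def] using k by (auto intro!: derivative_eq_intros simp: power2_eq_square)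
  have v\<tau>: "(\<tau> has_derivative (\<lambda>h. h * \<sigma> t)) (at t)" and v\<sigma>: "(\<sigma> has_derivative (\<lambda>h. h * (- 2 * k^2 * \<tau> t * \<sigma> t))) (at t)" for t
    using d\<tau>[of t, THEN has_field_derivative_imp_has_derivative] d\<sigma>[of t, THEN has_field_derivative_imp_has_derivative]
    by (auto elim!: has_derivative_eq_rhs)
  \<comment> \<open>the velocity; \<open>i t\<close> is the inverse of \<open>denom\<close> and commutes with \<open>l = slope u\<close>\<close>
  have rd: "recentre_deriv (\<tau> t *\<^sub>R u) (\<sigma> t *\<^sub>R u) = c' t" for t
  proof -
    have "1 - \<tau> t *\<^sub>R (i t * l) = i t"
    proof -
      have "i t * (1 + \<tau> t *\<^sub>R l) = 1" using q[of t] by (simp add: i_def)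
      then have "i t + \<tau> t *\<^sub>R (i t * l) = 1" by (simp add: distrib_left)
      then show ?thesis by (simp add: eq_diff_eq diff_eq_eq)
    qed
    then have "c' t = \<sigma> t *\<^sub>R (u \<star> (1 - \<tau> t *\<^sub>R (i t * l)) \<star> i t)" by (simp add: rscale_assoc c')
    then show ?thesis
      unfolding recentre_deriv_def den i_def[symmetric] slope_simps l_def[symmetric]
      by (simp add: rscale_distrib rscale_assoc scaleR_diff_right mult.assoc left_diff_distrib mult.commute)
  qed
  have dc: "(c has_vector_derivative c' t) (at t)" for t
  proof -
    have "((\<lambda>t. \<tau> t *\<^sub>R u) has_derivative (\<lambda>h. (h * \<sigma> t) *\<^sub>R u)) (at t)"
      by (rule derivative_eq_intros v\<tau> refl)+ simp
    then have "((\<lambda>t. recentre (\<tau> t *\<^sub>R u)) has_derivative (\<lambda>h. recentre_deriv (\<tau> t *\<^sub>R u) ((h * \<sigma> t) *\<^sub>R u))) (at t)"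
      by (rule has_derivative_compose) (rule has_derivative_recentre[OF denom_nonzero[OF lt]])
    moreover have "recentre_deriv (\<tau> t *\<^sub>R u) ((h * \<sigma> t) *\<^sub>R u) = h *\<^sub>R c' t" for h
      using linear_scale[OF linear_recentre_deriv, of "\<tau> t *\<^sub>R u" h "\<sigma> t *\<^sub>R u"] by (simp add: rd)
    ultimately show ?thesis by (simp add: c_def has_vector_derivative_def)
  qed
  have lev: "levi_civita (c t) (c' t) (c' t) =
      (2 * k^2 * \<tau> t * \<sigma> t) *\<^sub>R (u \<star> (i t * i t)) + (2 * (\<sigma> t)^2) *\<^sub>R (u \<star> (i t * i t * l * i t))" for t
  proof -
    have \<sigma>: "\<sigma> t \<noteq> 0" "1 - G (\<tau> t *\<^sub>R u) (\<tau> t *\<^sub>R u) = \<sigma> t"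
      using tanh_sq_less_1[of "k * t"] unfolding Gz by (auto simp: \<sigma>_def)
    have gc: "gap (c t) \<noteq> 0" using recentre_in_space[OF lt[of t]] by (simp add: c_def gap_pos)
    have "H (\<tau> t *\<^sub>R u) (\<sigma> t *\<^sub>R u) = (\<tau> t * \<sigma> t * k^2) *\<^sub>R 1"
      using form_self[of u] by (simp add: form_simps Guu of_real_def)
    moreover have "(1 + \<tau> t *\<^sub>R l) * i t = 1" using q[of t] by (simp add: i_def)
    ultimately have "herm (c t) (c' t) = gap (c t) *\<^sub>R ((\<tau> t * k^2) *\<^sub>R 1 + \<sigma> t *\<^sub>R (l * i t))"
      using herm_recentre_deriv[OF lt, of t "\<sigma> t *\<^sub>R u"] \<sigma>
      by (simp add: rd den i_def[symmetric] c_def slope_simps l_def[symmetric] distrib_right mult.assoc)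
    then have "inverse (gap (c t)) *\<^sub>R (c' t \<star> herm (c t) (c' t)) = c' t \<star> ((\<tau> t * k^2) *\<^sub>R 1 + \<sigma> t *\<^sub>R (l * i t))"
      using gc by simp
    moreover have "levi_civita (c t) (c' t) (c' t) = 2 *\<^sub>R (inverse (gap (c t)) *\<^sub>R (c' t \<star> herm (c t) (c' t)))"
      by (simp add: levi_civita_def scaleR_2[symmetric])
    ultimately show ?thesis
      unfolding c' by (simp add: rscale_distrib rscale_assoc scaleR_add_right power2_eq_square mult_ac mult.assoc)
  qed
  have dc': "(c' has_vector_derivative - levi_civita (c t) (c' t) (c' t)) (at t)" for t
  proof -
    have "((\<lambda>t. \<sigma> t *\<^sub>R (u \<star> (i t * i t))) has_derivative (\<lambda>h. h *\<^sub>R - levi_civita (c t) (c' t) (c' t))) (at t)"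
      unfolding i_def
      apply (rule derivative_eq_intros v\<tau> v\<sigma> q refl)+
      apply (rule ext)
      unfolding i_def[symmetric] lev
      apply (simp add: rscale_distrib scaleR_add_right scaleR_diff_right mult.assoc comm power2_eq_square algebra_simps)
      apply (simp only: mult_2 scaleR_add_right scaleR_add_left[symmetric])
      apply simp
      done
    then show ?thesis unfolding has_vector_derivative_def c'[abs_def] .
  qed
  show "geodesic_segment qh_space qh_metric c c'"
    unfolding geodesic_segment_def
  proof (intro ballI conjI)
    fix t :: real
    show c: "c t \<in> qh_space" using recentre_in_space[OF lt] by (simp add: c_def)
    show "(c has_vector_derivative c' t) (at t within {0..1})"
      using dc has_vector_derivative_at_within by blast
    show "(c' has_vector_derivative - christoffel qh_metric (c t) (c' t) (c' t)) (at t within {0..1})"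
      using dc' has_vector_derivative_at_within unfolding christoffel_qh[OF c] by blast
  qed
  show "c 0 = p" "c' 0 = u" by (simp_all add: c_def c'_def \<tau>_def recentre_def denom_def slope_def std.zero_right)
  show "c 1 = recentre (shrink u)" by (simp add: c_def \<tau>_def shrink_def k_def)
qed

lemma recentre_0: "recentre 0 = p" by (simp add: recentre_def)

lemma qh_exp_eq: "qh_exp p u = recentre (shrink u)"
proof -
  have "\<exists>c c'. geodesic_segment qh_space qh_metric c c' \<and> c 0 = p \<and> c' 0 = u \<and> c 1 = recentre (shrink u)"
  proof (cases "u = 0")
    case True
    have "geodesic_segment qh_space qh_metric (\<lambda>t. p) (\<lambda>t. 0)"
      unfolding geodesic_segment_def
      by (auto simp: p_in_space christoffel_qh levi_civita_def intro!: derivative_eq_intros)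
    then show ?thesis using True by (intro exI[of _ "\<lambda>t. p"] exI[of _ "\<lambda>t. 0"]) (simp add: shrink_def recentre_0)
  next
    case False
    show ?thesis using geodesic_recentre[OF False] by blast
  qed
  then obtain c c' where c: "geodesic_segment qh_space qh_metric c c'" "c 0 = p" "c' 0 = u" "c 1 = recentre (shrink u)"
    by blast
  show ?thesis
    unfolding riemann_exp_def
  proof (rule the_equality)
    show "\<exists>c c'. geodesic_segment qh_space qh_metric c c' \<and> c 0 = p \<and> c' 0 = u \<and> c 1 = recentre (shrink u)"
      using c by blast
    fix y assume "\<exists>d d'. geodesic_segment qh_space qh_metric d d' \<and> d 0 = p \<and> d' 0 = u \<and> d 1 = y"
    then obtain d d' where d: "geodesic_segment qh_space qh_metric d d'" "d 0 = p" "d' 0 = u" "d 1 = y" by blast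
    show "y = recentre (shrink u)"
      using geodesic_unique[OF c(1) d(1), of 1] c d by simp
  qed
qed

lemma shrink_unit: "G \<theta> \<theta> = 1 \<Longrightarrow> 0 \<le> r \<Longrightarrow> shrink (r *\<^sub>R \<theta>) = tanh r *\<^sub>R \<theta>"
  by (cases "r = 0") (auto simp: shrink_def mnorm_scaleR mnorm_def[of \<theta>])

lemma qh_exp_unit: "G \<theta> \<theta> = 1 \<Longrightarrow> 0 \<le> r \<Longrightarrow> qh_exp p (r *\<^sub>R \<theta>) = recentre (tanh r *\<^sub>R \<theta>)"
  by (simp add: qh_exp_eq shrink_unit)

lemma qh_metric_p: "qh_metric p u v = G u v" by (rule qh_metric_eq)

lemma G_tanh: "G \<theta> \<theta> = 1 \<Longrightarrow> G (tanh r *\<^sub>R \<theta>) (tanh r *\<^sub>R \<theta>) < 1"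
  using tanh_sq_less_1[of r] by (simp add: form_simps power2_eq_square)

lemma qh_polar_eqI:
  assumes "0 < r" "G \<theta> \<theta> = 1" "y = recentre (tanh r *\<^sub>R \<theta>)"
  shows "qh_polar p y = (r, \<theta>)"
  unfolding polar_coords_def
proof (rule the_equality)
  show "case (r, \<theta>) of (r, \<theta>) \<Rightarrow> 0 < r \<and> qh_metric p \<theta> \<theta> = 1 \<and> qh_exp p (r *\<^sub>R \<theta>) = y"
    using assms by (simp add: qh_metric_p qh_exp_unit)
  fix x assume "case x of (r, \<theta>) \<Rightarrow> 0 < r \<and> qh_metric p \<theta> \<theta> = 1 \<and> qh_exp p (r *\<^sub>R \<theta>) = y"
  then obtain r' \<theta>' where x: "x = (r', \<theta>')" "0 < r'" "G \<theta>' \<theta>' = 1" "recentre (tanh r' *\<^sub>R \<theta>') = y"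
    by (cases x) (auto simp: qh_metric_p qh_exp_unit)
  have eq: "tanh r' *\<^sub>R \<theta>' = tanh r *\<^sub>R \<theta>"
    using decentre_recentre(1)[OF denom_nonzero[OF G_tanh[OF x(3)]], of r'] x(4)
      decentre_recentre(1)[OF denom_nonzero[OF G_tanh[OF assms(2)]], of r] assms(3) by simp
  have "mnorm (tanh r *\<^sub>R \<theta>) = tanh r" "mnorm (tanh r' *\<^sub>R \<theta>') = tanh r'"
    using x(2,3) assms(1,2) by (simp_all add: mnorm_scaleR mnorm_def[of \<theta>] mnorm_def[of \<theta>'])
  then have "tanh r' = tanh r" using eq by metis
  then have "r' = r" by (metis artanh_tanh_real)
  then show "x = (r, \<theta>)" using x(1) eq assms(1) by simp
qed

lemma polar_exists:
  assumes "y \<in> qh_space - {p}"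
  obtains r \<theta> where "0 < r" "G \<theta> \<theta> = 1" "y = recentre (tanh r *\<^sub>R \<theta>)" "qh_polar p y = (r, \<theta>)"
proof -
  define z where "z = decentre y"
  have y: "recentre z = y" unfolding z_def using recentre_decentre(1)[OF slope_diff_p] assms by blast
  then have "z \<noteq> 0" using recentre_0 assms by auto
  then have T: "mnorm z > 0" using mnorm_nonneg[of z] mnorm_eq_0_iff[of z] by simp
  have "G z z < 1" unfolding z_def using decentre_in_ball assms by blast
  then have T1: "mnorm z < 1" by (simp add: mnorm_def)
  define r where "r = artanh (mnorm z)"
  have tr: "tanh r = mnorm z" unfolding r_def by (rule tanh_artanh_real) (use T T1 in simp)
  have "0 < r" using T tr by (metis tanh_real_pos_iff)
  moreover have "G (z /\<^sub>R mnorm z) (z /\<^sub>R mnorm z) = 1"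
    using T by (simp add: form_simps mnorm_sq[symmetric] power2_eq_square field_simps)
  moreover have "y = recentre (tanh r *\<^sub>R (z /\<^sub>R mnorm z))" using T tr y by simp
  ultimately show ?thesis using qh_polar_eqI that by blast
qed

end

section \<open>The splitting of the tangent spaces\<close>

context qh_point
begin

text \<open>
  For \<open>X\<close> orthogonal to \<open>\<theta>\<close> the quaternion \<open>H \<theta> X\<close> is imaginary, hence \<open>H X \<theta> = - H \<theta> X\<close>, and three of the four
  terms of the curvature tensor coincide.
\<close>
lemma radial_curvature:
  assumes "G \<theta> \<theta> = 1" "G X \<theta> = 0"
  shows "riemann_tensor qh_metric p X \<theta> \<theta> = - X - 3 *\<^sub>R (\<theta> \<star> H \<theta> X)"
proof -
  have "H \<theta> \<theta> = 1" using form_self[of \<theta>] assms(1) by simp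
  moreover have "H X \<theta> = - H \<theta> X"
    using form_sym[of X \<theta>] assms(2) G_sym[of X \<theta>] by (simp add: qcnj_eq)
  ultimately have "riemann_tensor qh_metric p X \<theta> \<theta> =
      - (\<theta> \<star> H \<theta> X) + - (\<theta> \<star> H \<theta> X) - X - \<theta> \<star> H \<theta> X"
    unfolding riemann_tensor_qh[OF p_in_space] by simp
  moreover have "3 *\<^sub>R v = v + v + v" for v :: "real^('m \<times> 4)"
    by (simp add: vec_eq_iff)
  ultimately show ?thesis by simp
qed

lemma radial_eigenspace_minus_1:
  assumes "G \<theta> \<theta> = 1"
  shows "radial_eigenspace qh_metric p \<theta> (-1) = {X. H \<theta> X = 0}"
proof (intro set_eqI iffI)
  fix X assume "X \<in> radial_eigenspace qh_metric p \<theta> (-1)"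
  then have X: "G X \<theta> = 0" "riemann_tensor qh_metric p X \<theta> \<theta> = - X"
    by (simp_all add: radial_eigenspace_def qh_metric_p)
  then have "\<theta> \<star> H \<theta> X = 0" using radial_curvature[OF assms X(1)] by simp
  then have "H \<theta> \<theta> * H \<theta> X = 0" unfolding rscale_right[symmetric] by (simp add: zero_right)
  then show "X \<in> {X. H \<theta> X = 0}" using form_self[of \<theta>] assms by simp
next
  fix X assume "X \<in> {X. H \<theta> X = 0}"
  moreover from this have "G X \<theta> = 0" using G_sym[of X \<theta>] by simp
  ultimately show "X \<in> radial_eigenspace qh_metric p \<theta> (-1)"
    using radial_curvature[OF assms, of X] by (simp add: radial_eigenspace_def qh_metric_p)
qed

lemma radial_eigenspace_minus_4:
  assumes "G \<theta> \<theta> = 1"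
  shows "radial_eigenspace qh_metric p \<theta> (-4) = {X. G \<theta> X = 0 \<and> \<theta> \<star> H \<theta> X = X}"
proof (intro set_eqI)
  fix X :: "real^('m \<times> 4)"
  have *: "- X - 3 *\<^sub>R Y = (-4) *\<^sub>R X \<longleftrightarrow> Y = X" for Y
  proof
    assume eq: "- X - 3 *\<^sub>R Y = (-4) *\<^sub>R X"
    show "Y = X"
      unfolding vec_eq_iff
    proof
      fix i
      show "Y $ i = X $ i" using arg_cong[OF eq, of "\<lambda>v. v $ i"] by simp
    qed
  qed (simp add: vec_eq_iff)
  show "X \<in> radial_eigenspace qh_metric p \<theta> (-4) \<longleftrightarrow> X \<in> {X. G \<theta> X = 0 \<and> \<theta> \<star> H \<theta> X = X}"
  proof (cases "G X \<theta> = 0")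
    case True
    then have "G \<theta> X = 0" using G_sym[of X \<theta>] by simp
    then show ?thesis
      by (simp only: radial_eigenspace_def qh_metric_p radial_curvature[OF assms True] * mem_Collect_eq True)
  next
    case False
    then have "G \<theta> X \<noteq> 0" using G_sym[of X \<theta>] by simp
    then show ?thesis using False by (simp only: radial_eigenspace_def qh_metric_p mem_Collect_eq simp_thms)
  qed
qed

lemma has_derivative_mnorm:
  assumes "x \<noteq> 0"
  shows "(mnorm has_derivative (\<lambda>h. G x h / mnorm x)) (at x)"
proof -
  have G: "G x x > 0" using form_pos[OF assms] .
  have "((\<lambda>x. G x x) has_derivative (\<lambda>h. 2 * G x h)) (at x)"
    by (rule has_derivative_eq_rhs[OF has_derivative_qre[OF FDERIV[OF has_derivative_ident has_derivative_ident]]])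
       (simp add: fun_eq_iff G_sym[of _ x])
  from has_derivative_real_sqrt[OF G this] show ?thesis
    unfolding mnorm_def[abs_def] by (rule has_derivative_eq_rhs) (rule ext, simp only: divide_inverse, simp)
qed

text \<open>
  Only the action on vectors orthogonal to \<open>\<theta>\<close> matters below, so the radial coefficient \<open>k\<close> is left implicit.
\<close>
lemma has_derivative_shrink:
  assumes "G \<theta> \<theta> = 1" "0 < r"
  shows "\<exists>k. (shrink has_derivative (\<lambda>h. (k * G \<theta> h) *\<^sub>R \<theta> + (tanh r / r) *\<^sub>R h)) (at (r *\<^sub>R \<theta>))"
proof -
  have th: "\<theta> \<noteq> 0" using assms(1) by (auto simp: zero_left)
  have m: "mnorm (r *\<^sub>R \<theta>) = r" using assms by (simp add: mnorm_scaleR mnorm_def[of \<theta>])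
  have dm: "(mnorm has_derivative (\<lambda>h. G \<theta> h)) (at (r *\<^sub>R \<theta>))"
    using has_derivative_mnorm[of "r *\<^sub>R \<theta>"] assms th unfolding m by (simp add: form_simps)
  define k where "k = (1 - (tanh r)^2) / r - tanh r / r^2"
  have df: "((\<lambda>s. tanh s / s) has_derivative (\<lambda>h. h * k)) (at r)"
  proof (rule has_field_derivative_imp_has_derivative)
    show "((\<lambda>s. tanh s / s) has_real_derivative k) (at r)"
      using assms(2) unfolding k_def by (auto intro!: derivative_eq_intros simp: field_simps power2_eq_square)
  qed
  have "((\<lambda>u. tanh (mnorm u) / mnorm u) has_derivative (\<lambda>h. G \<theta> h * k)) (at (r *\<^sub>R \<theta>))"
    by (rule has_derivative_compose[OF dm, of "\<lambda>s. tanh s / s" "\<lambda>h. h * k"]) (simp add: m df)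
  from has_derivative_scaleR[OF this has_derivative_ident]
  have "(shrink has_derivative (\<lambda>h. (k * r * G \<theta> h) *\<^sub>R \<theta> + (tanh r / r) *\<^sub>R h)) (at (r *\<^sub>R \<theta>))"
    unfolding shrink_def[abs_def] m by (rule has_derivative_eq_rhs) (simp add: fun_eq_iff add.commute mult_ac)
  then show ?thesis by blast
qed

lemma frechet_derivative_exp:
  assumes "G \<theta> \<theta> = 1" "0 < r" "G \<theta> X = 0"
  shows "frechet_derivative (qh_exp p) (at (r *\<^sub>R \<theta>)) X = recentre_deriv (tanh r *\<^sub>R \<theta>) ((tanh r / r) *\<^sub>R X)"
proof -
  obtain k where k: "(shrink has_derivative (\<lambda>h. (k * G \<theta> h) *\<^sub>R \<theta> + (tanh r / r) *\<^sub>R h)) (at (r *\<^sub>R \<theta>))"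
    using has_derivative_shrink[OF assms(1,2)] by blast
  have sh: "shrink (r *\<^sub>R \<theta>) = tanh r *\<^sub>R \<theta>" using assms by (simp add: shrink_unit)
  have "(recentre has_derivative recentre_deriv (shrink (r *\<^sub>R \<theta>))) (at (shrink (r *\<^sub>R \<theta>)))"
    unfolding sh by (rule has_derivative_recentre[OF denom_nonzero[OF G_tanh[OF assms(1)]]])
  from has_derivative_compose[OF k this]
  have "(qh_exp p has_derivative (\<lambda>h. recentre_deriv (tanh r *\<^sub>R \<theta>) ((k * G \<theta> h) *\<^sub>R \<theta> + (tanh r / r) *\<^sub>R h))) (at (r *\<^sub>R \<theta>))"
    unfolding sh qh_exp_eq[abs_def] .
  from frechet_derivative_at[OF this, symmetric] show ?thesis using assms(3) by simp
qed

lemma radial_field_eq: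
  assumes "qh_polar p y = (r, \<theta>)" "G \<theta> \<theta> = 1" "0 < r"
  shows "qh_radial p y = recentre_deriv (tanh r *\<^sub>R \<theta>) ((1 - (tanh r)^2) *\<^sub>R \<theta>)"
proof -
  let ?z = "tanh r *\<^sub>R \<theta>"
  have "((\<lambda>s. tanh s *\<^sub>R \<theta>) has_derivative (\<lambda>h. (h * (1 - (tanh r)^2)) *\<^sub>R \<theta>)) (at r)"
    by (intro has_derivative_scaleR_left has_field_derivative_imp_has_derivative)
       (auto intro!: derivative_eq_intros)
  from has_derivative_compose[OF this has_derivative_recentre[OF denom_nonzero[OF G_tanh[OF assms(2)]]]]
  have "((\<lambda>s. recentre (tanh s *\<^sub>R \<theta>)) has_derivative (\<lambda>h. h *\<^sub>R recentre_deriv ?z ((1 - (tanh r)^2) *\<^sub>R \<theta>))) (at r)"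
    by (simp add: linear_scale[OF linear_recentre_deriv, symmetric])
  then have "((\<lambda>s. qh_exp p (s *\<^sub>R \<theta>)) has_derivative (\<lambda>h. h *\<^sub>R recentre_deriv ?z ((1 - (tanh r)^2) *\<^sub>R \<theta>))) (at r)"
    by (rule has_derivative_transform_within_open[of _ _ _ _ "{0<..}"])
       (use assms in \<open>auto simp: qh_exp_unit\<close>)
  then show ?thesis
    unfolding radial_field_def assms(1) by (simp add: vector_derivative_at has_vector_derivative_def)
qed

lemma sphere_subspace_minus_1:
  assumes "qh_polar p y = (r, \<theta>)" "G \<theta> \<theta> = 1" "0 < r" "v \<in> qh_sub p (-1) y"
  obtains X where "v = recentre_deriv (tanh r *\<^sub>R \<theta>) X" "H \<theta> X = 0"
proof -
  obtain X where "v = frechet_derivative (qh_exp p) (at (r *\<^sub>R \<theta>)) X" "H \<theta> X = 0"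
    using assms(4) by (auto simp: sphere_subspace_def assms(1) radial_eigenspace_minus_1[OF assms(2)])
  then show ?thesis
    using that[of "(tanh r / r) *\<^sub>R X"] frechet_derivative_exp[OF assms(2,3), of X] by (simp add: scaleR_right)
qed

lemma sphere_subspace_minus_4:
  assumes "qh_polar p y = (r, \<theta>)" "G \<theta> \<theta> = 1" "0 < r" "v \<in> qh_sub p (-4) y"
  obtains X where "v = recentre_deriv (tanh r *\<^sub>R \<theta>) X" "G \<theta> X = 0" "\<theta> \<star> H \<theta> X = X"
proof -
  obtain X where "v = frechet_derivative (qh_exp p) (at (r *\<^sub>R \<theta>)) X" "G \<theta> X = 0" "\<theta> \<star> H \<theta> X = X"
    using assms(4) by (auto simp: sphere_subspace_def assms(1) radial_eigenspace_minus_4[OF assms(2)])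
  then show ?thesis
    using that[of "(tanh r / r) *\<^sub>R X"] frechet_derivative_exp[OF assms(2,3), of X] by (simp add: scaleR_right)
qed

end

section \<open>The volume radius\<close>

text \<open>
  \<open>vol n r\<close> is \<open>n\<close> times the integral of \<open>area n\<close> from \<open>0\<close> to \<open>r\<close>, that is, the \<open>n\<close>-th power of the volume radius.
\<close>
definition vol :: "nat \<Rightarrow> real \<Rightarrow> real" where
  "vol n r = sinh r ^ n * (1 + real n * (sinh r)^2 / (real n + 2))"

definition area :: "nat \<Rightarrow> real \<Rightarrow> real" where "area n r = sinh r ^ (n - 1) * cosh r ^ 3"

lemma vol_deriv:
  assumes "n > 0" shows "(vol n has_real_derivative real n * area n r) (at r)"
proof -
  obtain k where k: "n = Suc k" using assms by (cases n) auto
  have "(vol n has_real_derivative (real n * sinh r ^ k * cosh r) * (1 + real n * (sinh r)^2 / (real n + 2))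
     + sinh r ^ n * (real n * (2 * sinh r * cosh r) / (real n + 2))) (at r)"
    unfolding vol_def[abs_def] by (rule derivative_eq_intros refl | simp add: k)+
  also have "(real n * sinh r ^ k * cosh r) * (1 + real n * (sinh r)^2 / (real n + 2))
     + sinh r ^ n * (real n * (2 * sinh r * cosh r) / (real n + 2)) =
      real n * (sinh r ^ k * cosh r * (1 + (sinh r)^2))"
  proof -
    have "real n * (sinh r)^2 / (real n + 2) + 2 * (sinh r)^2 / (real n + 2) = (real n + 2) * (sinh r)^2 / (real n + 2)"
      by (simp only: add_divide_distrib[symmetric] distrib_right[symmetric])
    then have *: "real n * (sinh r)^2 / (real n + 2) + 2 * (sinh r)^2 / (real n + 2) = (sinh r)^2" by simp
    have "(real n * sinh r ^ k * cosh r) * (1 + real n * (sinh r)^2 / (real n + 2))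
       + sinh r ^ n * (real n * (2 * sinh r * cosh r) / (real n + 2)) =
      real n * (sinh r ^ k * cosh r * (1 + (real n * (sinh r)^2 / (real n + 2) + 2 * (sinh r)^2 / (real n + 2))))"
    proof -
      have "sinh r ^ n = sinh r ^ k * sinh r" by (simp add: k)
      then show ?thesis unfolding power2_eq_square by (simp add: distrib_left mult_ac)
    qed
    then show ?thesis unfolding * .
  qed
  also have "1 + (sinh r)^2 = (cosh r)^2" by (simp add: cosh_square_eq)
  finally show ?thesis by (simp add: area_def k power2_eq_square power3_eq_cube mult_ac)
qed

lemma vol_0: "n > 0 \<Longrightarrow> vol n 0 = 0" by (simp add: vol_def)

lemma area_pos: "r > 0 \<Longrightarrow> area n r > 0" by (simp add: area_def)

lemma vol_pos: "r > 0 \<Longrightarrow> vol n r > 0"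
  unfolding vol_def by (intro mult_pos_pos add_pos_nonneg) auto

lemma vol_strict_mono:
  assumes "n > 0" "0 \<le> a" "a < b" shows "vol n a < vol n b"
proof (rule DERIV_pos_imp_increasing_open[OF assms(3)])
  fix x assume "a < x" "x < b"
  then show "\<exists>y. (vol n has_real_derivative y) (at x) \<and> 0 < y"
    using vol_deriv[OF assms(1), of x] area_pos[of x n] assms
    by (intro exI[of _ "real n * area n x"] conjI) auto
next
  show "continuous_on {a..b} (vol n)"
    using vol_deriv[OF assms(1)] by (meson DERIV_isCont continuous_at_imp_continuous_on)
qed

lemma volume_radius_eq:
  assumes "n > 0" "0 \<le> r" shows "volume_radius n r = root n (vol n r)"
proof -
  have "(area n has_integral (vol n r / real n - vol n 0 / real n)) {0..r}"
  proof (rule fundamental_theorem_of_calculus[OF assms(2)])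
    fix x show "((\<lambda>x. vol n x / real n) has_vector_derivative area n x) (at x within {0..r})"
      using DERIV_cdivide[OF vol_deriv[OF assms(1), of x], of "real n"] assms(1)
      by (auto simp: has_real_derivative_iff_has_vector_derivative intro: has_vector_derivative_at_within)
  qed
  then have "integral {0..r} (area n) = vol n r / real n"
    using assms(1) by (simp add: vol_0 integral_unique)
  then show ?thesis using assms(1) by (simp add: volume_radius_def area_def[abs_def])
qed

lemma vol_surj:
  assumes "n > 0" "c > 0" obtains r where "r > 0" "vol n r = c"
proof -
  \<comment> \<open>already the first factor of \<open>vol\<close> reaches \<open>c\<close> at this radius\<close>
  define b where "b = arsinh (root n c)"
  have sb: "sinh b ^ n = c" using assms by (simp add: b_def)
  have "sinh b \<ge> 0" using assms by (simp add: b_def)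
  then have b: "0 \<le> b" by simp
  have "vol n b \<ge> c"
    unfolding vol_def sb using assms by (simp add: mult_le_cancel_left1)
  moreover have "continuous_on {0..b} (vol n)"
    using vol_deriv[OF assms(1)] by (meson DERIV_isCont continuous_at_imp_continuous_on)
  ultimately obtain r where r: "0 \<le> r" "r \<le> b" "vol n r = c"
    using IVT'[of "vol n" 0 c b] b assms by (auto simp: vol_0)
  then have "r \<noteq> 0" using assms by (auto simp: vol_0)
  then show ?thesis using that[of r] r by simp
qed

lemma vol_inj:
  assumes "n > 0" "0 \<le> a" "0 \<le> b" "vol n a = vol n b" shows "a = b"
  using vol_strict_mono[OF assms(1,2), of b] vol_strict_mono[OF assms(1,3), of a] assms(4)
  by (cases a b rule: linorder_cases) auto

text \<open>
  The radius as a function of the logarithm \<open>s\<close> of the volume radius. In this parameter dilations are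
  translations (\<open>exp_volume_radius\<close>), and \<open>log_radius\<close> is the inverse function.
\<close>
definition radius_exp :: "nat \<Rightarrow> real \<Rightarrow> real" where
  "radius_exp n s = radius_of_volume_radius n (exp s)"

lemma radius_exp:
  assumes "n > 0" shows "radius_exp n s > 0" "vol n (radius_exp n s) = exp (real n * s)"
proof -
  obtain r where r: "r > 0" "vol n r = exp (real n * s)" using vol_surj[OF assms, of "exp (real n * s)"] by auto
  have root: "root n (exp (real n * s)) = exp s"
    using assms by (simp add: exp_of_nat_mult real_root_power_cancel)
  have "radius_of_volume_radius n (exp s) = r"
    unfolding radius_of_volume_radius_def
  proof (rule the_equality)
    show "0 \<le> r \<and> volume_radius n r = exp s"
      using r root assms by (simp add: volume_radius_eq)
    fix a assume a: "0 \<le> a \<and> volume_radius n a = exp s"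
    then have "root n (vol n a) = root n (vol n r)"
      using volume_radius_eq[OF assms, of a] r root by simp
    then have "vol n a = vol n r" using assms by simp
    then show "a = r" using vol_inj[OF assms] a r by simp
  qed
  then show "radius_exp n s > 0" "vol n (radius_exp n s) = exp (real n * s)" using r by (simp_all add: radius_exp_def)
qed

definition log_radius :: "nat \<Rightarrow> real \<Rightarrow> real" where "log_radius n r = ln (vol n r) / real n"

lemma log_radius_deriv:
  assumes "n > 0" "r > 0" shows "(log_radius n has_real_derivative area n r / vol n r) (at r)"
  using DERIV_cdivide[OF DERIV_chain2[OF DERIV_ln_divide[OF vol_pos[OF assms(2)]] vol_deriv[OF assms(1)]], of "real n"] assms(1)
  unfolding log_radius_def[abs_def] by simp

lemma radius_exp_log_radius:
  assumes "n > 0" "r > 0" shows "radius_exp n (log_radius n r) = r"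
proof (rule vol_inj[OF assms(1)])
  show "vol n (radius_exp n (log_radius n r)) = vol n r"
    unfolding radius_exp(2)[OF assms(1)] using assms(1) vol_pos[OF assms(2), of n] by (simp add: log_radius_def)
qed (use radius_exp(1)[OF assms(1), of "log_radius n r"] assms(2) in simp_all)

lemma log_radius_radius_exp:
  assumes "n > 0" shows "log_radius n (radius_exp n s) = s"
  using assms by (simp add: log_radius_def radius_exp)

lemma radius_exp_deriv:
  assumes "n > 0"
  shows "(radius_exp n has_real_derivative vol n (radius_exp n s) / area n (radius_exp n s)) (at s)"
proof -
  let ?r = "radius_exp n s"
  have r: "?r > 0" by (rule radius_exp[OF assms])
  have "isCont (radius_exp n) (log_radius n ?r)"
  proof (rule isCont_inverse_function[where d = "?r / 2" and g = "radius_exp n" and f = "log_radius n"])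
    fix z assume "\<bar>z - ?r\<bar> \<le> ?r / 2"
    then have z: "z > 0" using r by linarith
    show "radius_exp n (log_radius n z) = z" by (rule radius_exp_log_radius[OF assms z])
    show "isCont (log_radius n) z" by (rule DERIV_isCont[OF log_radius_deriv[OF assms z]])
  qed (use r in simp)
  then have cont: "isCont (radius_exp n) s" by (simp add: log_radius_radius_exp[OF assms])
  have "(radius_exp n has_real_derivative inverse (area n ?r / vol n ?r)) (at s)"
    by (rule DERIV_inverse_function[where f = "log_radius n" and a = "s - 1" and b = "s + 1"])
       (use log_radius_deriv[OF assms r] area_pos[OF r, of n] vol_pos[OF r, of n] cont
         log_radius_radius_exp[OF assms] in auto)
  then show ?thesis by simp
qed

lemma exp_volume_radius:
  assumes "n > 0" "r > 0"
  shows "radius_of_volume_radius n (exp a * volume_radius n r) = radius_exp n (a + log_radius n r)"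
proof -
  have "volume_radius n r = exp (log_radius n r)"
    using assms vol_pos[OF assms(2), of n]
    by (simp add: volume_radius_eq log_radius_def root_powr_inverse powr_def divide_inverse mult.commute)
  then show ?thesis by (simp add: radius_exp_def exp_add)
qed

section \<open>The dilation in the recentred ball\<close>

text \<open>
  The dimension gets a name of its own: a definition of it in \<open>qh_point\<close> would depend on the type of \<open>p\<close> only,
  and carry that type as a hidden argument.
\<close>
locale qh_dim = qh_point p for p :: "real^('m::finite \<times> 4)" +
  fixes N :: nat
  assumes N_eq: "N = CARD('m \<times> 4)"
begin

lemma N_pos [simp]: "N > 0" unfolding N_eq by simp

text \<open>
  The dilation, transported to the recentred ball. The function on the unit sphere is \<open>\<theta> \<mapsto> G \<theta> e + c\<close>, which covers
  the linear functions as well as the constants.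
\<close>
definition model_dilation :: "real \<Rightarrow> real^('m \<times> 4) \<Rightarrow> real \<Rightarrow> real^('m \<times> 4) \<Rightarrow> real^('m \<times> 4)" where
  "model_dilation t e c z =
    (tanh (radius_exp N (t * (G z e / mnorm z + c) + log_radius N (artanh (mnorm z)))) / mnorm z) *\<^sub>R z"

lemma qh_dilation_recentre:
  assumes "z \<noteq> 0" "G z z < 1"
  shows "qh_dilation p t (\<lambda>\<theta>. G \<theta> e + c) (recentre z) = recentre (model_dilation t e c z)"
proof -
  have T: "0 < mnorm z" using mnorm_nonneg[of z] mnorm_eq_0_iff[of z] assms(1) by simp
  have T1: "mnorm z < 1" using assms(2) by (simp add: mnorm_def)
  define r where "r = artanh (mnorm z)"
  define \<theta> where "\<theta> = z /\<^sub>R mnorm z"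
  have tr: "tanh r = mnorm z" unfolding r_def by (rule tanh_artanh_real) (use T T1 in simp)
  have r: "0 < r" using T tr by (metis tanh_real_pos_iff)
  have th: "G \<theta> \<theta> = 1"
    using T unfolding \<theta>_def by (simp add: form_simps mnorm_sq[symmetric] power2_eq_square field_simps)
  have z: "z = tanh r *\<^sub>R \<theta>" using T by (simp add: tr \<theta>_def)
  have pol: "qh_polar p (recentre z) = (r, \<theta>)" by (rule qh_polar_eqI[OF r th]) (simp add: z)
  have G\<theta>: "G \<theta> e = G z e / mnorm z" by (simp add: \<theta>_def form_simps divide_inverse_commute)
  let ?\<rho> = "radius_exp N (t * (G \<theta> e + c) + log_radius N r)"
  have "qh_dilation p t (\<lambda>\<theta>. G \<theta> e + c) (recentre z) = qh_exp p (?\<rho> *\<^sub>R \<theta>)"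
    unfolding qh_dilation_def pol N_eq[symmetric] by (simp only: Let_def prod.case exp_volume_radius[OF N_pos r])
  also have "\<dots> = recentre (tanh ?\<rho> *\<^sub>R \<theta>)"
    by (rule qh_exp_unit[OF th]) (use radius_exp(1)[OF N_pos] in \<open>simp add: less_imp_le\<close>)
  also have "tanh ?\<rho> *\<^sub>R \<theta> = model_dilation t e c z"
    unfolding model_dilation_def G\<theta> r_def[symmetric] by (simp add: \<theta>_def divide_inverse)
  finally show ?thesis .
qed

lemma open_model_ball: "open {z. G z z < 1}"
proof -
  have "continuous_on UNIV (\<lambda>z. G z z)"
    by (intro bounded_linear.continuous_on[OF bounded_linear_qre]
       bounded_bilinear.continuous_on[OF bounded_bilinear_form] continuous_on_id)
  then show ?thesis using open_Collect_less[of "\<lambda>z. G z z" "\<lambda>z. 1"] by simp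
qed

text \<open>
  The derivative of the inverse exists by the explicit formula, so the chain rule identifies it.
\<close>
lemma has_derivative_decentre:
  assumes "G z z < 1"
  obtains D where "(decentre has_derivative D) (at (recentre z))"
    "\<And>u. D (recentre_deriv z u) = u" "\<And>u. recentre_deriv z (D u) = u"
proof -
  let ?y = "recentre z"
  note ne = slope_diff_p[OF recentre_in_space[OF assms]]
  define i where "i = inverse (1 - slope (?y - p))"
  define D where "D h = h \<star> i + (?y - p) \<star> (i * slope h * i)" for h
  have "((\<lambda>y. (y - p) \<star> inverse (1 - slope (y - p))) has_derivative D) (at ?y)"
    apply (rule derivative_eq_intros refl ne)+
    apply (rule ext)
    apply (simp add: D_def i_def)
    done
  then have D: "(decentre has_derivative D) (at ?y)" by (simp add: decentre_def[abs_def])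
  note R = has_derivative_recentre[OF denom_nonzero[OF assms]]
  have "((\<lambda>w. decentre (recentre w)) has_derivative (\<lambda>h. D (recentre_deriv z h))) (at z)"
    by (rule has_derivative_compose[OF R D])
  moreover have "((\<lambda>w. decentre (recentre w)) has_derivative (\<lambda>h. h)) (at z)"
    by (rule has_derivative_transform_within_open[OF has_derivative_ident open_model_ball])
       (use assms in \<open>auto simp: decentre_recentre denom_nonzero\<close>)
  ultimately have "(\<lambda>h. D (recentre_deriv z h)) = (\<lambda>h. h)" by (rule has_derivative_unique)
  then have 1: "D \<circ> recentre_deriv z = id" by (simp add: fun_eq_iff)
  then have 2: "recentre_deriv z \<circ> D = id"
    using linear_inverse_left[OF has_derivative_linear[OF D] linear_recentre_deriv] by blast
  show ?thesis
    by (rule that[OF D]) (use 1 2 in \<open>simp_all add: fun_eq_iff\<close>)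
qed

end

text \<open>
  A point in polar coordinates; \<open>z\<close> is its position in the recentred ball and \<open>rho \<tau>\<close> is the radius to which the
  dilation with exponent \<open>\<tau>\<close> takes \<open>r\<close>.
\<close>
locale qh_polar_point = qh_dim p N for p :: "real^('m::finite \<times> 4)" and N +
  fixes \<theta> :: "real^('m \<times> 4)" and r :: real
  assumes unit: "G \<theta> \<theta> = 1" and r_pos: "0 < r"
begin

abbreviation "z \<equiv> tanh r *\<^sub>R \<theta>"

definition rho :: "real \<Rightarrow> real" where "rho \<tau> = radius_exp N (\<tau> + log_radius N r)"

lemma rho_pos: "0 < rho \<tau>" by (simp add: rho_def radius_exp)

lemma rho_0: "rho 0 = r" using r_pos by (simp add: rho_def radius_exp_log_radius)

lemma vol_rho: "vol N (rho \<tau>) = exp (real N * \<tau>) * vol N r"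
  using r_pos vol_pos[OF r_pos, of N]
  unfolding rho_def radius_exp(2)[OF N_pos] by (simp add: log_radius_def distrib_left exp_add)

lemma rho_deriv: "(rho has_real_derivative vol N (rho \<tau>) / area N (rho \<tau>)) (at \<tau>)"
proof -
  have "((\<lambda>\<tau>. \<tau> + log_radius N r) has_real_derivative 1) (at \<tau>)" by (auto intro!: derivative_eq_intros)
  from DERIV_chain2[OF radius_exp_deriv[OF N_pos] this] show ?thesis by (simp add: rho_def[abs_def])
qed

lemma z_props: "mnorm z = tanh r" "z \<noteq> 0" "G z z = (tanh r)^2" "G z z < 1" "0 < tanh r" "tanh r < 1"
proof -
  show T: "0 < tanh r" "tanh r < 1" using r_pos by (simp_all add: tanh_real_lt_1)
  show "mnorm z = tanh r" using T unit by (simp add: mnorm_scaleR mnorm_def[of \<theta>])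
  show "z \<noteq> 0" using T unit by (auto simp: zero_left)
  show "G z z = (tanh r)^2" using unit by (simp add: form_simps power2_eq_square)
  show "G z z < 1" by (rule G_tanh[OF unit])
qed

lemma model_dilation_z: "model_dilation t e c z = tanh (rho (t * (G \<theta> e + c))) *\<^sub>R \<theta>"
  using z_props(1,5) by (simp add: model_dilation_def artanh_tanh_real rho_def form_simps)

definition tang :: "real^('m \<times> 4) \<Rightarrow> real^('m \<times> 4)" where "tang e = e - G \<theta> e *\<^sub>R \<theta>"

definition stretch :: "real \<Rightarrow> real" where "stretch \<tau> = tanh (rho \<tau>) / tanh r"
definition rad_stretch :: "real \<Rightarrow> real" where
  "rad_stretch \<tau> = (1 - (tanh (rho \<tau>))^2) * (vol N (rho \<tau>) / area N (rho \<tau>)) * (area N r / vol N r) / (1 - (tanh r)^2)"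
definition shear :: "real \<Rightarrow> real \<Rightarrow> real" where
  "shear t \<tau> = (1 - (tanh (rho \<tau>))^2) * (vol N (rho \<tau>) / area N (rho \<tau>)) * t / tanh r"

text \<open>
  The derivative of the dilation: a multiple of the identity tangentially to the sphere, another one
  radially, and a shear into the radial direction caused by the variation of the exponent with \<open>\<theta>\<close>.
\<close>
definition dil_deriv :: "real \<Rightarrow> real^('m \<times> 4) \<Rightarrow> real \<Rightarrow> real^('m \<times> 4) \<Rightarrow> real^('m \<times> 4)" where
  "dil_deriv t e \<tau> h = stretch \<tau> *\<^sub>R (h - G \<theta> h *\<^sub>R \<theta>) + (rad_stretch \<tau> * G \<theta> h + shear t \<tau> * G (tang e) h) *\<^sub>R \<theta>"

text \<open>
  The chain rule, one elementary function at a time: \<open>d1\<close> is the exponent, \<open>d3\<close> the logarithm of the volume radius,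
  \<open>d5\<close> the new radius and \<open>d6\<close> its hyperbolic tangent.
\<close>
lemma has_derivative_model_dilation:
  "(model_dilation t e c has_derivative dil_deriv t e (t * (G \<theta> e + c))) (at z)"
proof -
  define \<tau> where "\<tau> = t * (G \<theta> e + c)"
  define T where "T = tanh r"
  have T: "T > 0" "T < 1" "mnorm z = T" using z_props by (simp_all add: T_def)
  have dm: "(mnorm has_derivative (\<lambda>h. G \<theta> h)) (at z)"
    using has_derivative_mnorm[OF z_props(2)] T unfolding T(3) by (simp add: form_simps T_def)
  have dG: "((\<lambda>w. G w e) has_derivative (\<lambda>h. G h e)) (at z)"
    by (intro has_derivative_qre bounded_linear_imp_has_derivative bounded_linear_left)
  have "((\<lambda>w. G w e / mnorm w) has_derivative (\<lambda>h. (G h e * mnorm z - G z e * G \<theta> h) / (mnorm z * mnorm z))) (at z)"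
    by (rule has_derivative_divide'[OF dG dm]) (use T in simp)
  also have "(\<lambda>h. (G h e * mnorm z - G z e * G \<theta> h) / (mnorm z * mnorm z)) = (\<lambda>h. G (tang e) h / T)"
    using T unfolding T(3) by (simp add: fun_eq_iff tang_def form_simps T_def[symmetric] field_simps G_sym[of _ e])
  finally have d1: "((\<lambda>w. G w e / mnorm w) has_derivative (\<lambda>h. G (tang e) h / T)) (at z)" .
  have "(artanh has_real_derivative 1 / (1 - T^2)) (at (mnorm z))"
    unfolding T(3) using T artanh_real_has_field_derivative[of T UNIV] by simp
  from DERIV_compose_FDERIV[OF this dm]
  have d2: "((\<lambda>w. artanh (mnorm w)) has_derivative (\<lambda>h. G \<theta> h * (1 / (1 - T^2)))) (at z)" .
  have ar: "artanh (mnorm z) = r" unfolding T(3) T_def by (rule artanh_tanh_real)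
  have "(log_radius N has_real_derivative area N r / vol N r) (at (artanh (mnorm z)))"
    unfolding ar by (rule log_radius_deriv[OF N_pos r_pos])
  from DERIV_compose_FDERIV[OF this d2]
  have d3: "((\<lambda>w. log_radius N (artanh (mnorm w))) has_derivative (\<lambda>h. G \<theta> h * (1 / (1 - T^2)) * (area N r / vol N r))) (at z)" .
  let ?f = "\<lambda>w. t * (G w e / mnorm w + c) + log_radius N (artanh (mnorm w))"
  let ?f' = "\<lambda>h. t * (G (tang e) h / T) + G \<theta> h * (1 / (1 - T^2)) * (area N r / vol N r)"
  have d4: "(?f has_derivative ?f') (at z)"
    by (rule has_derivative_eq_rhs[OF has_derivative_add[OF has_derivative_mult_right[OF has_derivative_add[OF d1 has_derivative_const]] d3]]) simp
  have fz: "?f z = \<tau> + log_radius N r"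
    unfolding ar unfolding T(3) using T by (simp add: \<tau>_def form_simps T_def)
  have "(radius_exp N has_real_derivative vol N (rho \<tau>) / area N (rho \<tau>)) (at (?f z))"
    unfolding fz rho_def by (rule radius_exp_deriv[OF N_pos])
  from DERIV_compose_FDERIV[OF this d4]
  have d5: "((\<lambda>w. radius_exp N (?f w)) has_derivative (\<lambda>h. ?f' h * (vol N (rho \<tau>) / area N (rho \<tau>)))) (at z)" .
  have "(tanh has_real_derivative 1 - (tanh (rho \<tau>))^2) (at (radius_exp N (?f z)))"
    unfolding fz rho_def by (auto intro!: derivative_eq_intros)
  from DERIV_compose_FDERIV[OF this d5]
  have d6: "((\<lambda>w. tanh (radius_exp N (?f w))) has_derivative
     (\<lambda>h. ?f' h * (vol N (rho \<tau>) / area N (rho \<tau>)) * (1 - (tanh (rho \<tau>))^2))) (at z)" .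
  have tz: "tanh (radius_exp N (?f z)) = tanh (rho \<tau>)" unfolding fz rho_def ..
  have "mnorm z \<noteq> 0" using T by simp
  from has_derivative_divide'[OF d6 dm this]
  have "((\<lambda>w. tanh (radius_exp N (?f w)) / mnorm w) has_derivative
     (\<lambda>h. (?f' h * (vol N (rho \<tau>) / area N (rho \<tau>)) * (1 - (tanh (rho \<tau>))^2) * T - tanh (rho \<tau>) * G \<theta> h) / (T * T))) (at z)"
    unfolding tz unfolding T(3) .
  from has_derivative_scaleR[OF this has_derivative_ident]
  have "(model_dilation t e c has_derivative (\<lambda>h. (tanh (rho \<tau>) / T) *\<^sub>R h +
     ((?f' h * (vol N (rho \<tau>) / area N (rho \<tau>)) * (1 - (tanh (rho \<tau>))^2) * T - tanh (rho \<tau>) * G \<theta> h) / (T * T)) *\<^sub>R z)) (at z)"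
    unfolding model_dilation_def[abs_def] tz unfolding T(3) .
  moreover have "(tanh (rho \<tau>) / T) *\<^sub>R h +
     ((?f' h * (vol N (rho \<tau>) / area N (rho \<tau>)) * (1 - (tanh (rho \<tau>))^2) * T - tanh (rho \<tau>) * G \<theta> h) / (T * T)) *\<^sub>R z
     = dil_deriv t e \<tau> h" for h
  proof -
    have "((?f' h * (vol N (rho \<tau>) / area N (rho \<tau>)) * (1 - (tanh (rho \<tau>))^2) * T - tanh (rho \<tau>) * G \<theta> h) / (T * T)) *\<^sub>R z
      = (?f' h * (vol N (rho \<tau>) / area N (rho \<tau>)) * (1 - (tanh (rho \<tau>))^2) - tanh (rho \<tau>) / T * G \<theta> h) *\<^sub>R \<theta>"
    proof -
      have "(a * T - b * g) / (T * T) * T = a - b / T * g" for a b g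
        using T by (simp add: field_simps)
      then show ?thesis unfolding T_def[symmetric] scaleR_scaleR by (simp only:)
    qed
    moreover have "?f' h * (vol N (rho \<tau>) / area N (rho \<tau>)) * (1 - (tanh (rho \<tau>))^2) = rad_stretch \<tau> * G \<theta> h + shear t \<tau> * G (tang e) h"
      unfolding rad_stretch_def shear_def T_def[symmetric] by (simp add: divide_inverse algebra_simps)
    ultimately show ?thesis
      unfolding dil_deriv_def stretch_def T_def[symmetric]
      by (simp only: scaleR_diff_left scaleR_add_left scaleR_diff_right scaleR_scaleR) simp
  qed
  ultimately show ?thesis unfolding \<tau>_def by simp
qed

lemma linear_dil_deriv: "linear (dil_deriv t e \<tau>)"
  by (rule linearI) (simp_all add: dil_deriv_def form_simps algebra_simps scaleR_add_left)

lemma det_dil_deriv: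
  "det (matrix (dil_deriv t e \<tau>)) = stretch \<tau> ^ (N - 1) * rad_stretch \<tau>"
proof -
  have K: "stretch \<tau> \<noteq> 0" using rho_pos[of \<tau>] z_props(5) by (simp add: stretch_def less_imp_neq[symmetric])
  define f where "f h = ((rad_stretch \<tau> / stretch \<tau> - 1) * G \<theta> h + shear t \<tau> / stretch \<tau> * G (tang e) h)" for h
  have lin: "linear f" unfolding f_def by (rule linearI) (simp_all add: form_simps algebra_simps)
  have "dil_deriv t e \<tau> h = stretch \<tau> *\<^sub>R (h + f h *\<^sub>R \<theta>)" for h
  proof -
    have "stretch \<tau> * f h = (rad_stretch \<tau> - stretch \<tau>) * G \<theta> h + shear t \<tau> * G (tang e) h"
      using K by (simp add: f_def field_simps)
    then have eq: "rad_stretch \<tau> * G \<theta> h + shear t \<tau> * G (tang e) h = stretch \<tau> * f h + stretch \<tau> * G \<theta> h"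
      by (simp add: left_diff_distrib)
    show ?thesis
      unfolding dil_deriv_def eq by (simp add: scaleR_add_right scaleR_diff_right scaleR_add_left)
  qed
  then have "det (matrix (dil_deriv t e \<tau>)) = stretch \<tau> ^ N * (1 + f \<theta>)"
    using det_scaled_rank_one_update[OF lin, of "stretch \<tau>" \<theta>] unfolding N_eq by presburger
  also have "G (tang e) \<theta> = 0" using unit by (simp add: tang_def form_simps G_sym[of e \<theta>])
  then have "1 + f \<theta> = rad_stretch \<tau> / stretch \<tau>" using unit by (simp add: f_def)
  also have "stretch \<tau> ^ N = stretch \<tau> ^ (N - 1) * stretch \<tau>"
    using N_pos by (metis power_minus_mult)
  finally show ?thesis using K by simp
qed

text \<open>
  The determinant of the dilation with respect to the metrics at source and target is \<open>exp(N \<tau>)\<close>: the dilation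
  scales the \<open>N\<close>-th power of the volume radius by this factor. The exponent \<open>N + 4\<close> is the one of the volume
  density \<open>det_gram_ball_form\<close>.
\<close>
lemma volume_distortion:
  "(stretch \<tau> ^ (N - 1) * rad_stretch \<tau>)^2 * ((1 - (tanh r)^2) / (1 - (tanh (rho \<tau>))^2)) ^ (N + 4) = (exp (real N * \<tau>))^2"
proof -
  define S C S' C' where d: "S = sinh r" "C = cosh r" "S' = sinh (rho \<tau>)" "C' = cosh (rho \<tau>)"
  have pos: "S > 0" "C > 0" "S' > 0" "C' > 0" using r_pos rho_pos[of \<tau>] by (simp_all add: d)
  have T: "tanh r = S / C" "tanh (rho \<tau>) = S' / C'" by (simp_all add: tanh_def d)
  have \<sigma>: "1 - (S / C)^2 = 1 / C^2" "1 - (S' / C')^2 = 1 / C'^2"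
  proof -
    have "C^2 = 1 + S^2" "C'^2 = 1 + S'^2" by (simp_all add: d cosh_square_eq)
    moreover have "C^2 \<noteq> 0" "C'^2 \<noteq> 0" using pos by simp_all
    ultimately show "1 - (S / C)^2 = 1 / C^2" "1 - (S' / C')^2 = 1 / C'^2"
      by (simp_all add: power_divide field_simps)
  qed
  define k where k: "k = N - 1"
  have Nk: "N + 4 = k + 5" using N_pos by (simp add: k)
  have V: "vol N r \<noteq> 0" using vol_pos[OF r_pos, of N] by simp
  have rs: "rad_stretch \<tau> = C^2 / C'^2 * exp (real N * \<tau>) * (S ^ k * C ^ 3) / (S' ^ k * C' ^ 3)"
    unfolding rad_stretch_def T \<sigma> vol_rho area_def d[symmetric] k[symmetric] using V by simp
  have st: "stretch \<tau> = S' * C / (S * C')" by (simp add: stretch_def T)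
  have "stretch \<tau> ^ k * rad_stretch \<tau> = exp (real N * \<tau>) * (C / C') ^ (k + 5)"
    unfolding rs st using pos by (simp add: power_mult_distrib power_divide power_add field_simps eval_nat_numeral)
  then have "(stretch \<tau> ^ k * rad_stretch \<tau>)^2 * ((C' / C)^2) ^ (k + 5) = (exp (real N * \<tau>))^2 * ((C / C') ^ (k + 5) * (C' / C) ^ (k + 5))^2"
    by (simp add: power_mult_distrib power_mult[symmetric] mult.commute)
  also have "(C / C') ^ (k + 5) * (C' / C) ^ (k + 5) = 1"
    using pos by (simp add: power_mult_distrib[symmetric])
  finally have "(stretch \<tau> ^ k * rad_stretch \<tau>)^2 * ((C' / C)^2) ^ (k + 5) = (exp (real N * \<tau>))^2" by simp
  moreover have "(1 - (tanh r)^2) / (1 - (tanh (rho \<tau>))^2) = (C' / C)^2"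
    unfolding T \<sigma> by (simp add: power_divide)
  ultimately show ?thesis unfolding Nk k[symmetric] by simp
qed

end

section \<open>The hyperplane Jacobian\<close>

lemma sqrt_sq_abs: "(sqrt x)^2 = \<bar>x\<bar>"
  by (simp add: power2_eq_square)

text \<open>
  The determinant with respect to inner products compares volume densities. Up to sign, it can therefore be
  computed in other coordinates \<open>R\<close>, \<open>R'\<close> of source and target.
\<close>
lemma det_wrt_sq:
  fixes L R R' M :: "real^'n \<Rightarrow> real^'n"
  assumes lin: "linear L" "linear R" "linear R'" "linear M"
    and comm: "\<And>u. L (R u) = R' (M u)"
    and B: "\<And>u. linear (\<lambda>v. B u v)" "\<And>v. linear (\<lambda>u. B u v)" "det (gram_matrix B) \<noteq> 0"
    and C: "\<And>u. linear (\<lambda>v. C u v)" "\<And>v. linear (\<lambda>u. C u v)"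
  shows "(det_wrt B C L)^2 * \<bar>det (gram_matrix (\<lambda>u v. B (R u) (R v)))\<bar>
    = (det (matrix M))^2 * \<bar>det (gram_matrix (\<lambda>u v. C (R' u) (R' v)))\<bar>"
proof -
  have "det (matrix L) * det (matrix R) = det (matrix R') * det (matrix M)"
    unfolding det_matrix_compose[OF lin(1,2), symmetric] det_matrix_compose[OF lin(3,4), symmetric] comm ..
  then have "(det (matrix L))^2 * (det (matrix R))^2 = (det (matrix R'))^2 * (det (matrix M))^2"
    by (simp only: power_mult_distrib[symmetric])
  then show ?thesis
    unfolding det_wrt_def gram_matrix_compose[OF B(1,2) lin(2)] gram_matrix_compose[OF C lin(3)]
    using B(3) by (simp add: power_mult_distrib power_divide sqrt_sq_abs abs_mult mult_ac)
qed

text \<open>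
  The inverse transpose of \<open>L\<close> maps \<open>\<nu>\<close> to the vector \<open>a\<close> with \<open>B u \<nu> = C (L u) a\<close>.
\<close>
lemma adjoint_wrt_inv:
  assumes "bij L" and adj: "\<And>u. B u \<nu> = C (L u) a"
    and nondeg: "\<And>b. (\<And>x. C x a = C x b) \<Longrightarrow> a = b"
  shows "adjoint_wrt C B (inv L) \<nu> = a"
  unfolding adjoint_wrt_def
proof (rule the_equality)
  have L: "L (inv L x) = x" for x using assms(1) by (simp add: bij_is_surj surj_f_inv_f)
  show "\<forall>x. B (inv L x) \<nu> = C x a" using adj[of "inv L _"] by (simp add: L)
  fix b assume "\<forall>x. B (inv L x) \<nu> = C x b"
  then have "C x a = C x b" for x using adj[of "inv L x"] by (simp add: L)
  then show "b = a" using nondeg by blast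
qed

context qh_polar_point
begin

lemma ball_form_radial:
  "qre (ball_form H (s *\<^sub>R \<theta>) u v) = G u v / (1 - s^2) + s^2 * G u (\<theta> \<star> H \<theta> v) / (1 - s^2)^2"
proof -
  have "G (s *\<^sub>R \<theta>) (s *\<^sub>R \<theta>) = s^2" using unit by (simp add: form_simps power2_eq_square)
  moreover have "qre (qcnj (H (s *\<^sub>R \<theta>) u) * H (s *\<^sub>R \<theta>) v) = s^2 * qre (qcnj (H \<theta> u) * H \<theta> v)"
    by (simp add: scaleR_left power2_eq_square del: times_quaternion.sel)
  ultimately show ?thesis unfolding qre_ball_form G_rscale_adjoint[of \<theta> u v, symmetric] by simp
qed

lemma H_unit: "H \<theta> \<theta> = 1" using form_self[of \<theta>] unit by simp

text \<open>
  The metric at a point of the ray of \<open>\<theta>\<close> is diagonal with respect to the radial direction and the two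
  curvature eigenspaces; \<open>X\<close> and \<open>Y\<close> stand for vectors in the latter.
\<close>
lemma ball_form_radial_parts:
  assumes s: "s^2 < 1" and X: "H \<theta> X = 0" and Y: "\<theta> \<star> H \<theta> Y = Y"
  shows "qre (ball_form H (s *\<^sub>R \<theta>) u (a *\<^sub>R \<theta> + X + Y))
    = a * G u \<theta> / (1 - s^2)^2 + G u X / (1 - s^2) + G u Y / (1 - s^2)^2"
proof -
  define \<sigma> where "\<sigma> = 1 - s^2"
  have \<sigma>: "\<sigma> > 0" "s^2 = 1 - \<sigma>" using s by (simp_all add: \<sigma>_def)
  have "\<theta> \<star> H \<theta> (a *\<^sub>R \<theta> + X + Y) = a *\<^sub>R \<theta> + Y"
    by (simp add: add_right scaleR_right X H_unit rscale_distrib Y)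
  then have "qre (ball_form H (s *\<^sub>R \<theta>) u (a *\<^sub>R \<theta> + X + Y))
      = (a * G u \<theta> + G u X + G u Y) / \<sigma> + (1 - \<sigma>) * (a * G u \<theta> + G u Y) / \<sigma>^2"
    unfolding ball_form_radial \<sigma>_def[symmetric] \<sigma>(2) by (simp add: add_right scaleR_right)
  also have "\<dots> = a * G u \<theta> / \<sigma>^2 + G u X / \<sigma> + G u Y / \<sigma>^2"
    using \<sigma>(1) by (simp add: field_simps power2_eq_square)
  finally show ?thesis unfolding \<sigma>_def .
qed

lemma G_orth: "H \<theta> X = 0 \<Longrightarrow> \<theta> \<star> H \<theta> Y = Y \<Longrightarrow> G X Y = 0"
proof -
  assume X: "H \<theta> X = 0" and Y: "\<theta> \<star> H \<theta> Y = Y"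
  have "H X \<theta> = 0" using form_sym[of X \<theta>] X by simp
  then have "H X (\<theta> \<star> H \<theta> Y) = 0" by (simp add: rscale_right)
  then show "G X Y = 0" unfolding Y by simp
qed

text \<open>
  The components of \<open>tang e\<close>, the spherical gradient of \<open>\<theta> \<mapsto> G \<theta> e\<close>, in the two curvature eigenspaces.
\<close>
definition tang_V :: "real^('m \<times> 4) \<Rightarrow> real^('m \<times> 4)" where "tang_V e = \<theta> \<star> H \<theta> (tang e)"
definition tang_H :: "real^('m \<times> 4) \<Rightarrow> real^('m \<times> 4)" where "tang_H e = tang e - tang_V e"

lemma tang_parts: "tang e = tang_H e + tang_V e" by (simp add: tang_H_def)

lemma H_tang_V: "H \<theta> (tang_V e) = H \<theta> (tang e)" by (simp add: tang_V_def rscale_right H_unit)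

lemma tang_V_props: "\<theta> \<star> H \<theta> (tang_V e) = tang_V e" "G \<theta> (tang_V e) = 0"
proof -
  show "\<theta> \<star> H \<theta> (tang_V e) = tang_V e" unfolding H_tang_V by (simp only: tang_V_def)
  show "G \<theta> (tang_V e) = 0" unfolding H_tang_V using unit by (simp add: tang_def form_simps)
qed

lemma tang_H_props: "H \<theta> (tang_H e) = 0"
  by (simp add: tang_H_def diff_right H_tang_V)

lemma G_tang_V: "G (tang_V e) (tang_V e) = (norm (H \<theta> e))^2 - (G \<theta> e)^2"
proof -
  have "G (tang_V e) (tang_V e) = qre (qcnj (H \<theta> (tang e)) * H \<theta> (tang e))"
    unfolding tang_V_def by (simp only: rscale_left rscale_right H_unit mult_1_left mult_1_right)
  also have "\<dots> = (norm (H \<theta> (tang e)))^2" unfolding qcnj_mult_self qre_of_real ..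
  also have "H \<theta> (tang e) = H \<theta> e - G \<theta> e *\<^sub>R 1" by (simp add: tang_def form_simps H_unit)
  finally show ?thesis unfolding norm_quaternion_sq by simp
qed

lemma G_tang: "G (tang e) (tang e) = G e e - (G \<theta> e)^2"
  using unit by (simp add: tang_def form_simps G_sym[of e \<theta>] power2_eq_square)

lemma G_tang_H: "G (tang_H e) (tang_H e) = G e e - (norm (H \<theta> e))^2"
proof -
  have "G (tang e) (tang e) = G (tang_H e) (tang_H e) + G (tang_V e) (tang_V e)"
    unfolding tang_parts[of e] using G_orth[OF tang_H_props tang_V_props(1), of e e] G_sym[of "tang_V e" "tang_H e"]
    by (simp add: add_left add_right)
  then show ?thesis unfolding G_tang G_tang_V by simp
qed

lemma G_parts_tang:
  assumes "H \<theta> X = 0" "\<theta> \<star> H \<theta> Y = Y" "G \<theta> Y = 0"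
  shows "G X (tang_H e) = G X e" "G Y (tang_V e) = G Y e"
proof -
  have X: "G X \<theta> = 0" using G_sym[of X \<theta>] assms(1) by simp
  have Y: "G Y \<theta> = 0" using G_sym[of Y \<theta>] assms(3) by simp
  have 1: "G X (tang_V e) = 0" by (rule G_orth[OF assms(1) tang_V_props(1)])
  have 2: "G Y (tang_H e) = 0" using G_orth[OF tang_H_props assms(2)] G_sym[of Y "tang_H e"] by simp
  have e: "e = tang_H e + tang_V e + G \<theta> e *\<^sub>R \<theta>" by (simp add: tang_parts[symmetric] tang_def)
  show "G X (tang_H e) = G X e" using arg_cong[OF e, of "G X"] 1 X by (simp add: add_right scaleR_right)
  show "G Y (tang_V e) = G Y e" using arg_cong[OF e, of "G Y"] 2 Y by (simp add: add_right scaleR_right)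
qed

lemma stretch_pos: "stretch \<tau> > 0" using rho_pos[of \<tau>] z_props(5) by (simp add: stretch_def)

lemma rad_stretch_eq:
  "rad_stretch \<tau> = (1 - (tanh (rho \<tau>))^2) / (1 - (tanh r)^2) * exp (real N * \<tau>) * area N r / area N (rho \<tau>)"
  using vol_pos[OF r_pos, of N] unfolding rad_stretch_def vol_rho by (simp add: mult_ac)

lemma rad_stretch_pos: "rad_stretch \<tau> > 0"
  unfolding rad_stretch_eq using area_pos[OF r_pos, of N] area_pos[OF rho_pos, of N \<tau>]
    tanh_sq_less_1[of r] tanh_sq_less_1[of "rho \<tau>"] by simp

text \<open>
  The image of the normal under the inverse transpose of the dilation. Since the derivative of the dilation is
  triangular with respect to the radial direction, the radial component is divided by \<open>rad_stretch\<close>, and the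
  tangential ones are corrected by the shear. The correction \<open>q\<close> depends on \<open>t\<close> only through the factor \<open>t\<close>: the
  new radius cancels between \<open>shear\<close> and \<open>rad_stretch\<close>.
\<close>
definition conormal :: "real \<Rightarrow> real^('m \<times> 4) \<Rightarrow> real \<Rightarrow> real \<Rightarrow> real^('m \<times> 4) \<Rightarrow> real^('m \<times> 4) \<Rightarrow> real^('m \<times> 4)" where
  "conormal t e \<tau> \<alpha> X Y =
    (let \<sigma> = 1 - (tanh r)^2; \<sigma>' = 1 - (tanh (rho \<tau>))^2; q = \<alpha> * t * (vol N r / (area N r * tanh r))
     in (\<alpha> * \<sigma>'^2 / (rad_stretch \<tau> * \<sigma>)) *\<^sub>R \<theta>
       + (\<sigma>' / stretch \<tau>) *\<^sub>R ((1 / \<sigma>) *\<^sub>R X - q *\<^sub>R tang_H e)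
       + (\<sigma>'^2 / stretch \<tau>) *\<^sub>R ((1 / \<sigma>^2) *\<^sub>R Y - q *\<^sub>R tang_V e))"

lemma conormal:
  fixes \<tau> t \<alpha> :: real and e X Y u :: "real^('m \<times> 4)"
  assumes X: "H \<theta> X = 0" and Y: "\<theta> \<star> H \<theta> Y = Y" "G \<theta> Y = 0"
  defines "z' \<equiv> tanh (rho \<tau>) *\<^sub>R \<theta>"
  shows conormal_adjoint: "qre (ball_form H z u ((\<alpha> * (1 - (tanh r)^2)) *\<^sub>R \<theta> + X + Y))
      = qre (ball_form H z' (dil_deriv t e \<tau> u) (conormal t e \<tau> \<alpha> X Y))" (is ?adj)
    and conormal_norm: "qre (ball_form H z' (conormal t e \<tau> \<alpha> X Y) (conormal t e \<tau> \<alpha> X Y)) * (exp (real N * \<tau>))^2 =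
       \<alpha>^2 * (area N (rho \<tau>) / area N r)^2
     + (exp (real N * \<tau>))^2 * ((sinh r)^2 / (sinh (rho \<tau>))^2) *
        (G X X / (1 - (tanh r)^2) - 2 * \<alpha> * t * (vol N r / (area N r * tanh r)) * G X e
          + \<alpha>^2 * t^2 * (vol N r / (area N r * tanh r))^2 * (1 - (tanh r)^2) * G (tang_H e) (tang_H e))
     + (exp (real N * \<tau>))^2 * ((sinh r)^2 * (cosh r)^2 / ((sinh (rho \<tau>))^2 * (cosh (rho \<tau>))^2)) *
        (G Y Y / (1 - (tanh r)^2)^2 - 2 * \<alpha> * t * (vol N r / (area N r * tanh r)) * G Y e
          + \<alpha>^2 * t^2 * (vol N r / (area N r * tanh r))^2 * (1 - (tanh r)^2)^2 * G (tang_V e) (tang_V e))" (is ?norm)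
proof -
  define T T' where "T = tanh r" and "T' = tanh (rho \<tau>)"
  define \<sigma> \<sigma>' where "\<sigma> = 1 - T^2" and "\<sigma>' = 1 - T'^2"
  define K A where "K = stretch \<tau>" and "A = rad_stretch \<tau>"
  define q0 q where "q0 = vol N r / (area N r * T)" and "q = \<alpha> * t * q0"
  define a where "a = \<alpha> * \<sigma>'^2 / (A * \<sigma>)"
  define XX where "XX = (\<sigma>' / K) *\<^sub>R ((1 / \<sigma>) *\<^sub>R X - q *\<^sub>R tang_H e)"
  define YY where "YY = (\<sigma>'^2 / K) *\<^sub>R ((1 / \<sigma>^2) *\<^sub>R Y - q *\<^sub>R tang_V e)"
  define E where "E = exp (real N * \<tau>)"
  have E: "E > 0" by (simp add: E_def)
  have \<sigma>: "\<sigma> > 0" "\<sigma>' > 0" using tanh_sq_less_1 by (simp_all add: \<sigma>_def \<sigma>'_def T_def T'_def)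
  have KA: "K > 0" "A > 0" using stretch_pos rad_stretch_pos by (simp_all add: K_def A_def)
  have T: "T > 0" using z_props by (simp add: T_def)
  have w: "vol N r > 0" "area N r > 0" "vol N (rho \<tau>) > 0" "area N (rho \<tau>) > 0"
    using vol_pos area_pos r_pos rho_pos by simp_all
  have con: "conormal t e \<tau> \<alpha> X Y = a *\<^sub>R \<theta> + XX + YY"
    by (simp add: conormal_def Let_def a_def XX_def YY_def T_def[symmetric] T'_def[symmetric] \<sigma>_def[symmetric]
        \<sigma>'_def[symmetric] K_def[symmetric] A_def[symmetric] q_def q0_def)
  have HXX: "H \<theta> XX = 0" by (simp add: XX_def form_simps X tang_H_props)
  have HYY: "\<theta> \<star> H \<theta> YY = YY"
    by (simp add: YY_def scaleR_right diff_right rscale_distrib Y(1) tang_V_props(1))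
  have GYY: "G \<theta> YY = 0" by (simp add: YY_def form_simps Y(2) tang_V_props(2))
  have GXX: "G \<theta> XX = 0" using HXX by simp
  have sq: "T^2 < 1" "T'^2 < 1" using \<sigma> by (simp_all add: \<sigma>_def \<sigma>'_def)
  \<comment> \<open>the shear contributes the same multiple \<open>q\<close> of \<open>tang e\<close> that the tangential parts subtract\<close>
  have shear: "a * shear t \<tau> / \<sigma>'^2 = q"
  proof -
    have "shear t \<tau> = A * \<sigma> * t * q0"
      using w T \<sigma> unfolding shear_def A_def rad_stretch_def T_def[symmetric] T'_def[symmetric] \<sigma>_def[symmetric] \<sigma>'_def[symmetric] q0_def
      by (simp add: field_simps)
    then show ?thesis using KA \<sigma> by (simp add: a_def q_def)
  qed
  have Gd: "G (dil_deriv t e \<tau> u) \<theta> = A * G u \<theta> + shear t \<tau> * G u (tang e)"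
    using unit by (simp add: dil_deriv_def form_simps G_sym[of u \<theta>] G_sym[of u "tang e"] A_def)
  have Gd2: "G (dil_deriv t e \<tau> u) V = K * G u V" if "G \<theta> V = 0" for V
    using that by (simp add: dil_deriv_def form_simps K_def)
  have "qre (ball_form H z' (dil_deriv t e \<tau> u) (conormal t e \<tau> \<alpha> X Y))
    = a * (A * G u \<theta> + shear t \<tau> * G u (tang e)) / \<sigma>'^2 + K * G u XX / \<sigma>' + K * G u YY / \<sigma>'^2"
    unfolding con z'_def T'_def[symmetric] ball_form_radial_parts[OF sq(2) HXX HYY] Gd Gd2[OF GXX] Gd2[OF GYY] \<sigma>'_def ..
  also have "a * (A * G u \<theta> + shear t \<tau> * G u (tang e)) / \<sigma>'^2 = \<alpha> / \<sigma> * G u \<theta> + q * G u (tang e)"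
    unfolding shear[symmetric] using KA \<sigma> by (simp add: a_def field_simps)
  also have "K * G u XX / \<sigma>' = G u X / \<sigma> - q * G u (tang_H e)"
    using KA \<sigma> by (simp add: XX_def form_simps)
  also have "K * G u YY / \<sigma>'^2 = G u Y / \<sigma>^2 - q * G u (tang_V e)"
    using KA \<sigma> by (simp add: YY_def form_simps)
  also have "G u (tang e) = G u (tang_H e) + G u (tang_V e)" by (subst tang_parts) (simp add: add_right)
  also have "\<alpha> / \<sigma> * G u \<theta> + q * (G u (tang_H e) + G u (tang_V e)) + (G u X / \<sigma> - q * G u (tang_H e))
      + (G u Y / \<sigma>^2 - q * G u (tang_V e)) = \<alpha> * \<sigma> * G u \<theta> / \<sigma>^2 + G u X / \<sigma> + G u Y / \<sigma>^2"
    using \<sigma> by (simp add: distrib_left power2_eq_square)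
  also have "\<dots> = qre (ball_form H z u ((\<alpha> * (1 - (tanh r)^2)) *\<^sub>R \<theta> + X + Y))"
    using ball_form_radial_parts[OF sq(1) X Y(1), of u "\<alpha> * \<sigma>"] by (simp only: \<sigma>_def T_def)
  finally show ?adj by simp
  have G1: "G (a *\<^sub>R \<theta> + XX + YY) \<theta> = a"
    using unit GXX GYY by (simp add: form_simps G_sym[of XX \<theta>] G_sym[of YY \<theta>])
  have o: "G XX YY = 0" by (rule G_orth[OF HXX HYY])
  have G2: "G (a *\<^sub>R \<theta> + XX + YY) XX = G XX XX" using GXX o G_sym[of YY XX] by (simp add: form_simps)
  have G3: "G (a *\<^sub>R \<theta> + XX + YY) YY = G YY YY" using GYY o by (simp add: form_simps)
  have n: "qre (ball_form H z' (conormal t e \<tau> \<alpha> X Y) (conormal t e \<tau> \<alpha> X Y)) =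
      a * a / \<sigma>'^2 + G XX XX / \<sigma>' + G YY YY / \<sigma>'^2"
    unfolding con z'_def T'_def[symmetric] ball_form_radial_parts[OF sq(2) HXX HYY] G1 G2 G3 \<sigma>'_def ..
  have GXX2: "G XX XX / \<sigma>' = \<sigma>' / (K^2 * \<sigma>) * (G X X / \<sigma> - 2 * q * G X e + q^2 * \<sigma> * G (tang_H e) (tang_H e))"
    using KA \<sigma> G_parts_tang(1)[OF X Y, of e] G_sym[of "tang_H e" X]
    by (simp add: XX_def form_simps power2_eq_square field_simps)
  have GYY2: "G YY YY / \<sigma>'^2 = \<sigma>'^2 / (K^2 * \<sigma>^2) * (G Y Y / \<sigma>^2 - 2 * q * G Y e + q^2 * \<sigma>^2 * G (tang_V e) (tang_V e))"
    using KA \<sigma> G_parts_tang(2)[OF X Y, of e] G_sym[of "tang_V e" Y]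
    by (simp add: YY_def form_simps power2_eq_square field_simps)
  define S C S' C' where d: "S = sinh r" "C = cosh r" "S' = sinh (rho \<tau>)" "C' = cosh (rho \<tau>)"
  have pos: "S > 0" "C > 0" "S' > 0" "C' > 0" using r_pos rho_pos[of \<tau>] by (simp_all add: d)
  have TS: "T = S / C" "T' = S' / C'" by (simp_all add: tanh_def d T_def T'_def)
  have \<sigma>C: "\<sigma> = 1 / C^2" "\<sigma>' = 1 / C'^2"
  proof -
    have "C^2 = 1 + S^2" "C'^2 = 1 + S'^2" by (simp_all add: d cosh_square_eq)
    moreover have "C^2 \<noteq> 0" "C'^2 \<noteq> 0" using pos by simp_all
    ultimately show "\<sigma> = 1 / C^2" "\<sigma>' = 1 / C'^2"
      by (simp_all add: \<sigma>_def \<sigma>'_def TS power_divide field_simps)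
  qed
  have K: "K = S' * C / (S * C')" by (simp add: K_def stretch_def T_def[symmetric] T'_def[symmetric] TS)
  have k1: "\<sigma>' / (K^2 * \<sigma>) = S^2 / S'^2"
    unfolding K \<sigma>C using pos by (simp add: power_divide power_mult_distrib)
  have k2: "\<sigma>'^2 / (K^2 * \<sigma>^2) = S^2 * C^2 / (S'^2 * C'^2)"
    unfolding K \<sigma>C using pos by (simp add: power_divide power_mult_distrib field_simps power2_eq_square)
  have A: "A = \<sigma>' / \<sigma> * E * area N r / area N (rho \<tau>)"
    unfolding A_def rad_stretch_eq by (simp add: \<sigma>_def \<sigma>'_def T_def T'_def E_def)
  have k3: "a * a / \<sigma>'^2 * E^2 = \<alpha>^2 * (area N (rho \<tau>) / area N r)^2"
    unfolding a_def A using E w \<sigma> by (simp add: field_simps power2_eq_square)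
  have q2: "2 * q = 2 * \<alpha> * t * q0" "q^2 = \<alpha>^2 * t^2 * q0^2" by (simp_all add: q_def power_mult_distrib)
  have "qre (ball_form H z' (conormal t e \<tau> \<alpha> X Y) (conormal t e \<tau> \<alpha> X Y)) * E^2 =
      a * a / \<sigma>'^2 * E^2 + E^2 * (G XX XX / \<sigma>') + E^2 * (G YY YY / \<sigma>'^2)"
    unfolding n by (simp add: distrib_right distrib_left mult.commute)
  also have "\<dots> = \<alpha>^2 * (area N (rho \<tau>) / area N r)^2
     + E^2 * (S^2 / S'^2) * (G X X / \<sigma> - 2 * \<alpha> * t * q0 * G X e + \<alpha>^2 * t^2 * q0^2 * \<sigma> * G (tang_H e) (tang_H e))
     + E^2 * (S^2 * C^2 / (S'^2 * C'^2)) * (G Y Y / \<sigma>^2 - 2 * \<alpha> * t * q0 * G Y e + \<alpha>^2 * t^2 * q0^2 * \<sigma>^2 * G (tang_V e) (tang_V e))"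
    unfolding k3 GXX2 GYY2 k1 k2 q2 by (simp only: mult.assoc)
  finally show ?norm unfolding E_def q0_def \<sigma>_def T_def d .
qed

text \<open>
  All linear maps are expressed through the derivatives of \<open>recentre\<close> at source and target, which are isometries
  onto the tangent spaces with the metric; then \<open>volume_distortion\<close> and \<open>conormal_adjoint\<close> give the cofactor.
\<close>
theorem hyperplane_jacobian_eq:
  fixes t c \<alpha> :: real and e X Y \<nu> :: "real^('m \<times> 4)"
  assumes X: "H \<theta> X = 0" and Y: "\<theta> \<star> H \<theta> Y = Y" "G \<theta> Y = 0"
    and \<nu>: "\<nu> = recentre_deriv z ((\<alpha> * (1 - (tanh r)^2)) *\<^sub>R \<theta> + X + Y)"
  defines "\<tau> \<equiv> t * (G \<theta> e + c)"
  defines "z' \<equiv> tanh (rho \<tau>) *\<^sub>R \<theta>" and "a \<equiv> conormal t e \<tau> \<alpha> X Y"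
  shows "hyperplane_jacobian p (recentre z) \<nu> t (\<lambda>\<theta>. G \<theta> e + c) =
    sqrt (qre (ball_form H z' a a) * (exp (real N * \<tau>))^2)"
proof -
  let ?F = "qh_dilation p t (\<lambda>\<theta>. G \<theta> e + c)"
  define y y' where "y = recentre z" and "y' = recentre z'"
  define R R' M where "R = recentre_deriv z" and "R' = recentre_deriv z'" and "M = dil_deriv t e \<tau>"
  have z1: "G z z < 1" "G z' z' < 1" unfolding z'_def by (rule G_tanh[OF unit])+
  have ys: "y \<in> qh_space" "y' \<in> qh_space" using recentre_in_space z1 by (simp_all add: y_def y'_def)
  have mz: "model_dilation t e c z = z'" unfolding model_dilation_z z'_def \<tau>_def ..
  have Fy: "?F y = y'" unfolding y_def y'_def qh_dilation_recentre[OF z_props(2,4)] mz ..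
  obtain D where D: "(decentre has_derivative D) (at y)" "\<And>u. D (R u) = u" "\<And>u. R (D u) = u"
    using has_derivative_decentre[OF z1(1)] unfolding y_def R_def by blast
  have dz: "decentre y = z" unfolding y_def by (rule decentre_recentre(1)[OF denom_nonzero[OF z1(1)]])
  define L where "L u = R' (M (D u))" for u
  have "((\<lambda>x. model_dilation t e c (decentre x)) has_derivative (\<lambda>u. M (D u))) (at y)"
    by (rule has_derivative_compose[OF D(1)]) (unfold dz M_def \<tau>_def, rule has_derivative_model_dilation)
  then have "((\<lambda>x. recentre (model_dilation t e c (decentre x))) has_derivative L) (at y)"
    unfolding L_def R'_def
    by (rule has_derivative_compose) (unfold dz mz, rule has_derivative_recentre[OF denom_nonzero[OF z1(2)]])
  then have "(?F has_derivative L) (at y)"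
  proof (rule has_derivative_transform_within_open[of _ _ _ _ "qh_space - {p}"])
    show "open (qh_space - {p})" using open_qh_space by (rule open_delete)
    have "y \<noteq> p"
    proof
      assume "y = p"
      then have "decentre y = 0" by (simp add: decentre_def)
      then show False using dz z_props(2) by simp
    qed
    then show "y \<in> qh_space - {p}" using ys by simp
    fix x assume x: "x \<in> qh_space - {p}"
    then have rd: "recentre (decentre x) = x" using recentre_decentre(1)[OF slope_diff_p] by blast
    have "decentre x \<noteq> 0" using x rd recentre_0 by auto
    moreover have "G (decentre x) (decentre x) < 1" using decentre_in_ball x by blast
    ultimately show "recentre (model_dilation t e c (decentre x)) = ?F x"
      using qh_dilation_recentre[of "decentre x" t e c] rd by simp
  qed
  from frechet_derivative_at[OF this] have fd: "frechet_derivative ?F (at y) = L" by simp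
  have lin: "linear L" "linear R" "linear R'" "linear M"
    using \<open>(?F has_derivative L) (at y)\<close> has_derivative_linear linear_recentre_deriv linear_dil_deriv
    by (auto simp: R_def R'_def M_def)
  have LR: "L (R u) = R' (M u)" for u by (simp add: L_def D(2))
  interpret y: hermitian_form "ball_form herm y" by (rule hermitian_form_qh[OF ys(1)])
  interpret y': hermitian_form "ball_form herm y'" by (rule hermitian_form_qh[OF ys(2)])
  have By: "qh_metric y = (\<lambda>u v. y.G u v)" "qh_metric y' = (\<lambda>u v. y'.G u v)"
    by (simp_all add: fun_eq_iff qh_metric_eq)
  have iso: "qh_metric y (R u) (R v) = qre (ball_form H z u v)" "qh_metric y' (R' u) (R' v) = qre (ball_form H z' u v)" for u v
    unfolding y_def y'_def R_def R'_def by (rule recentre_isometry[OF z1(1)], rule recentre_isometry[OF z1(2)])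
  define g0 where "g0 = det (gram_matrix G)"
  have g0: "g0 \<noteq> 0" unfolding g0_def by (rule det_gram_qh_nonzero[OF p_in_space])
  define \<sigma> \<sigma>' where "\<sigma> = 1 - (tanh r)^2" and "\<sigma>' = 1 - (tanh (rho \<tau>))^2"
  have \<sigma>: "\<sigma> > 0" "\<sigma>' > 0" using tanh_sq_less_1 by (simp_all add: \<sigma>_def \<sigma>'_def)
  have Gz: "1 - G z z = \<sigma>" "1 - G z' z' = \<sigma>'"
    using unit by (simp_all add: z'_def \<sigma>_def \<sigma>'_def form_simps power2_eq_square)
  have grams: "det (gram_matrix (\<lambda>u v. qh_metric y (R u) (R v))) = g0 / \<sigma> ^ (N + 4)"
     "det (gram_matrix (\<lambda>u v. qh_metric y' (R' u) (R' v))) = g0 / \<sigma>' ^ (N + 4)"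
    unfolding iso det_gram_ball_form[OF z1(1)] det_gram_ball_form[OF z1(2)] Gz g0_def N_eq by simp_all
  have "(det_wrt (qh_metric y) (qh_metric y') L)^2 * \<bar>g0 / \<sigma> ^ (N + 4)\<bar> = (det (matrix M))^2 * \<bar>g0 / \<sigma>' ^ (N + 4)\<bar>"
    unfolding grams[symmetric]
  proof (rule det_wrt_sq[OF lin LR])
    show "det (gram_matrix (qh_metric y)) \<noteq> 0" unfolding By by (rule det_gram_qh_nonzero[OF ys(1)])
    show "linear (\<lambda>v. qh_metric y u v)" "linear (\<lambda>u. qh_metric y u v)"
      "linear (\<lambda>v. qh_metric y' u v)" "linear (\<lambda>u. qh_metric y' u v)" for u v
      unfolding By by (rule y.linear_G_right y.linear_G_left y'.linear_G_right y'.linear_G_left)+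
  qed
  then have "(det_wrt (qh_metric y) (qh_metric y') L)^2 = (det (matrix M))^2 * (\<sigma> / \<sigma>') ^ (N + 4)"
    using g0 \<sigma> by (simp add: abs_divide power_divide field_simps)
  also have "\<dots> = (exp (real N * \<tau>))^2"
    unfolding M_def det_dil_deriv \<sigma>_def \<sigma>'_def by (rule volume_distortion)
  finally have det: "(det_wrt (qh_metric y) (qh_metric y') L)^2 = (exp (real N * \<tau>))^2" .
  have "det (matrix M) \<noteq> 0"
    unfolding M_def det_dil_deriv using stretch_pos[of \<tau>] rad_stretch_pos[of \<tau>] by simp
  then have injM: "inj M" using det_nz_iff_inj[OF lin(4)] by blast
  obtain D' where D': "\<And>u. D' (R' u) = u"
    using has_derivative_decentre[OF z1(2)] unfolding R'_def by metis
  have "inj L"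
  proof (rule injI)
    fix u v assume "L u = L v"
    then have "M (D u) = M (D v)" unfolding L_def using D' by metis
    then have "D u = D v" using injM by (simp add: inj_eq)
    then show "u = v" using D(3) by metis
  qed
  then have bij: "bij L" using linear_injective_imp_surjective[OF lin(1)] by (simp add: bij_def)
  have adj: "adjoint_wrt (qh_metric y') (qh_metric y) (inv L) \<nu> = R' a"
  proof (rule adjoint_wrt_inv[OF bij])
    fix u
    have "qh_metric y u \<nu> = qh_metric y (R (D u)) (R ((\<alpha> * (1 - (tanh r)^2)) *\<^sub>R \<theta> + X + Y))"
      unfolding D(3) unfolding \<nu> R_def ..
    also have "\<dots> = qre (ball_form H z' (M (D u)) a)"
      unfolding iso a_def z'_def M_def by (rule conormal_adjoint[OF X Y])
    also have "\<dots> = qh_metric y' (L u) (R' a)" unfolding iso[symmetric] L_def ..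
    finally show "qh_metric y u \<nu> = qh_metric y' (L u) (R' a)" .
  next
    fix b assume "\<And>x. qh_metric y' x (R' a) = qh_metric y' x b"
    then show "R' a = b"
      by (intro qh_metric_nondegenerate[OF ys(2)]) (metis qh_metric_sym)
  qed
  have "hyperplane_jacobian p y \<nu> t (\<lambda>\<theta>. G \<theta> e + c) =
     sqrt ((det_wrt (qh_metric y) (qh_metric y') L)^2 * qh_metric y' (R' a) (R' a))"
    unfolding hyperplane_jacobian_def Let_def Fy fd cof_wrt_def adj
    by (simp add: By y'.scaleR_left y'.scaleR_right power2_eq_square)
  then show ?thesis unfolding det iso unfolding y_def by (simp only: mult.commute)
qed

end

section \<open>Second derivatives\<close>

text \<open>
  Positivity of \<open>Q\<close> near \<open>0\<close> is automatic, and the second derivative of the square root only involves such points.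
\<close>
lemma sqrt_derivs:
  fixes Q :: "real \<Rightarrow> real"
  assumes Q: "\<And>t. (Q has_real_derivative Q1 t) (at t)" and Q1: "(Q1 has_real_derivative Q2) (at 0)" and Q0: "Q 0 = 1"
  shows "deriv (\<lambda>t. sqrt (Q t)) 0 = Q1 0 / 2"
    "deriv (deriv (\<lambda>t. sqrt (Q t))) 0 = Q2 / 2 - (Q1 0)^2 / 4"
proof -
  have d: "((\<lambda>t. sqrt (Q t)) has_real_derivative Q1 t / (2 * sqrt (Q t))) (at t)" if "Q t > 0" for t
    by (rule DERIV_cong[OF DERIV_chain2[OF DERIV_real_sqrt[OF that] Q[of t]]]) (use that in \<open>simp add: field_simps\<close>)
  have dd: "deriv (\<lambda>t. sqrt (Q t)) t = Q1 t / (2 * sqrt (Q t))" if "Q t > 0" for t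
    by (rule DERIV_imp_deriv[OF d[OF that]])
  then show "deriv (\<lambda>t. sqrt (Q t)) 0 = Q1 0 / 2" using Q0 by simp
  have "isCont Q 0" by (rule DERIV_isCont[OF Q])
  then have "(Q \<longlongrightarrow> Q 0) (nhds 0)" by (simp only: isCont_def tendsto_at_iff_tendsto_nhds)
  from order_tendstoD(1)[OF this, of 0] have "\<forall>\<^sub>F t in nhds 0. Q t > 0" by (simp add: Q0)
  then have ev: "\<forall>\<^sub>F t in nhds 0. deriv (\<lambda>t. sqrt (Q t)) t = Q1 t / (2 * sqrt (Q t))"
    by (rule eventually_mono) (rule dd)
  have "((\<lambda>t. Q1 t / (2 * sqrt (Q t))) has_real_derivative
      (Q2 * (2 * sqrt (Q 0)) - Q1 0 * (2 * (Q1 0 / (2 * sqrt (Q 0))))) / (2 * sqrt (Q 0) * (2 * sqrt (Q 0)))) (at 0)"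
    by (rule DERIV_divide[OF Q1 DERIV_cmult[OF d]]) (simp_all add: Q0)
  then have "deriv (\<lambda>t. Q1 t / (2 * sqrt (Q t))) 0 = Q2 / 2 - (Q1 0)^2 / 4"
    by (intro DERIV_imp_deriv) (simp add: Q0 field_simps power2_eq_square)
  then show "deriv (deriv (\<lambda>t. sqrt (Q t))) 0 = Q2 / 2 - (Q1 0)^2 / 4"
    using deriv_cong_ev[OF ev refl] by simp
qed

lemma product_derivs:
  fixes f g pol pol1 :: "real \<Rightarrow> real"
  assumes f: "\<And>\<tau>. (f has_real_derivative g \<tau>) (at \<tau>)" and g: "(g has_real_derivative h) (at 0)"
    and pol: "\<And>t. (pol has_real_derivative pol1 t) (at t)" and pol1: "(pol1 has_real_derivative pol2) (at 0)"
  shows "((\<lambda>t. f (t * \<phi>) * pol t) has_real_derivative \<phi> * g (t * \<phi>) * pol t + f (t * \<phi>) * pol1 t) (at t)"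
    "((\<lambda>t. \<phi> * g (t * \<phi>) * pol t + f (t * \<phi>) * pol1 t) has_real_derivative
        \<phi>^2 * h * pol 0 + 2 * \<phi> * g 0 * pol1 0 + f 0 * pol2) (at 0)"
proof -
  have m: "((\<lambda>t. t * \<phi>) has_real_derivative \<phi>) (at t)" for t by (auto intro!: derivative_eq_intros)
  have f': "((\<lambda>t. f (t * \<phi>)) has_real_derivative g (t * \<phi>) * \<phi>) (at t)" for t
    by (rule DERIV_chain2[OF f m])
  have "(g has_real_derivative h) (at (0 * \<phi>))" using g by simp
  from DERIV_chain2[OF this m] have g': "((\<lambda>t. g (t * \<phi>)) has_real_derivative h * \<phi>) (at 0)" .
  show "((\<lambda>t. f (t * \<phi>) * pol t) has_real_derivative \<phi> * g (t * \<phi>) * pol t + f (t * \<phi>) * pol1 t) (at t)"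
    using DERIV_mult[OF f' pol, of t] by (simp add: algebra_simps)
  show "((\<lambda>t. \<phi> * g (t * \<phi>) * pol t + f (t * \<phi>) * pol1 t) has_real_derivative
        \<phi>^2 * h * pol 0 + 2 * \<phi> * g 0 * pol1 0 + f 0 * pol2) (at 0)"
    using DERIV_add[OF DERIV_mult[OF DERIV_cmult[OF g', of \<phi>] pol] DERIV_mult[OF f' pol1]]
    by (simp add: algebra_simps power2_eq_square)
qed

text \<open>
  The second derivative of a function whose logarithmic derivative is a function \<open>l\<close> of a quantity \<open>X\<close>.
\<close>
lemma logarithmic_second_deriv:
  fixes f X :: "real \<Rightarrow> real"
  assumes X: "(X has_real_derivative \<Psi>) (at 0)" and l: "(l has_real_derivative l') (at (X 0))"
    and f: "(f has_real_derivative l (X 0) * f 0) (at 0)" and f0: "f 0 = 1"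
  shows "((\<lambda>\<tau>. l (X \<tau>) * f \<tau>) has_real_derivative l' * \<Psi> + (l (X 0))^2) (at 0)"
  by (rule DERIV_cong[OF DERIV_mult[OF DERIV_chain2[OF l X] f]]) (simp add: f0 power2_eq_square)

section \<open>Parseval identities at the base point\<close>

context qh_dim
begin

lemma parseval:
  assumes "qh_orthonormal_basis p e"
  shows "(\<Sum>j = 1..N. G u (e j) * G v (e j)) = G u v"
proof -
  have on: "G (e i) (e j) = (if i = j then 1 else 0)" if "i \<in> {1..N}" "j \<in> {1..N}" for i j
    using assms that unfolding qh_orthonormal_basis_def N_eq[symmetric] by (simp add: qh_metric_p)
  have inj: "inj_on e {1..N}"
  proof (rule inj_onI)
    fix i j assume ij: "i \<in> {1..N}" "j \<in> {1..N}" "e i = e j"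
    then show "i = j" using on[of i j] on[of j j] by (auto split: if_splits)
  qed
  have ind: "independent (e ` {1..N})"
  proof (rule notI)
    assume "dependent (e ` {1..N})"
    then obtain c w where c: "w \<in> e ` {1..N}" "c w \<noteq> 0" "(\<Sum>x\<in>e ` {1..N}. c x *\<^sub>R x) = 0"
      by (auto simp: dependent_finite)
    then obtain i where i: "i \<in> {1..N}" "w = e i" by blast
    have "(\<Sum>k\<in>{1..N}. c (e k) *\<^sub>R e k) = 0"
      using c(3) unfolding sum.reindex[OF inj] by (simp add: o_def)
    then have "0 = G (e i) (\<Sum>k\<in>{1..N}. c (e k) *\<^sub>R e k)" by (simp add: zero_right)
    also have "\<dots> = (\<Sum>k\<in>{1..N}. c (e k) * G (e i) (e k))"
      by (simp add: sum_right scaleR_right qre_sum)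
    also have "\<dots> = (\<Sum>k\<in>{1..N}. if i = k then c (e k) else 0)"
      by (rule sum.cong) (use on i in auto)
    also have "\<dots> = c w" using i by simp
    finally show False using c(2) by simp
  qed
  have "card (e ` {1..N}) = DIM(real^('m \<times> 4))"
    unfolding card_image[OF inj] by (simp add: N_eq)
  then have span: "span (e ` {1..N}) = UNIV"
    using card_ge_dim_independent[OF subset_UNIV ind] by (auto simp: dim_UNIV)
  \<comment> \<open>\<open>u - P\<close> is orthogonal to the basis, hence to its span\<close>
  define P where "P = (\<Sum>j\<in>{1..N}. G u (e j) *\<^sub>R e j)"
  have "G (u - P) x = 0" for x
  proof -
    have "subspace {x. G (u - P) x = 0}"
      by (rule subspaceI) (simp_all add: add_right scaleR_right zero_right)
    moreover have "e ` {1..N} \<subseteq> {x. G (u - P) x = 0}"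
    proof (rule image_subsetI)
      fix i assume i: "i \<in> {1..N}"
      have "G P (e i) = (\<Sum>k\<in>{1..N}. G u (e k) * G (e k) (e i))"
        by (simp add: P_def sum_left scaleR_left qre_sum)
      also have "\<dots> = (\<Sum>k\<in>{1..N}. if k = i then G u (e k) else 0)"
        by (rule sum.cong) (use on i in auto)
      also have "\<dots> = G u (e i)" using i by simp
      finally show "e i \<in> {x. G (u - P) x = 0}" by (simp add: diff_left)
    qed
    ultimately show ?thesis using span_minimal span by blast
  qed
  then have "G (u - P) (u - P) = 0" by blast
  then have u: "u = P" using G_eq_0_iff[of "u - P"] by simp
  have "G u v = G P v" using u by simp
  also have "\<dots> = (\<Sum>j\<in>{1..N}. G u (e j) * G (e j) v)"
    by (simp add: P_def sum_left scaleR_left qre_sum)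
  also have "\<dots> = (\<Sum>j\<in>{1..N}. G u (e j) * G v (e j))" unfolding G_sym[of v] ..
  finally show ?thesis by simp
qed

text \<open>
  The norm of \<open>H \<theta> e\<close> is the norm of the projection of \<open>e\<close> to the quaternionic line of \<open>\<theta>\<close>, whose trace is its
  real dimension four.
\<close>
lemma sum_norm_H:
  assumes "qh_orthonormal_basis p e" "G \<theta> \<theta> = 1"
  shows "(\<Sum>j = 1..N. (norm (H \<theta> (e j)))^2) = 4"
proof -
  have one: "(\<Sum>j = 1..N. (qre (qcnj a * H \<theta> (e j)))^2) = (norm a)^2" for a
  proof -
    have H1: "H \<theta> \<theta> = 1" using form_self[of \<theta>] assms(2) by simp
    have "(\<Sum>j = 1..N. (qre (qcnj a * H \<theta> (e j)))^2) = (\<Sum>j = 1..N. G (\<theta> \<star> a) (e j) * G (\<theta> \<star> a) (e j))"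
      by (simp only: rscale_left power2_eq_square)
    also have "\<dots> = G (\<theta> \<star> a) (\<theta> \<star> a)" by (rule parseval[OF assms(1)])
    also have "\<dots> = qre (qcnj a * a)"
      by (simp only: rscale_left rscale_right H1 mult_1_left mult_1_right)
    finally show ?thesis unfolding qcnj_mult_self qre_of_real .
  qed
  have "(norm b)^2 = (qre (qcnj 1 * b))^2 + (qre (qcnj (Quaternion 0 1 0 0) * b))^2
     + (qre (qcnj (Quaternion 0 0 1 0) * b))^2 + (qre (qcnj (Quaternion 0 0 0 1) * b))^2" for b
    unfolding norm_quaternion_sq by simp
  then have "(\<Sum>j = 1..N. (norm (H \<theta> (e j)))^2) =
     (norm (1 :: quaternion))^2 + (norm (Quaternion 0 1 0 0))^2 + (norm (Quaternion 0 0 1 0))^2 + (norm (Quaternion 0 0 0 1))^2"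
    by (simp only: sum.distrib one)
  then show ?thesis unfolding norm_quaternion_sq by simp
qed

end

section \<open>The growth of the radius\<close>

text \<open>
  Numerators, over the common denominator \<open>rate\<close>, of the logarithmic derivatives of the three coefficient functions
  \<open>f1\<close>, \<open>f2\<close>, \<open>f3\<close> of the squared Jacobian; primes denote derivatives in \<open>x\<close>.
\<close>
definition lin1 :: "real \<Rightarrow> real \<Rightarrow> real" where
  "lin1 n x = 2 * (n - 1) * (n * x + n + 2) * (1 + x) + 6 * x * (n * x + n + 2)"
definition lin2 :: "real \<Rightarrow> real \<Rightarrow> real" where
  "lin2 n x = 2 * n * (n + 2) * (1 + x)^2 - 2 * (n * x + n + 2) * (1 + x)"
definition lin3 :: "real \<Rightarrow> real \<Rightarrow> real" where
  "lin3 n x = lin2 n x - 2 * x * (n * x + n + 2)"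
definition lin1' :: "real \<Rightarrow> real \<Rightarrow> real" where
  "lin1' n x = 2 * (n - 1) * (n * (1 + x) + (n * x + n + 2)) + 6 * ((n * x + n + 2) + n * x)"
definition lin2' :: "real \<Rightarrow> real \<Rightarrow> real" where
  "lin2' n x = 4 * n * (n + 2) * (1 + x) - 2 * (n * (1 + x) + (n * x + n + 2))"
definition lin3' :: "real \<Rightarrow> real \<Rightarrow> real" where
  "lin3' n x = lin2' n x - 2 * ((n * x + n + 2) + n * x)"

lemma lin_derivs:
  "(lin1 n has_real_derivative lin1' n x) (at x)" "(lin2 n has_real_derivative lin2' n x) (at x)"
  "(lin3 n has_real_derivative lin3' n x) (at x)"
proof -
  show "(lin1 n has_real_derivative lin1' n x) (at x)"
    unfolding lin1_def[abs_def] lin1'_def by (rule derivative_eq_intros refl)+ (simp add: algebra_simps)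
  show "(lin2 n has_real_derivative lin2' n x) (at x)"
    unfolding lin2_def[abs_def] lin2'_def by (rule derivative_eq_intros refl)+ (simp add: algebra_simps)
  note l2 = this
  show "(lin3 n has_real_derivative lin3' n x) (at x)"
    unfolding lin3_def[abs_def] lin3'_def by (rule derivative_eq_intros l2 refl)+ (simp add: algebra_simps)
qed

definition rate :: "real \<Rightarrow> real \<Rightarrow> real" where "rate n x = (n + 2) * (1 + x)^2"

lemma rate_deriv:
  assumes "n > 0" "x > 0" "(L has_real_derivative L') (at x)"
  shows "((\<lambda>x. L x / rate n x) has_real_derivative (L' * (1 + x) - 2 * L x) / ((n + 2) * (1 + x) ^ 3)) (at x)"
proof -
  have r: "(rate n has_real_derivative (n + 2) * (2 * (1 + x))) (at x)"
    unfolding rate_def[abs_def] by (auto intro!: derivative_eq_intros)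
  have r0: "rate n x \<noteq> 0" using assms by (simp add: rate_def)
  define c where "c = 1 + x"
  have c: "c > 0" using assms by (simp add: c_def)
  have "(L' * rate n x - L x * ((n + 2) * (2 * (1 + x)))) / (rate n x * rate n x)
     = (L' * (1 + x) - 2 * L x) / ((n + 2) * (1 + x) ^ 3)"
    unfolding rate_def c_def[symmetric] using assms(1) c
    by (simp add: divide_simps power2_eq_square power3_eq_cube) (simp add: algebra_simps)
  then show ?thesis using DERIV_divide[OF assms(3) r r0] by simp
qed

context qh_polar_point
begin

definition X :: "real \<Rightarrow> real" where "X \<tau> = (sinh (rho \<tau>))^2"

definition growth :: "real \<Rightarrow> real" where
  "growth x = 2 * x * (real N * x + real N + 2) / ((real N + 2) * (1 + x))"

lemma X_pos: "X \<tau> > 0" using rho_pos[of \<tau>] by (simp add: X_def)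

lemma cosh_X: "(cosh (rho \<tau>))^2 = 1 + X \<tau>" by (simp add: X_def cosh_square_eq)

lemma vol_over_area:
  assumes "s > 0"
  shows "vol N s / area N s = sinh s * (1 + real N * (sinh s)^2 / (real N + 2)) / cosh s ^ 3"
proof -
  have "sinh s ^ N = sinh s ^ (N - 1) * sinh s" using N_pos by (metis power_minus_mult)
  then show ?thesis unfolding vol_def area_def using assms by (simp add: less_imp_neq[symmetric])
qed

text \<open>
  The velocity of the radius is \<open>vol / area\<close>, which makes the equation for \<open>X = sinh\<^sup>2 rho\<close> autonomous and rational.
\<close>
lemma X_deriv: "(X has_real_derivative growth (X \<tau>)) (at \<tau>)"
proof -
  have "(X has_real_derivative 2 * sinh (rho \<tau>) * (cosh (rho \<tau>) * (vol N (rho \<tau>) / area N (rho \<tau>)))) (at \<tau>)"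
    unfolding X_def[abs_def] by (auto intro!: derivative_eq_intros rho_deriv)
  moreover have "2 * sinh (rho \<tau>) * (cosh (rho \<tau>) * (vol N (rho \<tau>) / area N (rho \<tau>))) =
     2 * X \<tau> * (1 + real N * X \<tau> / (real N + 2)) / (cosh (rho \<tau>))^2"
    unfolding vol_over_area[OF rho_pos] X_def
    by (simp add: power2_eq_square power3_eq_cube)
  moreover have "2 * X \<tau> * (1 + real N * X \<tau> / (real N + 2)) / (cosh (rho \<tau>))^2 = growth (X \<tau>)"
    unfolding cosh_X growth_def using X_pos[of \<tau>] by (simp add: field_simps)
  ultimately show ?thesis by simp
qed

definition f1 :: "real \<Rightarrow> real" where "f1 \<tau> = (area N (rho \<tau>) / area N r)^2"
definition f2 :: "real \<Rightarrow> real" where "f2 \<tau> = (exp (real N * \<tau>))^2 * ((sinh r)^2 / (sinh (rho \<tau>))^2)"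
definition f3 :: "real \<Rightarrow> real" where
  "f3 \<tau> = (exp (real N * \<tau>))^2 * ((sinh r)^2 * (cosh r)^2 / ((sinh (rho \<tau>))^2 * (cosh (rho \<tau>))^2))"

lemma f_0: "f1 0 = 1" "f2 0 = 1" "f3 0 = 1"
  using r_pos area_pos[OF r_pos, of N] by (simp_all add: f1_def f2_def f3_def rho_0)

lemma growth_quotients:
  "growth (X \<tau>) / X \<tau> = 2 * (real N * X \<tau> + real N + 2) * (1 + X \<tau>) / rate N (X \<tau>)"
  "growth (X \<tau>) / (1 + X \<tau>) = 2 * X \<tau> * (real N * X \<tau> + real N + 2) / rate N (X \<tau>)"
proof -
  have "X \<tau> \<noteq> 0" "1 + X \<tau> \<noteq> 0" using X_pos[of \<tau>] by simp_all
  then show "growth (X \<tau>) / X \<tau> = 2 * (real N * X \<tau> + real N + 2) * (1 + X \<tau>) / rate N (X \<tau>)"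
    "growth (X \<tau>) / (1 + X \<tau>) = 2 * X \<tau> * (real N * X \<tau> + real N + 2) / rate N (X \<tau>)"
    by (simp_all add: growth_def rate_def power2_eq_square mult_ac)
qed

lemma f1_deriv: "(f1 has_real_derivative lin1 N (X \<tau>) / rate N (X \<tau>) * f1 \<tau>) (at \<tau>)"
proof -
  define k where "k = N - 1"
  have k: "real k = real N - 1" using N_pos by (simp add: k_def of_nat_diff Suc_leI)
  have f: "f1 = (\<lambda>\<tau>. X \<tau> ^ k * (1 + X \<tau>) ^ 3 / (area N r)^2)"
  proof
    fix \<tau>
    have "(area N (rho \<tau>))^2 = ((sinh (rho \<tau>))^2) ^ k * ((cosh (rho \<tau>))^2) ^ 3"
      by (simp add: area_def k_def power_mult_distrib power_mult[symmetric] mult.commute)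
    then show "f1 \<tau> = X \<tau> ^ k * (1 + X \<tau>) ^ 3 / (area N r)^2"
      unfolding cosh_X by (simp add: f1_def X_def[symmetric] power_divide)
  qed
  have p: "X \<tau> \<noteq> 0" "1 + X \<tau> \<noteq> 0" using X_pos[of \<tau>] by simp_all
  have dk: "((\<lambda>\<tau>. X \<tau> ^ k) has_real_derivative real k * (growth (X \<tau>) / X \<tau>) * X \<tau> ^ k) (at \<tau>)"
    by (rule DERIV_cong[OF DERIV_power[OF X_deriv]]) (cases k; use p in simp)
  have d3: "((\<lambda>\<tau>. (1 + X \<tau>) ^ 3) has_real_derivative 3 * (growth (X \<tau>) / (1 + X \<tau>)) * (1 + X \<tau>) ^ 3) (at \<tau>)"
    using p by (auto intro!: derivative_eq_intros X_deriv simp: power2_eq_square power3_eq_cube)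
  have "(f1 has_real_derivative (real k * (growth (X \<tau>) / X \<tau>) + 3 * (growth (X \<tau>) / (1 + X \<tau>))) * f1 \<tau>) (at \<tau>)"
  proof -
    have "(a * x * y + b * y * x) / c = (a + b) * (x * y / c)" for a b c x y :: real
      by (simp add: algebra_simps)
    then show ?thesis
      unfolding f by (intro DERIV_cong[OF DERIV_cdivide[OF DERIV_mult[OF dk d3]]]) (simp only:)
  qed
  also have "real k * (growth (X \<tau>) / X \<tau>) + 3 * (growth (X \<tau>) / (1 + X \<tau>)) = lin1 N (X \<tau>) / rate N (X \<tau>)"
    unfolding growth_quotients k lin1_def times_divide_eq_right add_divide_distrib[symmetric] by (simp add: algebra_simps)
  finally show ?thesis .
qed

lemma exp_sq_deriv: "((\<lambda>\<tau>. (exp (real N * \<tau>))^2) has_real_derivative 2 * real N * (exp (real N * \<tau>))^2) (at \<tau>)"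
  by (auto intro!: derivative_eq_intros simp: power2_eq_square)

lemma lin2_rate: "2 * real N - growth (X \<tau>) / X \<tau> = lin2 N (X \<tau>) / rate N (X \<tau>)"
proof -
  have "2 * real N = 2 * real N * (real N + 2) * (1 + X \<tau>)^2 / rate N (X \<tau>)"
  proof -
    have "1 + X \<tau> \<noteq> 0" "real N + 2 \<noteq> 0" using X_pos[of \<tau>] by simp_all
    then show ?thesis by (simp add: rate_def)
  qed
  then show ?thesis unfolding growth_quotients lin2_def by (simp add: diff_divide_distrib)
qed

lemma lin3_rate: "2 * real N - growth (X \<tau>) / X \<tau> - growth (X \<tau>) / (1 + X \<tau>) = lin3 N (X \<tau>) / rate N (X \<tau>)"
  unfolding lin2_rate unfolding growth_quotients lin3_def by (simp add: diff_divide_distrib)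

lemma lin_comb: "a * e * s + - g * s * e = (a - g) * (e * s)" for a e s g :: real
  by (simp add: algebra_simps)

lemma f2_deriv: "(f2 has_real_derivative lin2 N (X \<tau>) / rate N (X \<tau>) * f2 \<tau>) (at \<tau>)"
proof -
  have p: "X \<tau> \<noteq> 0" using X_pos[of \<tau>] by simp
  have f: "f2 = (\<lambda>\<tau>. (exp (real N * \<tau>))^2 * ((sinh r)^2 / X \<tau>))" by (simp add: fun_eq_iff f2_def X_def)
  have "((\<lambda>\<tau>. (sinh r)^2 / X \<tau>) has_real_derivative - (growth (X \<tau>) / X \<tau>) * ((sinh r)^2 / X \<tau>)) (at \<tau>)"
    using p by (auto intro!: derivative_eq_intros X_deriv)
  from DERIV_mult[OF exp_sq_deriv this]
  have "(f2 has_real_derivative (2 * real N - growth (X \<tau>) / X \<tau>) * f2 \<tau>) (at \<tau>)"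
    unfolding f by (rule DERIV_cong) (rule lin_comb)
  then show ?thesis unfolding lin2_rate .
qed

lemma f3_deriv: "(f3 has_real_derivative lin3 N (X \<tau>) / rate N (X \<tau>) * f3 \<tau>) (at \<tau>)"
proof -
  have p: "1 + X \<tau> \<noteq> 0" using X_pos[of \<tau>] by simp
  have f: "f3 = (\<lambda>\<tau>. f2 \<tau> * ((cosh r)^2 / (1 + X \<tau>)))"
    by (simp add: fun_eq_iff f2_def f3_def cosh_X mult.assoc)
  have "((\<lambda>\<tau>. (cosh r)^2 / (1 + X \<tau>)) has_real_derivative - (growth (X \<tau>) / (1 + X \<tau>)) * ((cosh r)^2 / (1 + X \<tau>))) (at \<tau>)"
    using p by (auto intro!: derivative_eq_intros X_deriv)
  from DERIV_mult[OF f2_deriv this]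
  have "(f3 has_real_derivative (lin2 N (X \<tau>) / rate N (X \<tau>) - growth (X \<tau>) / (1 + X \<tau>)) * f3 \<tau>) (at \<tau>)"
    unfolding f by (rule DERIV_cong) (rule lin_comb)
  then show ?thesis unfolding lin2_rate[symmetric] lin3_rate .
qed

text \<open>
  The second derivative at \<open>0\<close> of a function with value \<open>1\<close> there and logarithmic derivative \<open>L / rate\<close> along \<open>X\<close>.
\<close>
definition second :: "(real \<Rightarrow> real) \<Rightarrow> real \<Rightarrow> real \<Rightarrow> real" where
  "second L L' x = (L' * (1 + x) - 2 * L x) / ((real N + 2) * (1 + x) ^ 3) * growth x + (L x / rate N x)^2"

lemma f_second_derivs:
  "((\<lambda>\<tau>. lin1 N (X \<tau>) / rate N (X \<tau>) * f1 \<tau>) has_real_derivative second (lin1 N) (lin1' N (X 0)) (X 0)) (at 0)"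
  "((\<lambda>\<tau>. lin2 N (X \<tau>) / rate N (X \<tau>) * f2 \<tau>) has_real_derivative second (lin2 N) (lin2' N (X 0)) (X 0)) (at 0)"
  "((\<lambda>\<tau>. lin3 N (X \<tau>) / rate N (X \<tau>) * f3 \<tau>) has_real_derivative second (lin3 N) (lin3' N (X 0)) (X 0)) (at 0)"
  unfolding second_def
  by (rule logarithmic_second_deriv[where X = X and l = "\<lambda>x. lin1 N x / rate N x", OF X_deriv rate_deriv[OF _ X_pos lin_derivs(1)] f1_deriv f_0(1)], simp)
     (rule logarithmic_second_deriv[where X = X and l = "\<lambda>x. lin2 N x / rate N x", OF X_deriv rate_deriv[OF _ X_pos lin_derivs(2)] f2_deriv f_0(2)], simp,
      rule logarithmic_second_deriv[where X = X and l = "\<lambda>x. lin3 N x / rate N x", OF X_deriv rate_deriv[OF _ X_pos lin_derivs(3)] f3_deriv f_0(3)], simp)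

end

section \<open>The polynomial\<close>

text \<open>
  The numerator of \<open>second\<close> over the denominator \<open>(n + 2)\<^sup>2 (1 + x)\<^sup>4\<close>.
\<close>
definition sq_coeff :: "real \<Rightarrow> real \<Rightarrow> real \<Rightarrow> real \<Rightarrow> real" where
  "sq_coeff n x L L' = L^2 + 2 * x * (n * x + n + 2) * (L' * (1 + x) - 2 * L)"

text \<open>
  The coefficients, with respect to \<open>\<delta>\<close>, \<open>\<beta>\<close>, \<open>\<gamma>\<close>, of the homogenized trace: \<open>c1\<close>, \<open>c2\<close>, \<open>c3\<close> collect the terms linear
  in these variables, which get multiplied by \<open>\<delta> + \<beta> + \<gamma> = 1\<close>.
\<close>
lemma coefficient_identities:
  fixes n x :: real
  defines "w \<equiv> n * x + n + 2"
  defines "L1 \<equiv> lin1 n x" and "L2 \<equiv> lin2 n x" and "L3 \<equiv> lin3 n x"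
  defines "c1 \<equiv> sq_coeff n x L1 (lin1' n x) / 2 + w^2 * ((n - 4) * (1 + x) + 3) - n / 2 * ((n + 2) * (1 + x)^2) * L1"
    and "c2 \<equiv> sq_coeff n x L2 (lin2' n x) / 2 - n / 2 * ((n + 2) * (1 + x)^2) * L2"
    and "c3 \<equiv> sq_coeff n x L3 (lin3' n x) / 2 - n / 2 * ((n + 2) * (1 + x)^2) * L3"
  shows "c1 - L1^2 / 4 = 0"
    and "c2 - L2^2 / 4 = - A20 n x"
    and "c3 - L3^2 / 4 = - A02 n x"
    and "c2 + c3 - L2 * L3 / 2 = - A11 n x"
    and "c1 + c2 - L1 * L2 / 2 - w^2 * (1 + x) = - A10 n x"
    and "c1 + c3 - L1 * L3 / 2 - w^2 = - A01 n x"
  unfolding c1_def c2_def c3_def L1_def L2_def L3_def w_def sq_coeff_def lin3_def lin3'_def lin1_def lin2_def lin1'_def lin2'_def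
    A20_def A11_def A02_def A10_def A01_def
  by (simp_all add: field_simps power2_eq_square power3_eq_cube power4_eq_xxxx)

lemma trace_polynomial:
  fixes n x \<beta> \<gamma> :: real
  assumes n: "n > 0" and x: "x > 0"
  defines "\<delta> \<equiv> 1 - \<beta> - \<gamma>" and "w \<equiv> n * x + n + 2" and "R \<equiv> (n + 2)^2 * (1 + x) ^ 4"
  defines "L1 \<equiv> lin1 n x" and "L2 \<equiv> lin2 n x" and "L3 \<equiv> lin3 n x"
  defines "D1 \<equiv> sq_coeff n x L1 (lin1' n x)" and "D2 \<equiv> sq_coeff n x L2 (lin2' n x)" and "D3 \<equiv> sq_coeff n x L3 (lin3' n x)"
  shows "(\<delta> * (D1 / R) + \<beta> * (D2 / R) + \<gamma> * (D3 / R)) / 2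
      - (\<delta> * (L1 / rate n x) + \<beta> * (L2 / rate n x) + \<gamma> * (L3 / rate n x))^2 / 4
      + \<delta> * (w^2 / ((n + 2)^2 * (1 + x)^2)) * ((n - 4) / (1 + x) + 3 / (1 + x)^2 - \<beta> / (1 + x) - \<gamma> / (1 + x)^2)
      - n / 2 * (\<delta> * (L1 / rate n x) + \<beta> * (L2 / rate n x) + \<gamma> * (L3 / rate n x))
    = - P_H n x \<beta> \<gamma> / R"
proof -
  define c where "c = 1 + x"
  define m where "m = n + 2"
  have c: "c > 0" "m > 0" using n x by (simp_all add: c_def m_def)
  define \<Lambda> where "\<Lambda> = \<delta> * L1 + \<beta> * L2 + \<gamma> * L3"
  have r: "rate n x = m * c^2" "R = m^2 * c ^ 4" by (simp_all add: rate_def c_def m_def R_def)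
  have R0: "R \<noteq> 0" "m * c^2 \<noteq> 0" using c by (simp_all add: r)
  have RR: "(m * c^2) * (m * c^2) = R" by (simp add: r power2_eq_square power4_eq_xxxx)
  have 1: "\<delta> * (L1 / rate n x) + \<beta> * (L2 / rate n x) + \<gamma> * (L3 / rate n x) = \<Lambda> / (m * c^2)"
    by (simp add: r \<Lambda>_def add_divide_distrib)
  have 2: "(\<Lambda> / (m * c^2))^2 = \<Lambda>^2 / R" by (simp add: power2_eq_square RR[symmetric])
  have 3: "\<Lambda> / (m * c^2) = (m * c^2) * \<Lambda> / R" unfolding RR[symmetric] using R0 by simp
  have 4: "\<delta> * (w^2 / (m^2 * c^2)) * ((n - 4) / c + 3 / c^2 - \<beta> / c - \<gamma> / c^2)
      = \<delta> * w^2 * ((n - 4) * c + 3 - \<beta> * c - \<gamma>) / R"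
  proof -
    have "(n - 4) / c + 3 / c^2 - \<beta> / c - \<gamma> / c^2 = ((n - 4) * c + 3 - \<beta> * c - \<gamma>) / c^2"
      using c by (simp add: field_simps power2_eq_square)
    moreover have "R = (m^2 * c^2) * c^2" by (simp add: r power2_eq_square power4_eq_xxxx)
    ultimately show ?thesis by simp
  qed
  define c1 c2 c3 where "c1 = D1 / 2 + w^2 * ((n - 4) * c + 3) - n / 2 * (m * c^2) * L1"
    and "c2 = D2 / 2 - n / 2 * (m * c^2) * L2" and "c3 = D3 / 2 - n / 2 * (m * c^2) * L3"
  have id: "c1 - L1^2 / 4 = 0" "c2 - L2^2 / 4 = - A20 n x" "c3 - L3^2 / 4 = - A02 n x"
    "c2 + c3 - L2 * L3 / 2 = - A11 n x" "c1 + c2 - L1 * L2 / 2 - w^2 * c = - A10 n x"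
    "c1 + c3 - L1 * L3 / 2 - w^2 = - A01 n x"
    unfolding c1_def c2_def c3_def c_def m_def D1_def D2_def D3_def w_def L1_def L2_def L3_def
    by (rule coefficient_identities)+
  \<comment> \<open>the linear terms are multiplied by this to become quadratic\<close>
  have one: "\<delta> + \<beta> + \<gamma> = 1" by (simp add: \<delta>_def)
  have "(\<delta> * (D1 / R) + \<beta> * (D2 / R) + \<gamma> * (D3 / R)) / 2 - \<Lambda>^2 / R / 4
      + \<delta> * w^2 * ((n - 4) * c + 3 - \<beta> * c - \<gamma>) / R - n / 2 * ((m * c^2) * \<Lambda> / R)
     = ((\<delta> * D1 + \<beta> * D2 + \<gamma> * D3) / 2 - \<Lambda>^2 / 4 + \<delta> * w^2 * ((n - 4) * c + 3 - \<beta> * c - \<gamma>) - n / 2 * ((m * c^2) * \<Lambda>)) / R"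
    by (simp add: add_divide_distrib diff_divide_distrib)
  also have "(\<delta> * D1 + \<beta> * D2 + \<gamma> * D3) / 2 - \<Lambda>^2 / 4 + \<delta> * w^2 * ((n - 4) * c + 3 - \<beta> * c - \<gamma>) - n / 2 * ((m * c^2) * \<Lambda>)
    = (c1 * \<delta> + c2 * \<beta> + c3 * \<gamma>) - \<Lambda>^2 / 4 - w^2 * c * (\<delta> * \<beta>) - w^2 * (\<delta> * \<gamma>)"
    by (simp add: c1_def c2_def c3_def \<Lambda>_def algebra_simps)
  also have "c1 * \<delta> + c2 * \<beta> + c3 * \<gamma> = (c1 * \<delta> + c2 * \<beta> + c3 * \<gamma>) * (\<delta> + \<beta> + \<gamma>)" by (simp add: one)
  also have "(c1 * \<delta> + c2 * \<beta> + c3 * \<gamma>) * (\<delta> + \<beta> + \<gamma>) - \<Lambda>^2 / 4 - w^2 * c * (\<delta> * \<beta>) - w^2 * (\<delta> * \<gamma>)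
     = (c1 - L1^2 / 4) * \<delta>^2 + (c2 - L2^2 / 4) * \<beta>^2 + (c3 - L3^2 / 4) * \<gamma>^2 + (c2 + c3 - L2 * L3 / 2) * \<beta> * \<gamma>
      + (c1 + c2 - L1 * L2 / 2 - w^2 * c) * \<beta> * \<delta> + (c1 + c3 - L1 * L3 / 2 - w^2) * \<gamma> * \<delta>"
    by (simp add: \<Lambda>_def algebra_simps power2_eq_square)
  also have "\<dots> = - P_H n x \<beta> \<gamma>"
    unfolding id P_H_def Let_def \<delta>_def[symmetric] by (simp add: algebra_simps)
  finally show ?thesis
    unfolding 1 2 c_def[symmetric] m_def[symmetric] 4 unfolding 3 by simp
qed

text \<open>
  For \<open>n \<ge> 4\<close> all coefficients of the polynomials in \<open>x\<close> are nonnegative. The bounds on \<open>n\<^sup>2\<close> and \<open>n\<^sup>3\<close> make this linear.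
\<close>
lemma coefficients_pos:
  fixes n x :: real
  assumes n: "n \<ge> 4" and x: "x > 0"
  shows "A20 n x > 0" "A11 n x > 0" "A02 n x > 0" "A10 n x > 0" "A01 n x > 0"
proof -
  have n2: "n^2 \<ge> 4 * n" using n by (simp add: power2_eq_square)
  have n3: "n ^ 3 \<ge> 4 * n^2" using n by (simp add: power2_eq_square power3_eq_cube mult_right_mono)
  have w: "n * x + n + 2 > 0" using n x by (simp add: add_pos_pos)
  have "0 \<le> (n^2 + n) * x^2" "0 \<le> (2 * (n^2 + n) - 6) * x" using n n2 x by simp_all
  moreover have "(n^2 + n) * (1 + x)^2 - 6 * x - 2 = (n^2 + n) * x^2 + (2 * (n^2 + n) - 6) * x + (n^2 + n - 2)"
    by (simp add: power2_eq_square algebra_simps)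
  ultimately have "(n^2 + n) * (1 + x)^2 - 6 * x - 2 > 0"
    using n n2 by linarith
  then show "A20 n x > 0" unfolding A20_def using w x by simp
  have "0 \<le> 3 * n^2 * x ^ 3" "0 \<le> (8 * n^2 + 6 * n - 24) * x^2" "0 \<le> (7 * n^2 + 8 * n - 16) * x"
    using n n2 x by simp_all
  then have "3*n^2 * x^3 + (8*n^2 + 6*n - 24) * x^2 + (7*n^2 + 8*n - 16) * x + 2*n^2 + 2*n - 4 > 0"
    using n n2 by linarith
  then show "A11 n x > 0" unfolding A11_def using w by simp
  have "0 \<le> 2 * n^2 * x ^ 3" "0 \<le> (5 * n^2 + 4 * n - 16) * x^2" "0 \<le> (4 * n^2 + 5 * n - 8) * x"
    using n n2 x by simp_all
  then have "2*n^2 * x^3 + (5*n^2 + 4*n - 16) * x^2 + (4*n^2 + 5*n - 8) * x + n^2 + n - 2 > 0"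
    using n n2 by linarith
  then show "A02 n x > 0" unfolding A02_def using w by simp
  have "0 \<le> n ^ 3 * x ^ 4" "0 \<le> (4*n^3 + 5*n^2 - 16*n) * x^3" "0 \<le> (6*n^3 + 14*n^2 - 16*n - 48) * x^2"
    "0 \<le> (4*n^3 + 13*n^2 + 4*n - 12) * x"
    using n n2 n3 x by simp_all
  then show "A10 n x > 0" unfolding A10_def using n n2 n3 by linarith
  have "0 \<le> (2*n^3 - 4*n^2) * x ^ 4" "0 \<le> (7*n^3 - 48*n) * x^3" "0 \<le> (9*n^3 + 16*n^2 - 48*n - 96) * x^2"
    "0 \<le> (5*n^3 + 16*n^2 + 4*n - 16) * x"
    using n n2 n3 x by simp_all
  then show "A01 n x > 0" unfolding A01_def using n n2 n3 by linarith
qed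

lemma P_H_nonneg:
  fixes n x \<beta> \<gamma> :: real
  assumes n: "n \<ge> 4" and x: "x > 0" and \<beta>: "\<beta> \<ge> 0" and \<gamma>: "\<gamma> \<ge> 0" and \<delta>: "1 - \<beta> - \<gamma> \<ge> 0"
  shows "P_H n x \<beta> \<gamma> \<ge> 0" "P_H n x \<beta> \<gamma> = 0 \<longleftrightarrow> \<beta> = 0 \<and> \<gamma> = 0"
proof -
  note A = coefficients_pos[OF n x]
  have t: "0 \<le> A20 n x * \<beta>^2" "0 \<le> A11 n x * \<beta> * \<gamma>" "0 \<le> A02 n x * \<gamma>^2"
    "0 \<le> A10 n x * \<beta> * (1 - \<beta> - \<gamma>)" "0 \<le> A01 n x * \<gamma> * (1 - \<beta> - \<gamma>)"
    using A \<beta> \<gamma> \<delta> by (simp_all add: mult_nonneg_nonneg less_imp_le)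
  then show "P_H n x \<beta> \<gamma> \<ge> 0" unfolding P_H_def Let_def by linarith
  show "P_H n x \<beta> \<gamma> = 0 \<longleftrightarrow> \<beta> = 0 \<and> \<gamma> = 0"
  proof
    assume "P_H n x \<beta> \<gamma> = 0"
    then have "A20 n x * \<beta>^2 = 0" "A02 n x * \<gamma>^2 = 0" using t unfolding P_H_def Let_def by linarith+
    then show "\<beta> = 0 \<and> \<gamma> = 0" using A by simp
  qed (simp add: P_H_def)
qed

section \<open>The trace defect\<close>

context qh_polar_point
begin

text \<open>
  The factor in front of the spherical gradient: volume radius over its radial derivative, divided by the
  Euclidean radius \<open>tanh r\<close> of the sphere in the recentred ball.
\<close>
definition reach :: real where "reach = vol N r / (area N r * tanh r)"

text \<open>
  The square of the Jacobian is a sum of three products of a function of \<open>t \<phi>\<close> and a quadratic polynomial in \<open>t\<close>.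
\<close>
lemma jacobian_derivs:
  fixes e U V \<nu> :: "real^('m \<times> 4)" and \<alpha> c :: real
  assumes U: "H \<theta> U = 0" and V: "\<theta> \<star> H \<theta> V = V" "G \<theta> V = 0"
    and \<nu>: "\<nu> = recentre_deriv z ((\<alpha> * (1 - (tanh r)^2)) *\<^sub>R \<theta> + U + V)"
  defines "\<sigma> \<equiv> 1 - (tanh r)^2"
  defines "\<beta> \<equiv> G U U / \<sigma>" and "\<gamma> \<equiv> G V V / \<sigma>^2" and "\<phi> \<equiv> G \<theta> e + c" and "x \<equiv> X 0"
  assumes unit_normal: "\<alpha>^2 + \<beta> + \<gamma> = 1"
  defines "\<Lambda> \<equiv> \<alpha>^2 * (lin1 N x / rate N x) + \<beta> * (lin2 N x / rate N x) + \<gamma> * (lin3 N x / rate N x)"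
    and "\<Delta> \<equiv> \<alpha>^2 * second (lin1 N) (lin1' N x) x + \<beta> * second (lin2 N) (lin2' N x) x + \<gamma> * second (lin3 N) (lin3' N x) x"
  shows "deriv (\<lambda>t. hyperplane_jacobian p (recentre z) \<nu> t (\<lambda>\<theta>. G \<theta> e + c)) 0
      = (\<phi> * \<Lambda> - 2 * \<alpha> * reach * (G U e + G V e)) / 2" (is ?first)
    and "deriv (deriv (\<lambda>t. hyperplane_jacobian p (recentre z) \<nu> t (\<lambda>\<theta>. G \<theta> e + c))) 0
      = (\<phi>^2 * \<Delta> - 4 * \<alpha> * reach * \<phi> * (lin2 N x / rate N x * G U e + lin3 N x / rate N x * G V e)
          + 2 * \<alpha>^2 * reach^2 * (\<sigma> * G (tang_H e) (tang_H e) + \<sigma>^2 * G (tang_V e) (tang_V e))) / 2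
        - (\<phi> * \<Lambda> - 2 * \<alpha> * reach * (G U e + G V e))^2 / 4" (is ?second)
proof -
  define l1 l2 l3 where l: "l1 = lin1 N x / rate N x" "l2 = lin2 N x / rate N x" "l3 = lin3 N x / rate N x"
  define d1 d2 d3 where d: "d1 = second (lin1 N) (lin1' N x) x" "d2 = second (lin2 N) (lin2' N x) x" "d3 = second (lin3 N) (lin3' N x) x"
  define g1 g2 g3 where g: "g1 = (\<lambda>\<tau>. lin1 N (X \<tau>) / rate N (X \<tau>) * f1 \<tau>)"
    "g2 = (\<lambda>\<tau>. lin2 N (X \<tau>) / rate N (X \<tau>) * f2 \<tau>)" "g3 = (\<lambda>\<tau>. lin3 N (X \<tau>) / rate N (X \<tau>) * f3 \<tau>)"
  have g0: "g1 0 = l1" "g2 0 = l2" "g3 0 = l3" by (simp_all add: g l f_0 x_def)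
  have gd: "(g1 has_real_derivative d1) (at 0)" "(g2 has_real_derivative d2) (at 0)" "(g3 has_real_derivative d3) (at 0)"
    unfolding g d x_def by (rule f_second_derivs)+
  have fd: "(f1 has_real_derivative g1 \<tau>) (at \<tau>)" "(f2 has_real_derivative g2 \<tau>) (at \<tau>)" "(f3 has_real_derivative g3 \<tau>) (at \<tau>)" for \<tau>
    unfolding g by (rule f1_deriv f2_deriv f3_deriv)+
  define a2 b1 b2 k1 k2 where ab: "a2 = \<alpha>^2" "b1 = - 2 * \<alpha> * reach * G U e" "b2 = - 2 * \<alpha> * reach * G V e"
    "k1 = \<alpha>^2 * reach^2 * \<sigma> * G (tang_H e) (tang_H e)" "k2 = \<alpha>^2 * reach^2 * \<sigma>^2 * G (tang_V e) (tang_V e)"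
  define Q where "Q t = f1 (t * \<phi>) * a2 + f2 (t * \<phi>) * (\<beta> + b1 * t + k1 * t^2) + f3 (t * \<phi>) * (\<gamma> + b2 * t + k2 * t^2)" for t
  have J: "hyperplane_jacobian p (recentre z) \<nu> t (\<lambda>\<theta>. G \<theta> e + c) = sqrt (Q t)" for t
  proof -
    have "\<beta> + b1 * t + k1 * t^2 = G U U / \<sigma> - 2 * \<alpha> * t * reach * G U e + \<alpha>^2 * t^2 * reach^2 * \<sigma> * G (tang_H e) (tang_H e)"
      "\<gamma> + b2 * t + k2 * t^2 = G V V / \<sigma>^2 - 2 * \<alpha> * t * reach * G V e + \<alpha>^2 * t^2 * reach^2 * \<sigma>^2 * G (tang_V e) (tang_V e)"
      unfolding ab \<beta>_def \<gamma>_def by (simp_all add: mult_ac)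
    then show ?thesis
      unfolding hyperplane_jacobian_eq[OF U V \<nu>] conormal_norm[OF U V] Q_def ab(1)
        f1_def[symmetric] f2_def[symmetric] f3_def[symmetric] reach_def[symmetric] \<sigma>_def[symmetric] \<phi>_def[symmetric]
      by (simp only: mult.commute[of "\<alpha>^2"])
  qed
  define Q1 where "Q1 t = (\<phi> * g1 (t * \<phi>) * a2 + f1 (t * \<phi>) * 0)
      + (\<phi> * g2 (t * \<phi>) * (\<beta> + b1 * t + k1 * t^2) + f2 (t * \<phi>) * (b1 + 2 * k1 * t))
      + (\<phi> * g3 (t * \<phi>) * (\<gamma> + b2 * t + k2 * t^2) + f3 (t * \<phi>) * (b2 + 2 * k2 * t))" for t
  have pol: "((\<lambda>t. a + b * t + k * t^2) has_real_derivative b + 2 * k * t) (at t)"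
    "((\<lambda>t. b + 2 * k * t) has_real_derivative 2 * k) (at 0)" for a b k t :: real
    by (auto intro!: derivative_eq_intros)
  have const: "((\<lambda>t. a2) has_real_derivative 0) (at t)" "((\<lambda>t. 0) has_real_derivative 0) (at (0 :: real))" for t by simp_all
  have Qd: "(Q has_real_derivative Q1 t) (at t)" for t
    unfolding Q_def Q1_def
    by (intro DERIV_add product_derivs(1)[OF fd(1) gd(1) const] product_derivs(1)[OF fd(2) gd(2) pol]
        product_derivs(1)[OF fd(3) gd(3) pol])
  have Q1d: "(Q1 has_real_derivative
      (\<phi>^2 * d1 * a2 + 2 * \<phi> * g1 0 * 0 + f1 0 * 0)
    + (\<phi>^2 * d2 * (\<beta> + b1 * 0 + k1 * 0^2) + 2 * \<phi> * g2 0 * (b1 + 2 * k1 * 0) + f2 0 * (2 * k1))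
    + (\<phi>^2 * d3 * (\<gamma> + b2 * 0 + k2 * 0^2) + 2 * \<phi> * g3 0 * (b2 + 2 * k2 * 0) + f3 0 * (2 * k2))) (at 0)"
    unfolding Q1_def
    by (intro DERIV_add product_derivs(2)[OF fd(1) gd(1) const] product_derivs(2)[OF fd(2) gd(2) pol]
        product_derivs(2)[OF fd(3) gd(3) pol])
  have Q0: "Q 0 = 1" using unit_normal by (simp add: Q_def f_0 ab(1))
  have Q10: "Q1 0 = \<phi> * \<Lambda> - 2 * \<alpha> * reach * (G U e + G V e)"
    unfolding Q1_def \<Lambda>_def l[symmetric] by (simp add: g0 f_0 ab algebra_simps)
  note res = sqrt_derivs[OF Qd Q1d Q0]
  show ?first unfolding J res(1) Q10 ..
  show ?second
    unfolding J res(2) Q10 \<Delta>_def l[symmetric] d[symmetric] by (simp add: g0 f_0 ab algebra_simps)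
qed

lemma x_facts: "X 0 = (sinh r)^2" "1 - (tanh r)^2 = 1 / (1 + X 0)"
  "reach^2 = (real N * X 0 + real N + 2)^2 / ((real N + 2)^2 * (1 + X 0)^2)"
proof -
  show X: "X 0 = (sinh r)^2" by (simp add: X_def rho_0)
  have C: "(cosh r)^2 = 1 + X 0" by (simp add: X cosh_square_eq)
  have pos: "sinh r > 0" "cosh r > 0" using r_pos by simp_all
  show "1 - (tanh r)^2 = 1 / (1 + X 0)"
  proof -
    have "1 + (sinh r)^2 \<noteq> 0" using zero_le_power2[of "sinh r"] by linarith
    then show ?thesis by (simp add: tanh_def power_divide C X field_simps)
  qed
  have "reach = (1 + real N * (sinh r)^2 / (real N + 2)) / (cosh r)^2"
  proof -
    have "reach = vol N r / area N r / tanh r" by (simp add: reach_def)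
    then show ?thesis
      unfolding vol_over_area[OF r_pos] using pos by (simp add: tanh_def power2_eq_square power3_eq_cube)
  qed
  also have "1 + real N * (sinh r)^2 / (real N + 2) = (real N * X 0 + real N + 2) / (real N + 2)"
    by (simp add: X field_simps)
  finally show "reach^2 = (real N * X 0 + real N + 2)^2 / ((real N + 2)^2 * (1 + X 0)^2)"
    unfolding C by (simp add: power_divide power_mult_distrib)
qed

lemma second_eq:
  "second L L' (X 0) = sq_coeff N (X 0) (L (X 0)) L' / ((real N + 2)^2 * (1 + X 0) ^ 4)"
proof -
  define c m D where "c = 1 + X 0" and "m = real N + 2" and "D = L' * (1 + X 0) - 2 * L (X 0)"
  define w where "w = real N * X 0 + real N + 2"
  have pos: "c \<noteq> 0" "m \<noteq> 0" using X_pos[of 0] by (simp_all add: c_def m_def)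
  have "D / (m * c ^ 3) * (2 * X 0 * w / (m * c)) + (L (X 0) / (m * c^2))^2 = ((L (X 0))^2 + 2 * X 0 * w * D) / (m^2 * c ^ 4)"
    using pos by (simp add: divide_simps power2_eq_square power3_eq_cube power4_eq_xxxx)
  then show ?thesis
    unfolding second_def sq_coeff_def growth_def rate_def c_def m_def D_def w_def .
qed

text \<open>
  The second derivative is a quadratic form in the values \<open>G \<theta> (e j)\<close>, \<open>G U (e j)\<close>, \<open>G V (e j)\<close>. Summation over \<open>j\<close>
  replaces each product by an inner product of two of the mutually orthogonal vectors \<open>\<theta>\<close>, \<open>U\<close>, \<open>V\<close>, and
  the gradient terms by the dimensions of the eigenspaces.
\<close>
theorem trace_defect_eq:
  fixes e :: "nat \<Rightarrow> real^('m \<times> 4)" and U V \<nu> :: "real^('m \<times> 4)" and \<alpha> :: real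
  assumes basis: "qh_orthonormal_basis p e"
    and U: "H \<theta> U = 0" and V: "\<theta> \<star> H \<theta> V = V" "G \<theta> V = 0"
    and \<nu>: "\<nu> = recentre_deriv z ((\<alpha> * (1 - (tanh r)^2)) *\<^sub>R \<theta> + U + V)"
  defines "\<sigma> \<equiv> 1 - (tanh r)^2"
  defines "\<beta> \<equiv> G U U / \<sigma>" and "\<gamma> \<equiv> G V V / \<sigma>^2"
  assumes unit_normal: "\<alpha>^2 + \<beta> + \<gamma> = 1"
  shows "trace_defect p e (recentre z) \<nu> =
    - P_H (real N) ((sinh r)^2) \<beta> \<gamma> / ((real N + 2)^2 * (1 + (sinh r)^2) ^ 4)"
proof -
  define x where "x = X 0"
  define l2 l3 where l: "l2 = lin2 N x / rate N x" "l3 = lin3 N x / rate N x"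
  define \<Lambda> where "\<Lambda> = \<alpha>^2 * (lin1 N x / rate N x) + \<beta> * (lin2 N x / rate N x) + \<gamma> * (lin3 N x / rate N x)"
  define \<Delta> where "\<Delta> = \<alpha>^2 * second (lin1 N) (lin1' N x) x + \<beta> * second (lin2 N) (lin2' N x) x + \<gamma> * second (lin3 N) (lin3' N x) x"
  have \<sigma>: "\<sigma> > 0" using tanh_sq_less_1 by (simp add: \<sigma>_def)
  have un: "\<alpha>^2 + G U U / (1 - (tanh r)^2) + G V V / (1 - (tanh r)^2)^2 = 1"
    using unit_normal unfolding \<beta>_def \<gamma>_def \<sigma>_def .
  define q where "q = \<alpha> * reach"
  let ?\<phi> = "\<lambda>j. G \<theta> (e j)" and ?M = "\<lambda>j. G U (e j)" and ?P = "\<lambda>j. G V (e j)"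
  let ?mh = "\<lambda>j. G (tang_H (e j)) (tang_H (e j))" and ?mv = "\<lambda>j. G (tang_V (e j)) (tang_V (e j))"
  have second: "deriv (deriv (\<lambda>t. hyperplane_jacobian p (recentre z) \<nu> t (\<lambda>\<theta>. qh_metric p \<theta> (e j)))) 0
     = (\<Delta> / 2 - \<Lambda>^2 / 4) * (?\<phi> j * ?\<phi> j) + (q * \<Lambda> - 2 * q * l2) * (?\<phi> j * ?M j) + (q * \<Lambda> - 2 * q * l3) * (?\<phi> j * ?P j)
       - q^2 * (?M j * ?M j) - 2 * q^2 * (?M j * ?P j) - q^2 * (?P j * ?P j)
       + q^2 * \<sigma> * ?mh j + q^2 * \<sigma>^2 * ?mv j" for j
  proof -
    have "(f^2 * \<Delta> - 4 * \<alpha> * reach * f * (l2 * M + l3 * P) + 2 * \<alpha>^2 * reach^2 * (\<sigma> * mh + \<sigma>^2 * mv)) / 2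
        - (f * \<Lambda> - 2 * \<alpha> * reach * (M + P))^2 / 4
      = (\<Delta> / 2 - \<Lambda>^2 / 4) * (f * f) + (q * \<Lambda> - 2 * q * l2) * (f * M) + (q * \<Lambda> - 2 * q * l3) * (f * P)
       - q^2 * (M * M) - 2 * q^2 * (M * P) - q^2 * (P * P) + q^2 * \<sigma> * mh + q^2 * \<sigma>^2 * mv" for f M P mh mv
      by (simp add: q_def power2_eq_square field_simps)
    then show ?thesis
      using jacobian_derivs(2)[OF U V \<nu> un, of "e j" 0]
      unfolding qh_metric_p x_def[symmetric] \<sigma>_def[symmetric] add_0_right
      unfolding \<beta>_def[symmetric] \<gamma>_def[symmetric]
      unfolding \<Lambda>_def[symmetric] \<Delta>_def[symmetric]
      unfolding l[symmetric] by (simp only:)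
  qed
  \<comment> \<open>the constant function \<open>1\<close> corresponds to \<open>e = 0\<close> and \<open>c = 1\<close>\<close>
  have first: "deriv (\<lambda>t. hyperplane_jacobian p (recentre z) \<nu> t (\<lambda>\<theta>. 1)) 0 = \<Lambda> / 2"
    using jacobian_derivs(1)[OF U V \<nu> un, of 0 1]
    unfolding x_def[symmetric] \<beta>_def[symmetric] \<gamma>_def[symmetric] \<sigma>_def[symmetric] \<Lambda>_def[symmetric]
    by (simp add: zero_right)
  have GU: "G \<theta> U = 0" using U by simp
  have s: "(\<Sum>j = 1..N. ?\<phi> j * ?\<phi> j) = 1" "(\<Sum>j = 1..N. ?\<phi> j * ?M j) = 0" "(\<Sum>j = 1..N. ?\<phi> j * ?P j) = 0"
    "(\<Sum>j = 1..N. ?M j * ?M j) = \<beta> * \<sigma>" "(\<Sum>j = 1..N. ?M j * ?P j) = 0" "(\<Sum>j = 1..N. ?P j * ?P j) = \<gamma> * \<sigma>^2"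
    unfolding parseval[OF basis] unit GU V(2) G_orth[OF U V(1)] \<beta>_def \<gamma>_def using \<sigma> by simp_all
  have ee: "(\<Sum>j = 1..N. G (e j) (e j)) = real N"
  proof -
    have "G (e j) (e j) = 1" if "j \<in> {1..N}" for j
      using basis that unfolding qh_orthonormal_basis_def N_eq[symmetric] by (simp add: qh_metric_p)
    then show ?thesis by simp
  qed
  have h: "(\<Sum>j = 1..N. ?mh j) = real N - 4" "(\<Sum>j = 1..N. ?mv j) = 3"
    using s(1) unfolding G_tang_H G_tang_V sum_subtractf ee sum_norm_H[OF basis unit] power2_eq_square[of "G \<theta> _"] by simp_all
  have "trace_defect p e (recentre z) \<nu> =
      (\<Delta> / 2 - \<Lambda>^2 / 4) * 1 + (q * \<Lambda> - 2 * q * l2) * 0 + (q * \<Lambda> - 2 * q * l3) * 0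
       - q^2 * (\<beta> * \<sigma>) - 2 * q^2 * 0 - q^2 * (\<gamma> * \<sigma>^2) + q^2 * \<sigma> * (real N - 4) + q^2 * \<sigma>^2 * 3 - real N * (\<Lambda> / 2)"
    unfolding trace_defect_def N_eq[symmetric] second first sum.distrib sum_subtractf sum_distrib_left[symmetric] s h ..
  also have "\<dots> = \<Delta> / 2 - \<Lambda>^2 / 4 + \<alpha>^2 * reach^2 * ((real N - 4) * \<sigma> + 3 * \<sigma>^2 - \<beta> * \<sigma> - \<gamma> * \<sigma>^2) - real N / 2 * \<Lambda>"
    by (simp add: q_def power_mult_distrib algebra_simps)
  also have "\<dots> = - P_H (real N) x \<beta> \<gamma> / ((real N + 2)^2 * (1 + x) ^ 4)"
  proof -
    have a2: "\<alpha>^2 = 1 - \<beta> - \<gamma>" using unit_normal by simp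
    have \<sigma>x: "\<sigma> = 1 / (1 + x)" unfolding \<sigma>_def x_facts(2) x_def ..
    have \<sigma>: "(real N - 4) * \<sigma> + 3 * \<sigma>^2 - \<beta> * \<sigma> - \<gamma> * \<sigma>^2
        = (real N - 4) / (1 + x) + 3 / (1 + x)^2 - \<beta> / (1 + x) - \<gamma> / (1 + x)^2"
      unfolding \<sigma>x by (simp add: power_divide)
    have pos: "real N > 0" "x > 0" using N_pos X_pos[of 0] by (simp_all add: x_def)
    show ?thesis
      unfolding \<Delta>_def \<Lambda>_def second_eq[folded x_def] x_facts(3)[folded x_def] a2 \<sigma>
      by (rule trace_polynomial[OF pos])
  qed
  finally show ?thesis unfolding x_def x_facts(1) .
qed

end

theorem theorem2p10:
  fixes p y \<nu> v w \<theta> :: "real^('m::finite \<times> 4)"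
    and e :: "nat \<Rightarrow> real^('m \<times> 4)"
    and r x \<alpha> \<beta> \<gamma> \<delta> :: real
    and n :: nat
  assumes "n = 4 * CARD('m)"
    and "p \<in> qh_space"
    and "qh_orthonormal_basis p e"
    and "y \<in> qh_space - {p}"
    and "(r, \<theta>) = qh_polar p y"
    and "x = (sinh r)\<^sup>2"
    and "\<nu> = \<alpha> *\<^sub>R qh_radial p y + v + w"
    and "v \<in> qh_sub p (-1) y"
    and "w \<in> qh_sub p (-4) y"
    and "qh_metric y \<nu> \<nu> = 1"
    and "\<beta> = qh_metric y v v"
    and "\<gamma> = qh_metric y w w"
    and "\<delta> = 1 - \<beta> - \<gamma>"
  shows "\<delta> = \<alpha>\<^sup>2
    \<and> trace_defect p e y \<nu> = - P_H (real n) x \<beta> \<gamma> / ((real n + 2)\<^sup>2 * (1 + x) ^ 4)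
    \<and> trace_defect p e y \<nu> \<le> 0
    \<and> (trace_defect p e y \<nu> = 0 \<longleftrightarrow> \<beta> = 0 \<and> \<gamma> = 0)"
proof -
  interpret qh_point p by unfold_locales (rule assms(2))
  obtain r' \<theta>' where rt: "0 < r'" "G \<theta>' \<theta>' = 1" "y = recentre (tanh r' *\<^sub>R \<theta>')" "qh_polar p y = (r', \<theta>')"
    using polar_exists[OF assms(4)] by blast
  then have eq: "r' = r" "\<theta>' = \<theta>" using assms(5) by simp_all
  have r: "0 < r" and unit: "G \<theta> \<theta> = 1" and y: "y = recentre (tanh r *\<^sub>R \<theta>)" and pol: "qh_polar p y = (r, \<theta>)"
    using rt unfolding eq by simp_all
  have n: "n = CARD('m \<times> 4)" using assms(1) by simp
  interpret qh_polar_point p n \<theta> r by unfold_locales (fact n unit r)+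
  define \<sigma> where "\<sigma> = 1 - (tanh r)^2"
  have \<sigma>: "\<sigma> > 0" using tanh_sq_less_1 by (simp add: \<sigma>_def)
  have s1: "(tanh r)^2 < 1" by (rule tanh_sq_less_1)
  obtain U where U: "v = recentre_deriv z U" "H \<theta> U = 0"
    using sphere_subspace_minus_1[OF pol unit r assms(8)] by blast
  obtain V where V: "w = recentre_deriv z V" "G \<theta> V = 0" "\<theta> \<star> H \<theta> V = V"
    using sphere_subspace_minus_4[OF pol unit r assms(9)] by blast
  \<comment> \<open>pull \<open>\<nu>\<close> and its parts back to the recentred ball\<close>
  have rad: "qh_radial p y = recentre_deriv z (\<sigma> *\<^sub>R \<theta>)"
    unfolding \<sigma>_def by (rule radial_field_eq[OF pol unit r])
  have \<nu>: "\<nu> = recentre_deriv z ((\<alpha> * \<sigma>) *\<^sub>R \<theta> + U + V)"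
    unfolding assms(7) rad U(1) V(1)
    by (simp add: linear_add[OF linear_recentre_deriv] linear_scale[OF linear_recentre_deriv, symmetric])
  have iso: "qh_metric y (recentre_deriv z a) (recentre_deriv z b) = qre (ball_form H z a b)" for a b
    unfolding y by (rule recentre_isometry[OF z_props(4)])
  note parts = ball_form_radial_parts[OF s1 U(2) V(3), folded \<sigma>_def]
  have GU: "G U \<theta> = 0" using G_sym[of U \<theta>] U(2) by simp
  have GV: "G V \<theta> = 0" using G_sym[of V \<theta>] V(2) by simp
  have UV: "G U V = 0" by (rule G_orth[OF U(2) V(3)])
  have VU: "G V U = 0" using UV G_sym[of V U] by simp
  have U0: "H \<theta> 0 = 0" "\<theta> \<star> H \<theta> 0 = 0" by (simp_all add: zero_right)
  have \<beta>: "\<beta> = G U U / \<sigma>"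
    using ball_form_radial_parts[OF s1 U(2) U0(2), of U 0, folded \<sigma>_def]
    unfolding assms(11) U(1) iso by (simp add: zero_right)
  have \<gamma>: "\<gamma> = G V V / \<sigma>^2"
    using ball_form_radial_parts[OF s1 U0(1) V(3), of V 0, folded \<sigma>_def]
    unfolding assms(12) V(1) iso by (simp add: zero_right)
  have "1 = \<alpha>^2 + \<beta> + \<gamma>"
  proof -
    have "1 = qre (ball_form H z ((\<alpha> * \<sigma>) *\<^sub>R \<theta> + U + V) ((\<alpha> * \<sigma>) *\<^sub>R \<theta> + U + V))"
      using assms(10) unfolding \<nu> iso by simp
    also have "\<dots> = \<alpha> * \<sigma> * (\<alpha> * \<sigma>) / \<sigma>^2 + G U U / \<sigma> + G V V / \<sigma>^2"
      unfolding parts using unit GU GV UV VU U(2) V(2) by (simp add: form_simps)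
    finally show ?thesis using \<sigma> by (simp add: \<beta> \<gamma> power2_eq_square)
  qed
  then have un: "\<alpha>^2 + \<beta> + \<gamma> = 1" by simp
  then have \<delta>: "\<delta> = \<alpha>^2" using assms(13) by simp
  have T: "trace_defect p e y \<nu> = - P_H (real n) x \<beta> \<gamma> / ((real n + 2)^2 * (1 + x) ^ 4)"
    using trace_defect_eq[OF assms(3) U(2) V(3,2) \<nu>[unfolded \<sigma>_def]] un
    unfolding y assms(6) \<beta> \<gamma> \<sigma>_def by simp
  have x: "x > 0" using r by (simp add: assms(6))
  have n4: "real n \<ge> 4"
  proof -
    have "1 \<le> CARD('m)" by (simp add: Suc_leI)
    then have "4 \<le> n" using assms(1) by simp
    then show ?thesis by simp
  qed
  have "\<beta> \<ge> 0" "\<gamma> \<ge> 0" using \<sigma> by (simp_all add: \<beta> \<gamma> G_nonneg)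
  moreover from this have "1 - \<beta> - \<gamma> \<ge> 0" using un zero_le_power2[of \<alpha>] by linarith
  ultimately have P: "P_H (real n) x \<beta> \<gamma> \<ge> 0" "P_H (real n) x \<beta> \<gamma> = 0 \<longleftrightarrow> \<beta> = 0 \<and> \<gamma> = 0"
    using P_H_nonneg[OF n4 x] by blast+
  have D: "(real n + 2)^2 * (1 + x) ^ 4 > 0" using x by (simp add: add_pos_pos)
  show ?thesis
  proof (intro conjI)
    show "\<delta> = \<alpha>^2" by (rule \<delta>)
    show "trace_defect p e y \<nu> = - P_H (real n) x \<beta> \<gamma> / ((real n + 2)^2 * (1 + x) ^ 4)" by (rule T)
    show "trace_defect p e y \<nu> \<le> 0" unfolding T using P(1) D by (simp add: divide_nonpos_pos)
    show "trace_defect p e y \<nu> = 0 \<longleftrightarrow> \<beta> = 0 \<and> \<gamma> = 0"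
      unfolding T P(2)[symmetric] using x by simp
  qed
qed

end
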